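(* Let $n\ge 2$, let $a_0,\dots,a_n\ge 0$ be constants with $a_0,a_n\neq 0$, let $G$ be the Sobolev-type metric of order $n$ with constant coefficients on $\mathrm{Imm}(S^1,\mathbb{R}^2)$, $$G_c(h,k)=\int_{S^1}\sum_{j=0}^n a_j\langle D_s^jh,D_s^jk\rangle\,ds,$$ and let $\mathrm{dist}^G$ be the induced geodesic distance. If $0\leq k\leq n-2$, then the functions $$c\mapsto D_s^k(\kappa)\sqrt{|c'|} : (\mathrm{Imm}(S^1,\mathbb{R}^2),\mathrm{dist}^G)\to L^2(S^1,\mathbb{R}),$$ $$c\mapsto D_s^{k+1}(\log|c'|)\sqrt{|c'|} : (\mathrm{Imm}(S^1,\mathbb{R}^2),\mathrm{dist}^G)\to L^2(S^1,\mathbb{R})$$ are continuous, and Lipschitz continuous on every metric ball.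
   Context: $S^1=\mathbb{R}/2\pi\mathbb{Z}$ with parameter $\theta$; a prime denotes $\partial_\theta$. $\mathrm{Imm}(S^1,\mathbb{R}^2)=\{c\in C^\infty(S^1,\mathbb{R}^2): c'(\theta)\neq 0 \text{ for all }\theta\}$, with $T_c\mathrm{Imm}(S^1,\mathbb{R}^2)\cong C^\infty(S^1,\mathbb{R}^2)$. For a curve $c$: $D_s=\frac{1}{|c'|}\partial_\theta$, $ds=|c'|\,d\theta$, $v=c'/|c'|$, and the curvature is $\kappa=\langle D_sv,Jv\rangle$, where $J$ is rotation by $\pi/2$. $L^2(S^1,\mathbb{R})$ carries the norm $\|u\|_{L^2(d\theta)}^2=\int_{S^1}|u|^2\,d\theta$. The geodesic distance is $\mathrm{dist}^G(c_1,c_2)=\inf_c\mathrm{Len}^G(c)$, the infimum over smooth paths $c:[0,1]\to\mathrm{Imm}(S^1,\mathbb{R}^2)$ from $c_1$ to $c_2$ of $\mathrm{Len}^G(c)=\int_0^1\sqrt{G_{c}(c_t,c_t)}\,dt$ (it is $+\infty$ if there is no such path). A metric ball is a set $\{c:\mathrm{dist}^G(c_0,c)<N\}$ with $c_0\in\mathrm{Imm}(S^1,\mathbb{R}^2)$ and $N>0$. *)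

theory Defs
  imports "HOL-Analysis.Analysis"
begin

(* Functions on the circle R / 2 pi Z are represented by functions on the reals with period 2 pi;
   integrals over the circle are integrals over {0..2*pi}. *)
definition circle_fun :: "(real \<Rightarrow> 'a) \<Rightarrow> bool" where
  "circle_fun f \<longleftrightarrow> (\<forall>\<theta>. f (\<theta> + 2 * pi) = f \<theta>)"

definition dtheta :: "(real \<Rightarrow> 'a::real_normed_vector) \<Rightarrow> real \<Rightarrow> 'a" where
  "dtheta f \<theta> = vector_derivative f (at \<theta>)"

definition smooth :: "(real \<Rightarrow> 'a::real_normed_vector) \<Rightarrow> bool" where
  "smooth f \<longleftrightarrow> (\<forall>k \<theta>. (dtheta ^^ k) f differentiable (at \<theta>))"

definition Imm :: "(real \<Rightarrow> real ^ 2) set" where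
  "Imm = {c. circle_fun c \<and> smooth c \<and> (\<forall>\<theta>. dtheta c \<theta> \<noteq> 0)}"

definition Ds :: "(real \<Rightarrow> real ^ 2) \<Rightarrow> (real \<Rightarrow> 'a::real_normed_vector) \<Rightarrow> real \<Rightarrow> 'a" where
  "Ds c f \<theta> = (1 / norm (dtheta c \<theta>)) *\<^sub>R dtheta f \<theta>"

definition tangent :: "(real \<Rightarrow> real ^ 2) \<Rightarrow> real \<Rightarrow> real ^ 2" where
  "tangent c \<theta> = (1 / norm (dtheta c \<theta>)) *\<^sub>R dtheta c \<theta>"

definition J :: "real ^ 2 \<Rightarrow> real ^ 2" where
  "J x = vector [- (x $ 2), x $ 1]"

definition curvature :: "(real \<Rightarrow> real ^ 2) \<Rightarrow> real \<Rightarrow> real" where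
  "curvature c \<theta> = Ds c (tangent c) \<theta> \<bullet> J (tangent c \<theta>)"

definition sobolev_metric ::
    "nat \<Rightarrow> (nat \<Rightarrow> real) \<Rightarrow> (real \<Rightarrow> real ^ 2) \<Rightarrow> (real \<Rightarrow> real ^ 2) \<Rightarrow> (real \<Rightarrow> real ^ 2) \<Rightarrow> real" where
  "sobolev_metric n a c h k =
     integral {0..2 * pi}
       (\<lambda>\<theta>. (\<Sum>j\<le>n. a j * ((Ds c ^^ j) h \<theta> \<bullet> (Ds c ^^ j) k \<theta>)) * norm (dtheta c \<theta>))"

(* A path of curves is a function c of (t, \<theta>) with t in {0..1}. The t-derivative is taken
   within {0..1}, hence one-sided at the endpoints, and no value of c outside {0..1} matters. *)
definition path_dt :: "(real \<Rightarrow> real \<Rightarrow> 'a::real_normed_vector) \<Rightarrow> real \<Rightarrow> real \<Rightarrow> 'a" where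
  "path_dt c t \<theta> = vector_derivative (\<lambda>s. c s \<theta>) (at t within {0..1})"

definition path_dtheta :: "(real \<Rightarrow> real \<Rightarrow> 'a::real_normed_vector) \<Rightarrow> real \<Rightarrow> real \<Rightarrow> 'a" where
  "path_dtheta c t = dtheta (c t)"

primrec path_Ck :: "nat \<Rightarrow> (real \<Rightarrow> real \<Rightarrow> 'a::real_normed_vector) \<Rightarrow> bool" where
  "path_Ck 0 c \<longleftrightarrow> continuous_on ({0..1} \<times> UNIV) (\<lambda>(t, \<theta>). c t \<theta>)"
| "path_Ck (Suc m) c \<longleftrightarrow>
     (\<forall>t\<in>{0..1}. \<forall>\<theta>. (\<lambda>s. c s \<theta>) differentiable (at t within {0..1}) \<and>
                    c t differentiable (at \<theta>)) \<and>
     path_Ck m (path_dt c) \<and> path_Ck m (path_dtheta c)"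

(* Smoothness of a path into Imm, an open subset of the Frechet space of smooth maps from the
   circle to the plane, is joint smoothness in (t, \<theta>). *)
definition smooth_paths ::
    "(real \<Rightarrow> real ^ 2) \<Rightarrow> (real \<Rightarrow> real ^ 2) \<Rightarrow> (real \<Rightarrow> real \<Rightarrow> real ^ 2) set" where
  "smooth_paths c1 c2 =
     {c. (\<forall>m. path_Ck m c) \<and> (\<forall>t\<in>{0..1}. c t \<in> Imm) \<and> c 0 = c1 \<and> c 1 = c2}"

definition path_len :: "nat \<Rightarrow> (nat \<Rightarrow> real) \<Rightarrow> (real \<Rightarrow> real \<Rightarrow> real ^ 2) \<Rightarrow> real" where
  "path_len n a c =
     integral {0..1} (\<lambda>t. sqrt (sobolev_metric n a (c t) (path_dt c t) (path_dt c t)))"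

(* The infimum of the empty set is \<infinity> in ereal. *)
definition geod_dist ::
    "nat \<Rightarrow> (nat \<Rightarrow> real) \<Rightarrow> (real \<Rightarrow> real ^ 2) \<Rightarrow> (real \<Rightarrow> real ^ 2) \<Rightarrow> ereal" where
  "geod_dist n a c1 c2 = (INF c\<in>smooth_paths c1 c2. ereal (path_len n a c))"

definition metric_ball ::
    "nat \<Rightarrow> (nat \<Rightarrow> real) \<Rightarrow> (real \<Rightarrow> real ^ 2) \<Rightarrow> real \<Rightarrow> (real \<Rightarrow> real ^ 2) set" where
  "metric_ball n a c0 N = {c \<in> Imm. geod_dist n a c0 c < ereal N}"

(* Elements of L2 are represented by functions, not by almost-everywhere classes. *)
definition L2_circle :: "(real \<Rightarrow> real) set" where
  "L2_circle = {u. circle_fun u \<and> set_borel_measurable lebesgue {0..2 * pi} u \<and>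
                   set_integrable lebesgue {0..2 * pi} (\<lambda>\<theta>. (u \<theta>)\<^sup>2)}"

definition L2_norm :: "(real \<Rightarrow> real) \<Rightarrow> real" where
  "L2_norm u = sqrt (LINT \<theta>:{0..2 * pi}|lebesgue. (u \<theta>)\<^sup>2)"

definition L2_dist :: "(real \<Rightarrow> real) \<Rightarrow> (real \<Rightarrow> real) \<Rightarrow> real" where
  "L2_dist u w = L2_norm (\<lambda>\<theta>. u \<theta> - w \<theta>)"

definition continuous_Imm_L2 ::
    "nat \<Rightarrow> (nat \<Rightarrow> real) \<Rightarrow> ((real \<Rightarrow> real ^ 2) \<Rightarrow> real \<Rightarrow> real) \<Rightarrow> bool" where
  "continuous_Imm_L2 n a F \<longleftrightarrow>
     (\<forall>c1\<in>Imm. \<forall>\<epsilon>>0. \<exists>\<delta>>0. \<forall>c2\<in>Imm.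
        geod_dist n a c1 c2 < ereal \<delta> \<longrightarrow> L2_dist (F c1) (F c2) < \<epsilon>)"

definition lipschitz_on_balls_Imm_L2 ::
    "nat \<Rightarrow> (nat \<Rightarrow> real) \<Rightarrow> ((real \<Rightarrow> real ^ 2) \<Rightarrow> real \<Rightarrow> real) \<Rightarrow> bool" where
  "lipschitz_on_balls_Imm_L2 n a F \<longleftrightarrow>
     (\<forall>c0\<in>Imm. \<forall>N>0. \<exists>L\<ge>0. \<forall>c1\<in>metric_ball n a c0 N. \<forall>c2\<in>metric_ball n a c0 N.
        ereal (L2_dist (F c1) (F c2)) \<le> ereal L * geod_dist n a c1 c2)"

definition curvature_map :: "nat \<Rightarrow> (real \<Rightarrow> real ^ 2) \<Rightarrow> real \<Rightarrow> real" where
  "curvature_map k c \<theta> = (Ds c ^^ k) (curvature c) \<theta> * sqrt (norm (dtheta c \<theta>))"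

definition log_speed_map :: "nat \<Rightarrow> (real \<Rightarrow> real ^ 2) \<Rightarrow> real \<Rightarrow> real" where
  "log_speed_map k c \<theta> =
     (Ds c ^^ (k + 1)) (\<lambda>\<phi>. ln (norm (dtheta c \<phi>))) \<theta> * sqrt (norm (dtheta c \<theta>))"

end

(*
  Along a smooth path c with velocity h = c_t, unit tangent v and q = <v, D_s h>, one has
  v_t = D_s h - q v,  kappa_t = <D_s^2 h, J v> - 2 q kappa  and  (D_s log|c'|)_t = D_s q - q D_s log|c'|.
  Differentiating these transport equations m times in arc length gives, for g one of the three
  quantities, a bound of the t-derivative of D_s^m g sqrt|c'| in L^2(d theta) by
  C sqrt(G(h,h)) (1 + ||D_s^m g||), where C depends only on norms of lower order; the weight sqrt|c'|
  contributes another term q/2.  Here ||D_s^j h|| for j <= n is controlled by sqrt(G(h,h)) through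
  interpolation between the orders 0 and n, and sup|D_s^j h| for 1 <= j < n by the length.
  Gronwall's inequality, applied order by order, bounds the norms of v, kappa and D_s log|c'| on
  paths of bounded length; then the t-derivatives are bounded by a multiple of sqrt(G(h,h)) and
  integrating over the path yields the Lipschitz estimate.
*)
theory Submission
  imports Defs
begin

section \<open>Smooth families of functions on the circle\<close>

text \<open>Gronwall's inequality covers paths of arbitrary length only if each rate is linear in
  the norm being estimated, so a product of two unknown top order factors must never occur. This is
  where |v| = 1 enters: if all derivatives fall on one factor, an undifferentiated v is bounded in
  sup by 1; in a mixed term one of the factors has lower order and is bounded already. The length of
  the curve is not bounded beforehand either. The squared L^2(ds) norm of v is the length, so order
  0 of the induction for v is the length bound on which all later sup bounds depend. The range k <=
  n - 2 comes from the sources <D_s^2 h, J v> and D_s q: both contain two derivatives of h, so D_s^k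
  of them has order k + 2, and the metric controls orders up to n. All constants are chosen before
  the path and depend only on bounds at its initial curve and on its length; otherwise they would
  not survive the infimum over paths. On a ball, the bounds at the centre are carried to every point
  along a short path.\<close>

text \<open>Variant of \<^const>\<open>path_Ck\<close> that is convenient for closure properties: the partial derivatives
  are quantified existentially, since \<^const>\<open>path_dt\<close> takes junk values for times outside
  \<open>{0..1}\<close>, and continuity is required at every level.\<close>

primrec joint_Ck :: "nat \<Rightarrow> (real \<Rightarrow> real \<Rightarrow> 'a::real_normed_vector) \<Rightarrow> bool" where
  "joint_Ck 0 g \<longleftrightarrow> continuous_on ({0..1} \<times> UNIV) (\<lambda>(t, \<theta>). g t \<theta>)"
| "joint_Ck (Suc m) g \<longleftrightarrow>
     continuous_on ({0..1} \<times> UNIV) (\<lambda>(t, \<theta>). g t \<theta>) \<and>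
     (\<exists>gt gx. (\<forall>t\<in>{0..1}. \<forall>\<theta>. ((\<lambda>s. g s \<theta>) has_vector_derivative gt t \<theta>) (at t within {0..1}) \<and>
                            (g t has_vector_derivative gx t \<theta>) (at \<theta>)) \<and>
              joint_Ck m gt \<and> joint_Ck m gx)"

lemma joint_Ck_continuous: "joint_Ck m g \<Longrightarrow> continuous_on ({0..1} \<times> UNIV) (\<lambda>(t, \<theta>). g t \<theta>)"
  by (cases m) auto

lemma joint_Ck_SucI:
  assumes "continuous_on ({0..1} \<times> UNIV) (\<lambda>(t, \<theta>). g t \<theta>)"
    and "\<And>t \<theta>. t \<in> {0..1} \<Longrightarrow> ((\<lambda>s. g s \<theta>) has_vector_derivative gt t \<theta>) (at t within {0..1})"
    and "\<And>t \<theta>. t \<in> {0..1} \<Longrightarrow> (g t has_vector_derivative gx t \<theta>) (at \<theta>)"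
    and "joint_Ck m gt" "joint_Ck m gx"
  shows "joint_Ck (Suc m) g"
  unfolding joint_Ck.simps using assms by blast

lemma joint_Ck_SucE:
  assumes "joint_Ck (Suc m) g"
  obtains gt gx where
    "continuous_on ({0..1} \<times> UNIV) (\<lambda>(t, \<theta>). g t \<theta>)"
    "\<And>t \<theta>. t \<in> {0..1} \<Longrightarrow> ((\<lambda>s. g s \<theta>) has_vector_derivative gt t \<theta>) (at t within {0..1})"
    "\<And>t \<theta>. t \<in> {0..1} \<Longrightarrow> (g t has_vector_derivative gx t \<theta>) (at \<theta>)"
    "joint_Ck m gt" "joint_Ck m gx"
  using assms unfolding joint_Ck.simps by blast

declare joint_Ck.simps(2) [simp del]

text \<open>Only times in \<open>{0..1}\<close> enter \<open>joint_Ck\<close>: the time derivative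
  is taken within that interval and the other clauses quantify over it. Junk values of
  \<open>path_dt\<close> at other times are therefore harmless.\<close>

lemma joint_Ck_cong:
  assumes "\<And>t \<theta>. t \<in> {0..1} \<Longrightarrow> f t \<theta> = g t \<theta>" "joint_Ck m f"
  shows "joint_Ck m g"
proof -
  have c: "continuous_on ({0..1} \<times> UNIV) (\<lambda>(t, \<theta>). g t \<theta>)"
    using joint_Ck_continuous[OF assms(2)] by (rule continuous_on_eq) (use assms(1) in auto)
  show ?thesis
  proof (cases m)
    case 0
    then show ?thesis using c by simp
  next
    case (Suc k)
    obtain ft fx where f:
      "\<And>t \<theta>. t \<in> {0..1} \<Longrightarrow> ((\<lambda>s. f s \<theta>) has_vector_derivative ft t \<theta>) (at t within {0..1})"
      "\<And>t \<theta>. t \<in> {0..1} \<Longrightarrow> (f t has_vector_derivative fx t \<theta>) (at \<theta>)"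
      "joint_Ck k ft" "joint_Ck k fx"
      by (rule joint_Ck_SucE[OF assms(2)[unfolded Suc]]) (rule that, assumption+)
    have e: "f t = g t" if "t \<in> {0..1}" for t
      using assms(1)[OF that] by auto
    show ?thesis unfolding Suc
    proof (rule joint_Ck_SucI[OF c _ _ f(3,4)])
      fix t \<theta> :: real assume t: "t \<in> {0..1}"
      show "((\<lambda>s. g s \<theta>) has_vector_derivative ft t \<theta>) (at t within {0..1})"
        by (rule has_vector_derivative_transform[OF t _ f(1)[OF t]]) (simp add: assms(1))
      show "(g t has_vector_derivative fx t \<theta>) (at \<theta>)"
        using f(2)[OF t] e[OF t] by simp
    qed
  qed
qed

lemma joint_Ck_SucD: "joint_Ck (Suc m) g \<Longrightarrow> joint_Ck m g"
proof (induction m arbitrary: g)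
  case 0
  then show ?case by (simp add: joint_Ck_continuous)
next
  case (Suc m)
  show ?case
    by (rule joint_Ck_SucE[OF Suc.prems], rule joint_Ck_SucI, assumption+) (auto intro: Suc.IH)
qed

lemma joint_Ck_add: "joint_Ck m f \<Longrightarrow> joint_Ck m g \<Longrightarrow> joint_Ck m (\<lambda>t \<theta>. f t \<theta> + g t \<theta>)"
proof (induction m arbitrary: f g)
  case 0
  then show ?case by (auto simp: case_prod_beta intro!: continuous_intros)
next
  case (Suc m)
  obtain ft fx where f: "continuous_on ({0..1} \<times> UNIV) (\<lambda>(t, \<theta>). f t \<theta>)"
    "\<And>t \<theta>. t \<in> {0..1} \<Longrightarrow> ((\<lambda>s. f s \<theta>) has_vector_derivative ft t \<theta>) (at t within {0..1})"
    "\<And>t \<theta>. t \<in> {0..1} \<Longrightarrow> (f t has_vector_derivative fx t \<theta>) (at \<theta>)"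
    "joint_Ck m ft" "joint_Ck m fx"
    by (rule joint_Ck_SucE[OF Suc.prems(1)]) (rule that, assumption+)
  obtain gt gx where g: "continuous_on ({0..1} \<times> UNIV) (\<lambda>(t, \<theta>). g t \<theta>)"
    "\<And>t \<theta>. t \<in> {0..1} \<Longrightarrow> ((\<lambda>s. g s \<theta>) has_vector_derivative gt t \<theta>) (at t within {0..1})"
    "\<And>t \<theta>. t \<in> {0..1} \<Longrightarrow> (g t has_vector_derivative gx t \<theta>) (at \<theta>)"
    "joint_Ck m gt" "joint_Ck m gx"
    by (rule joint_Ck_SucE[OF Suc.prems(2)]) (rule that, assumption+)
  show ?case
    by (rule joint_Ck_SucI[where gt = "\<lambda>t \<theta>. ft t \<theta> + gt t \<theta>" and gx = "\<lambda>t \<theta>. fx t \<theta> + gx t \<theta>"])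
      (use f g in \<open>auto simp: case_prod_beta intro!: continuous_intros has_vector_derivative_add Suc.IH\<close>)
qed

lemma joint_Ck_bilinear:
  assumes "bounded_bilinear B"
  shows "joint_Ck m f \<Longrightarrow> joint_Ck m g \<Longrightarrow> joint_Ck m (\<lambda>t \<theta>. B (f t \<theta>) (g t \<theta>))"
proof (induction m arbitrary: f g)
  case 0
  then show ?case by (auto simp: case_prod_beta intro!: bounded_bilinear.continuous_on[OF assms])
next
  case (Suc m)
  obtain ft fx where f: "continuous_on ({0..1} \<times> UNIV) (\<lambda>(t, \<theta>). f t \<theta>)"
    "\<And>t \<theta>. t \<in> {0..1} \<Longrightarrow> ((\<lambda>s. f s \<theta>) has_vector_derivative ft t \<theta>) (at t within {0..1})"
    "\<And>t \<theta>. t \<in> {0..1} \<Longrightarrow> (f t has_vector_derivative fx t \<theta>) (at \<theta>)"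
    "joint_Ck m ft" "joint_Ck m fx"
    by (rule joint_Ck_SucE[OF Suc.prems(1)]) (rule that, assumption+)
  obtain gt gx where g: "continuous_on ({0..1} \<times> UNIV) (\<lambda>(t, \<theta>). g t \<theta>)"
    "\<And>t \<theta>. t \<in> {0..1} \<Longrightarrow> ((\<lambda>s. g s \<theta>) has_vector_derivative gt t \<theta>) (at t within {0..1})"
    "\<And>t \<theta>. t \<in> {0..1} \<Longrightarrow> (g t has_vector_derivative gx t \<theta>) (at \<theta>)"
    "joint_Ck m gt" "joint_Ck m gx"
    by (rule joint_Ck_SucE[OF Suc.prems(2)]) (rule that, assumption+)
  show ?case
  proof (rule joint_Ck_SucI[where gt = "\<lambda>t \<theta>. B (f t \<theta>) (gt t \<theta>) + B (ft t \<theta>) (g t \<theta>)"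
        and gx = "\<lambda>t \<theta>. B (f t \<theta>) (gx t \<theta>) + B (fx t \<theta>) (g t \<theta>)"])
    show "continuous_on ({0..1} \<times> UNIV) (\<lambda>(t, \<theta>). B (f t \<theta>) (g t \<theta>))"
      using f(1) g(1) by (auto simp: case_prod_beta intro!: bounded_bilinear.continuous_on[OF assms])
    show "joint_Ck m (\<lambda>t \<theta>. B (f t \<theta>) (gt t \<theta>) + B (ft t \<theta>) (g t \<theta>))"
      "joint_Ck m (\<lambda>t \<theta>. B (f t \<theta>) (gx t \<theta>) + B (fx t \<theta>) (g t \<theta>))"
      using Suc.prems[THEN joint_Ck_SucD] f(4,5) g(4,5) by (auto intro!: joint_Ck_add Suc.IH)
  qed (use f(2,3) g(2,3) in \<open>auto intro!: bounded_bilinear.has_vector_derivative[OF assms]\<close>)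
qed

lemma joint_Ck_const: "joint_Ck m (\<lambda>t \<theta>. a)"
proof (induction m arbitrary: a)
  case 0
  then show ?case by (simp add: case_prod_beta)
next
  case (Suc m)
  show ?case
    by (rule joint_Ck_SucI[where gt = "\<lambda>t \<theta>. 0" and gx = "\<lambda>t \<theta>. 0"]) (auto simp: case_prod_beta Suc)
qed

lemma joint_Ck_linear:
  assumes "bounded_linear L" "joint_Ck m f"
  shows "joint_Ck m (\<lambda>t \<theta>. L (f t \<theta>))"
proof -
  \<comment> \<open>A linear map is the bilinear map \<open>x *\<^sub>R L y\<close> at
    \<open>x = 1\<close>, so the product rule covers it.\<close>
  have "bounded_bilinear (\<lambda>(x::real) y. x *\<^sub>R L y)"
    using bounded_bilinear.comp[OF bounded_bilinear_scaleR bounded_linear_ident assms(1)] .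
  from joint_Ck_bilinear[OF this joint_Ck_const[of m 1] assms(2)] show ?thesis by simp
qed

lemma has_vector_derivative_powr:
  fixes g :: "real \<Rightarrow> real"
  assumes "(g has_vector_derivative g') (at x within S)" "g x > 0"
  shows "((\<lambda>x. g x powr a) has_vector_derivative a * (g x powr (a - 1) * g')) (at x within S)"
  using DERIV_chain2[where f = "\<lambda>z. z powr a" and g = g, OF has_real_derivative_powr[OF assms(2)]] assms(1)
  by (simp add: has_real_derivative_iff_has_vector_derivative mult.assoc)

lemma has_vector_derivative_ln:
  fixes g :: "real \<Rightarrow> real"
  assumes "(g has_vector_derivative g') (at x within S)" "g x > 0"
  shows "((\<lambda>x. ln (g x)) has_vector_derivative g x powr (-1) * g') (at x within S)"
  using DERIV_chain2[where f = ln and g = g, OF DERIV_ln_divide[OF assms(2)]] assms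
  by (simp add: has_real_derivative_iff_has_vector_derivative powr_minus_divide)

text \<open>Differentiation lowers the exponent to \<open>a - 1\<close>, so the induction ranges
  over all real exponents. Reciprocals (\<open>-1\<close>) and square roots (\<open>1/2\<close>)
  then come from one statement.\<close>

lemma joint_Ck_powr:
  fixes f :: "real \<Rightarrow> real \<Rightarrow> real"
  assumes pos: "\<And>t \<theta>. t \<in> {0..1} \<Longrightarrow> f t \<theta> > 0"
  shows "joint_Ck m f \<Longrightarrow> joint_Ck m (\<lambda>t \<theta>. f t \<theta> powr a)"
proof (induction m arbitrary: a)
  case 0
  have "fst x \<in> {0..1} \<Longrightarrow> f (fst x) (snd x) \<noteq> 0" for x
    using pos[of "fst x" "snd x"] by auto
  then show ?case using 0 by (auto simp: case_prod_beta intro!: continuous_intros)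
next
  case (Suc m)
  obtain ft fx where f: "continuous_on ({0..1} \<times> UNIV) (\<lambda>(t, \<theta>). f t \<theta>)"
    "\<And>t \<theta>. t \<in> {0..1} \<Longrightarrow> ((\<lambda>s. f s \<theta>) has_vector_derivative ft t \<theta>) (at t within {0..1})"
    "\<And>t \<theta>. t \<in> {0..1} \<Longrightarrow> (f t has_vector_derivative fx t \<theta>) (at \<theta>)"
    "joint_Ck m ft" "joint_Ck m fx"
    by (rule joint_Ck_SucE[OF Suc.prems(1)]) (rule that, assumption+)
  have nz: "fst x \<in> {0..1} \<Longrightarrow> f (fst x) (snd x) \<noteq> 0" for x
    using pos[of "fst x" "snd x"] by auto
  note mult = joint_Ck_bilinear[OF bounded_bilinear_mult]
  show ?case
  proof (rule joint_Ck_SucI[where gt = "\<lambda>t \<theta>. a * (f t \<theta> powr (a - 1) * ft t \<theta>)"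
        and gx = "\<lambda>t \<theta>. a * (f t \<theta> powr (a - 1) * fx t \<theta>)"])
    show "continuous_on ({0..1} \<times> UNIV) (\<lambda>(t, \<theta>). f t \<theta> powr a)"
      using f(1) nz by (auto simp: case_prod_beta intro!: continuous_intros)
  qed (use f pos in \<open>auto intro!: has_vector_derivative_powr mult joint_Ck_const
         Suc.IH joint_Ck_SucD[OF Suc.prems]\<close>)
qed

text \<open>The partial derivatives of the logarithm are products with \<open>f powr (-1)\<close>,
  which \<open>joint_Ck_powr\<close> covers at every order. The proof reaches order
  \<open>Suc m\<close> directly and then drops one order.\<close>

lemma joint_Ck_ln:
  fixes f :: "real \<Rightarrow> real \<Rightarrow> real"
  assumes pos: "\<And>t \<theta>. t \<in> {0..1} \<Longrightarrow> f t \<theta> > 0" and "\<And>m. joint_Ck m f"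
  shows "joint_Ck m (\<lambda>t \<theta>. ln (f t \<theta>))"
proof -
  obtain ft fx where f: "continuous_on ({0..1} \<times> UNIV) (\<lambda>(t, \<theta>). f t \<theta>)"
    "\<And>t \<theta>. t \<in> {0..1} \<Longrightarrow> ((\<lambda>s. f s \<theta>) has_vector_derivative ft t \<theta>) (at t within {0..1})"
    "\<And>t \<theta>. t \<in> {0..1} \<Longrightarrow> (f t has_vector_derivative fx t \<theta>) (at \<theta>)"
    "joint_Ck m ft" "joint_Ck m fx"
    by (rule joint_Ck_SucE[OF assms(2)[of "Suc m"]]) (rule that, assumption+)
  have nz: "fst x \<in> {0..1} \<Longrightarrow> f (fst x) (snd x) \<noteq> 0" for x
    using pos[of "fst x" "snd x"] by auto
  show ?thesis
  proof (rule joint_Ck_SucD, rule joint_Ck_SucI[where gt = "\<lambda>t \<theta>. f t \<theta> powr (-1) * ft t \<theta>"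
        and gx = "\<lambda>t \<theta>. f t \<theta> powr (-1) * fx t \<theta>"])
    show "continuous_on ({0..1} \<times> UNIV) (\<lambda>(t, \<theta>). ln (f t \<theta>))"
      using f(1) nz by (auto simp: case_prod_beta intro!: continuous_intros)
  qed (use f pos in \<open>auto simp del: powr_neg_one' intro!: has_vector_derivative_ln joint_Ck_bilinear[OF bounded_bilinear_mult]
         joint_Ck_powr assms(2)\<close>)
qed

section \<open>Smooth paths of periodic functions\<close>

definition smooth_loops :: "(real \<Rightarrow> real \<Rightarrow> 'a::real_normed_vector) \<Rightarrow> bool" where
  "smooth_loops g \<longleftrightarrow> (\<forall>m. joint_Ck m g) \<and> (\<forall>t\<in>{0..1}. circle_fun (g t))"

lemma path_dt_eq:
  assumes "((\<lambda>s. g s \<theta>) has_vector_derivative d) (at t within {0..1})" "t \<in> {0..1}"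
  shows "path_dt g t \<theta> = d"
  using vector_derivative_within_cbox[of 0 1 t "\<lambda>s. g s \<theta>" d] assms by (simp add: path_dt_def)

lemma path_dtheta_eq: "(g t has_vector_derivative d) (at \<theta>) \<Longrightarrow> path_dtheta g t \<theta> = d"
  by (simp add: path_dtheta_def dtheta_def vector_derivative_at)

lemma smooth_loops_has_dt:
  assumes "smooth_loops g" "t \<in> {0..1}"
  shows "((\<lambda>s. g s \<theta>) has_vector_derivative path_dt g t \<theta>) (at t within {0..1})"
proof -
  have "joint_Ck (Suc 0) g" using assms by (simp only: smooth_loops_def)
  then have "(\<lambda>s. g s \<theta>) differentiable (at t within {0..1})"
    unfolding joint_Ck.simps using assms(2) differentiableI_vector by metis
  then show ?thesis by (simp add: path_dt_def vector_derivative_works)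
qed

lemma smooth_loops_has_dtheta:
  assumes "smooth_loops g" "t \<in> {0..1}"
  shows "(g t has_vector_derivative path_dtheta g t \<theta>) (at \<theta>)"
proof -
  have "joint_Ck (Suc 0) g" using assms by (simp only: smooth_loops_def)
  then have "g t differentiable (at \<theta>)"
    unfolding joint_Ck.simps using assms(2) differentiableI_vector by metis
  then show ?thesis by (simp add: path_dtheta_def dtheta_def vector_derivative_works)
qed

text \<open>For times in \<open>{0..1}\<close> derivatives are unique, so the existentially chosen
  partials agree there with \<open>path_dt\<close> and \<open>path_dtheta\<close>;
  \<open>joint_Ck_cong\<close> does the rest.\<close>

lemma joint_Ck_partials:
  assumes "joint_Ck (Suc m) g"
  shows "joint_Ck m (path_dt g)" "joint_Ck m (path_dtheta g)"
proof -
  obtain gt gx where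
    g: "\<And>t \<theta>. t \<in> {0..1} \<Longrightarrow> ((\<lambda>s. g s \<theta>) has_vector_derivative gt t \<theta>) (at t within {0..1})"
    "\<And>t \<theta>. t \<in> {0..1} \<Longrightarrow> (g t has_vector_derivative gx t \<theta>) (at \<theta>)"
    "joint_Ck m gt" "joint_Ck m gx"
    by (rule joint_Ck_SucE[OF assms]) (rule that, assumption+)
  show "joint_Ck m (path_dt g)"
    by (rule joint_Ck_cong[OF _ g(3)]) (use path_dt_eq[OF g(1)] in auto)
  show "joint_Ck m (path_dtheta g)"
    by (rule joint_Ck_cong[OF _ g(4)]) (use path_dtheta_eq[OF g(2)] in auto)
qed

lemma circle_fun_dtheta:
  assumes "circle_fun f" "\<And>\<theta>. (f has_vector_derivative f' \<theta>) (at \<theta>)"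
  shows "circle_fun f'"
proof -
  have "f' (\<theta> + 2 * pi) = f' \<theta>" for \<theta>
  proof -
    have "((\<lambda>x. f (x + 2 * pi)) has_vector_derivative f' (\<theta> + 2 * pi)) (at \<theta>)"
      using vector_diff_chain_at[of "\<lambda>x. x + 2 * pi" 1 \<theta> f "f' (\<theta> + 2 * pi)"]
        assms(2) has_vector_derivative_add_const[of "\<lambda>x. x" "2 * pi" 1 "at \<theta>"] by (simp add: o_def)
    moreover have "(\<lambda>x. f (x + 2 * pi)) = f" using assms(1) by (auto simp: circle_fun_def)
    ultimately show ?thesis using assms(2) vector_derivative_unique_at by metis
  qed
  then show ?thesis by (simp add: circle_fun_def)
qed

lemma smooth_loops_dtheta:
  assumes "smooth_loops g" shows "smooth_loops (path_dtheta g)"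
proof -
  have "circle_fun (path_dtheta g t)" if "t \<in> {0..1}" for t
    by (rule circle_fun_dtheta[of "g t"])
      (use that assms smooth_loops_has_dtheta[OF assms that] in \<open>auto simp: smooth_loops_def\<close>)
  then show ?thesis
    using assms joint_Ck_partials(2) unfolding smooth_loops_def by blast
qed

lemma smooth_loops_dt:
  assumes "smooth_loops g" shows "smooth_loops (path_dt g)"
proof -
  have "path_dt g t (\<theta> + 2 * pi) = path_dt g t \<theta>" if t: "t \<in> {0..1}" for t \<theta>
  proof -
    have "((\<lambda>s. g s (\<theta> + 2 * pi)) has_vector_derivative path_dt g t \<theta>) (at t within {0..1})"
      by (rule has_vector_derivative_transform[OF t _ smooth_loops_has_dt[OF assms t]])
        (use assms in \<open>auto simp: smooth_loops_def circle_fun_def\<close>)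
    then show ?thesis using path_dt_eq[of g "\<theta> + 2 * pi"] t by blast
  qed
  then show ?thesis
    using assms joint_Ck_partials(1) unfolding smooth_loops_def circle_fun_def by blast
qed

lemma smooth_loops_continuous:
  "smooth_loops g \<Longrightarrow> continuous_on ({0..1} \<times> UNIV) (\<lambda>(t, \<theta>). g t \<theta>)"
  unfolding smooth_loops_def using joint_Ck_continuous by blast

lemma smooth_loops_continuous_theta:
  assumes "smooth_loops g" "t \<in> {0..1}" shows "continuous_on S (g t)"
  using smooth_loops_has_dtheta[OF assms]
  by (meson continuous_at_imp_continuous_on has_vector_derivative_continuous)

lemma smooth_loops_cong:
  "(\<And>t \<theta>. t \<in> {0..1} \<Longrightarrow> f t \<theta> = g t \<theta>) \<Longrightarrow> smooth_loops f \<Longrightarrow> smooth_loops g"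
  using joint_Ck_cong[of f g] unfolding smooth_loops_def circle_fun_def by metis

lemma smooth_loops_add: "smooth_loops f \<Longrightarrow> smooth_loops g \<Longrightarrow> smooth_loops (\<lambda>t \<theta>. f t \<theta> + g t \<theta>)"
  by (simp add: smooth_loops_def joint_Ck_add circle_fun_def)

lemma smooth_loops_bilinear:
  "bounded_bilinear B \<Longrightarrow> smooth_loops f \<Longrightarrow> smooth_loops g \<Longrightarrow> smooth_loops (\<lambda>t \<theta>. B (f t \<theta>) (g t \<theta>))"
  by (simp add: smooth_loops_def joint_Ck_bilinear circle_fun_def)

lemmas smooth_loops_scaleR = smooth_loops_bilinear[OF bounded_bilinear_scaleR]
lemmas smooth_loops_mult = smooth_loops_bilinear[OF bounded_bilinear_mult]
lemmas smooth_loops_inner = smooth_loops_bilinear[OF bounded_bilinear_inner]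

lemma smooth_loops_const: "smooth_loops (\<lambda>t \<theta>. a)"
  by (simp add: smooth_loops_def joint_Ck_const circle_fun_def)

lemma smooth_loops_linear: "bounded_linear L \<Longrightarrow> smooth_loops f \<Longrightarrow> smooth_loops (\<lambda>t \<theta>. L (f t \<theta>))"
  by (simp add: smooth_loops_def joint_Ck_linear circle_fun_def)

lemma smooth_loops_sum:
  "(\<And>i. i \<in> A \<Longrightarrow> smooth_loops (f i)) \<Longrightarrow> smooth_loops (\<lambda>t \<theta>. \<Sum>i\<in>A. f i t \<theta>)"
  by (induction A rule: infinite_finite_induct) (auto simp: smooth_loops_const smooth_loops_add)

lemma smooth_loops_powr:
  fixes f :: "real \<Rightarrow> real \<Rightarrow> real"
  assumes "\<And>t \<theta>. t \<in> {0..1} \<Longrightarrow> f t \<theta> > 0" "smooth_loops f"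
  shows "smooth_loops (\<lambda>t \<theta>. f t \<theta> powr a)"
  using assms joint_Ck_powr[of f] by (simp add: smooth_loops_def circle_fun_def)

lemma smooth_loops_ln:
  fixes f :: "real \<Rightarrow> real \<Rightarrow> real"
  assumes "\<And>t \<theta>. t \<in> {0..1} \<Longrightarrow> f t \<theta> > 0" "smooth_loops f"
  shows "smooth_loops (\<lambda>t \<theta>. ln (f t \<theta>))"
  using assms joint_Ck_ln[of f] by (simp add: smooth_loops_def circle_fun_def)

text \<open>\<open>path_Ck (Suc m)\<close> records joint continuity only of the partials of highest
  order, while \<open>joint_Ck\<close> wants it at every level. Hence the hypothesis for all orders,
  whose order 0 supplies the continuity of \<open>g\<close> itself.\<close>

lemma joint_Ck_path:
  assumes "\<And>m. path_Ck m g"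
  shows "joint_Ck m g"
  using assms
proof (induction m arbitrary: g)
  case 0
  then show ?case by (metis joint_Ck.simps(1) path_Ck.simps(1))
next
  case (Suc m)
  have p: "path_Ck (Suc k) g" for k by (rule Suc.prems)
  show ?case
  proof (rule joint_Ck_SucI[where gt = "path_dt g" and gx = "path_dtheta g"])
    show "continuous_on ({0..1} \<times> UNIV) (\<lambda>(t, \<theta>). g t \<theta>)" using Suc.prems[of 0] by simp
    show "joint_Ck m (path_dt g)" "joint_Ck m (path_dtheta g)" using p by (auto intro!: Suc.IH)
  qed (use p[of 0] in \<open>auto simp: path_dt_def path_dtheta_def dtheta_def vector_derivative_works\<close>)
qed

lemma smooth_loops_path:
  assumes "c \<in> smooth_paths c1 c2" shows "smooth_loops c"
  using assms joint_Ck_path by (auto simp: smooth_loops_def smooth_paths_def Imm_def)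

lemma joint_Ck_constant_path:
  assumes "smooth f" shows "joint_Ck m (\<lambda>t. f)"
  using assms
proof (induction m arbitrary: f)
  case 0
  have "\<And>\<theta>. f differentiable (at \<theta>)" using 0 unfolding smooth_def by (metis funpow_0)
  then have "continuous_on UNIV f"
    by (simp add: continuous_at_imp_continuous_on differentiable_imp_continuous_within)
  then have "continuous_on ({0..1} \<times> UNIV) (\<lambda>x. f (snd x))"
    by (rule continuous_on_compose2) (auto intro: continuous_intros)
  then show ?case by (simp add: case_prod_beta)
next
  case (Suc m)
  have d: "\<And>\<theta>. f differentiable (at \<theta>)" using Suc.prems unfolding smooth_def by (metis funpow_0)
  then have "continuous_on UNIV f"
    by (simp add: continuous_at_imp_continuous_on differentiable_imp_continuous_within)
  then have c: "continuous_on ({0..1::real} \<times> UNIV) (\<lambda>x. f (snd x))"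
    by (rule continuous_on_compose2) (auto intro: continuous_intros)
  have s: "smooth (dtheta f)"
    using Suc.prems unfolding smooth_def by (metis funpow_Suc_right comp_apply)
  show ?case
    by (rule joint_Ck_SucI[where gt = "\<lambda>t \<theta>. 0" and gx = "\<lambda>t. dtheta f"])
      (use c d s Suc.IH joint_Ck_const in \<open>auto simp: case_prod_beta dtheta_def vector_derivative_works[symmetric]\<close>)
qed

lemma smooth_loops_constant_path: "smooth f \<Longrightarrow> circle_fun f \<Longrightarrow> smooth_loops (\<lambda>t. f)"
  by (simp add: smooth_loops_def joint_Ck_constant_path)

lemma continuous_on_slice_theta:
  assumes "continuous_on ({0..1} \<times> UNIV) (\<lambda>(t, \<theta>). g t \<theta>)" "t \<in> {0..1}"
  shows "continuous_on S (g t)"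
proof -
  have "continuous_on S (\<lambda>\<theta>. (\<lambda>(t, \<theta>). g t \<theta>) (t, \<theta>))"
    by (rule continuous_on_compose2[OF assms(1)]) (use assms(2) in \<open>auto intro!: continuous_intros\<close>)
  then show ?thesis by simp
qed

text \<open>Makes the initial value a constant path, so that \<open>U t - U 0\<close> is again a
  smooth path in \<open>loop_norm_Lipschitz\<close>.\<close>

lemma joint_Ck_freeze:
  assumes "joint_Ck m g" "s \<in> {0..1}"
  shows "joint_Ck m (\<lambda>t. g s)"
  using assms(1)
proof (induction m arbitrary: g)
  case 0
  have "continuous_on ({0..1::real} \<times> UNIV) (\<lambda>x. g s (snd x))"
    by (rule continuous_on_compose2[OF continuous_on_slice_theta[OF _ assms(2), of g UNIV]])
      (use 0 in \<open>auto intro!: continuous_intros\<close>)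
  then show ?case by (simp add: case_prod_beta)
next
  case (Suc m)
  obtain gt gx where g: "continuous_on ({0..1} \<times> UNIV) (\<lambda>(t, \<theta>). g t \<theta>)"
    "\<And>t \<theta>. t \<in> {0..1} \<Longrightarrow> ((\<lambda>s. g s \<theta>) has_vector_derivative gt t \<theta>) (at t within {0..1})"
    "\<And>t \<theta>. t \<in> {0..1} \<Longrightarrow> (g t has_vector_derivative gx t \<theta>) (at \<theta>)"
    "joint_Ck m gt" "joint_Ck m gx"
    by (rule joint_Ck_SucE[OF Suc.prems(1)]) (rule that, assumption+)
  have "continuous_on ({0..1::real} \<times> UNIV) (\<lambda>x. g s (snd x))"
    by (rule continuous_on_compose2[OF continuous_on_slice_theta[OF g(1) assms(2), of UNIV]])
      (auto intro!: continuous_intros)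
  then show ?case
    by (intro joint_Ck_SucI[where gt = "\<lambda>t \<theta>. 0" and gx = "\<lambda>t. gx s"])
      (use g(3)[OF assms(2)] Suc.IH[OF g(5)] joint_Ck_const in \<open>auto simp: case_prod_beta\<close>)
qed

lemma smooth_loops_freeze: "smooth_loops g \<Longrightarrow> s \<in> {0..1} \<Longrightarrow> smooth_loops (\<lambda>t. g s)"
  by (simp add: smooth_loops_def joint_Ck_freeze)

text \<open>Since time derivatives are one-sided at 0 and 1, the symmetry is derived from integrals:
  \<open>g s x - g s a\<close> is the integral of the angular derivative, differentiation in
  \<open>s\<close> passes under the integral, and the fundamental theorem in \<open>x\<close> then
  identifies the angular derivative of \<open>path_dt g\<close>.\<close>

lemma path_dt_path_dtheta_commute:
  fixes g :: "real \<Rightarrow> real \<Rightarrow> 'a::euclidean_space"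
  assumes g: "smooth_loops g" and t: "t \<in> {0..1}"
  shows "path_dt (path_dtheta g) t \<theta> = path_dtheta (path_dt g) t \<theta>"
proof -
  let ?a = "\<theta> - 1" and ?b = "\<theta> + 1"
  let ?gx = "path_dtheta g" and ?gxt = "path_dt (path_dtheta g)"
  have gx: "smooth_loops ?gx" and gxt: "smooth_loops ?gxt"
    by (auto intro!: smooth_loops_dt smooth_loops_dtheta g)
  have ftc: "(?gx s has_integral (g s x - g s ?a)) {?a..x}" if "s \<in> {0..1}" "x \<ge> ?a" for s x
    by (rule fundamental_theorem_of_calculus)
      (use that in \<open>auto intro: has_vector_derivative_at_within[OF smooth_loops_has_dtheta[OF g]]\<close>)
  have dt: "path_dt g t x = path_dt g t ?a + integral {?a..x} (?gxt t)" if x: "x \<ge> ?a" for x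
  proof -
    have "((\<lambda>s. integral (cbox ?a x) (?gx s)) has_vector_derivative integral (cbox ?a x) (?gxt t))
        (at t within {0..1})"
    proof (rule leibniz_rule_vector_derivative)
      show "continuous_on ({0..1} \<times> cbox ?a x) (\<lambda>(x, t). ?gxt x t)"
        using smooth_loops_continuous[OF gxt] continuous_on_subset by blast
    qed (use t gx smooth_loops_has_dt in
        \<open>auto intro!: integrable_continuous_interval smooth_loops_continuous_theta\<close>)
    then have B: "((\<lambda>s. integral {?a..x} (?gx s)) has_vector_derivative integral {?a..x} (?gxt t))
        (at t within {0..1})" by simp
    have d1: "((\<lambda>s. g s x - g s ?a) has_vector_derivative integral {?a..x} (?gxt t)) (at t within {0..1})"
      by (intro has_vector_derivative_transform[OF t _ B]) (use integral_unique[OF ftc] x in simp)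
    have d2: "((\<lambda>s. g s x - g s ?a) has_vector_derivative path_dt g t x - path_dt g t ?a) (at t within {0..1})"
      by (intro has_vector_derivative_diff smooth_loops_has_dt g t)
    have "path_dt g t x - path_dt g t ?a = integral {?a..x} (?gxt t)"
      using path_dt_eq[where g = "\<lambda>s _. g s x - g s ?a", OF d1 t]
        path_dt_eq[where g = "\<lambda>s _. g s x - g s ?a", OF d2 t] by simp
    then show ?thesis by (simp add: algebra_simps)
  qed
  have "((\<lambda>x. integral {?a..x} (?gxt t)) has_vector_derivative ?gxt t \<theta>) (at \<theta> within {?a..?b})"
    by (rule integral_has_vector_derivative) (auto intro: smooth_loops_continuous_theta gxt t)
  from has_vector_derivative_add[OF has_vector_derivative_const this, of "path_dt g t ?a"]
  have "((\<lambda>x. path_dt g t ?a + integral {?a..x} (?gxt t)) has_vector_derivative ?gxt t \<theta>)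
      (at \<theta> within {?a..?b})" by simp
  then have "(path_dt g t has_vector_derivative ?gxt t \<theta>) (at \<theta> within {?a..?b})"
    by (rule has_vector_derivative_transform[rotated 2]) (auto intro: dt)
  then have "(path_dt g t has_vector_derivative ?gxt t \<theta>) (at \<theta>)"
    using at_within_Icc_at[of ?a \<theta> ?b] by simp
  then show ?thesis by (rule path_dtheta_eq[symmetric])
qed

section \<open>Arc-length derivatives along a path of immersions\<close>

definition path_Ds ::
    "(real \<Rightarrow> real \<Rightarrow> real ^ 2) \<Rightarrow> (real \<Rightarrow> real \<Rightarrow> 'a::real_normed_vector) \<Rightarrow> real \<Rightarrow> real \<Rightarrow> 'a" where
  "path_Ds c g t = Ds (c t) (g t)"

lemma path_Ds_funpow: "(path_Ds c ^^ m) g t = (Ds (c t) ^^ m) (g t)"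
  by (induction m) (auto simp: path_Ds_def)

text \<open>Pascal's rule for arbitrary coefficients. With binomial coefficients it gives the
  Leibniz formula, with \<open>transport_coeff\<close> the iterated commutator formula.\<close>

lemma sum_leibniz_shift:
  fixes X :: "nat \<Rightarrow> nat \<Rightarrow> 'a::real_vector"
  shows "(\<Sum>j\<le>m. b j *\<^sub>R (X (Suc j) (m - j) + X j (Suc (m - j)))) =
    (\<Sum>j\<le>Suc m. ((if j = 0 then 0 else b (j - 1)) + (if j \<le> m then b j else 0)) *\<^sub>R X j (Suc m - j))"
proof -
  have "(\<Sum>j\<le>Suc m. (if j = 0 then 0 else b (j - 1)) *\<^sub>R X j (Suc m - j)) =
      (\<Sum>j\<le>m. b j *\<^sub>R X (Suc j) (m - j))"
    by (subst sum.atMost_Suc_shift) simp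
  moreover have "(\<Sum>j\<le>Suc m. (if j \<le> m then b j else 0) *\<^sub>R X j (Suc m - j)) =
      (\<Sum>j\<le>m. b j *\<^sub>R X j (Suc (m - j)))"
    by (simp add: Suc_diff_le)
  ultimately show ?thesis
    by (simp only: scaleR_add_left sum.distrib scaleR_add_right)
qed

text \<open>Along a path of curves with velocity \<open>h\<close>, unit tangent \<open>v\<close> and \<open>q = \<langle>v, D\<^sub>s h\<rangle>\<close>, the commutator is
  \<open>[\<partial>\<^sub>t, D\<^sub>s] = - q D\<^sub>s\<close>. If \<open>\<partial>\<^sub>t g = r - lam q g\<close>, then \<open>transport_coeff lam m j\<close> is the coefficient of
  \<open>(D\<^sub>s\<^sup>j q) (D\<^sub>s\<^sup>m\<^sup>-\<^sup>j g)\<close> in \<open>\<partial>\<^sub>t D\<^sub>s\<^sup>m g - D\<^sub>s\<^sup>m r\<close>.\<close>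

primrec transport_coeff :: "real \<Rightarrow> nat \<Rightarrow> nat \<Rightarrow> real" where
  "transport_coeff lam 0 = (\<lambda>j. if j = 0 then - lam else 0)"
| "transport_coeff lam (Suc m) = (\<lambda>j.
     (if j = 0 then 0 else transport_coeff lam m (j - 1)) +
     (if j \<le> m then transport_coeff lam m j else 0) - (if j = 0 then 1 else 0))"

locale immersed_path =
  fixes c :: "real \<Rightarrow> real \<Rightarrow> real ^ 2"
  assumes smooth_path: "smooth_loops c"
    and immersed: "t \<in> {0..1} \<Longrightarrow> c t \<in> Imm"
begin

definition speed :: "real \<Rightarrow> real \<Rightarrow> real" where
  "speed t \<theta> = norm (dtheta (c t) \<theta>)"

abbreviation D :: "(real \<Rightarrow> real \<Rightarrow> 'a::real_normed_vector) \<Rightarrow> real \<Rightarrow> real \<Rightarrow> 'a" where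
  "D \<equiv> path_Ds c"

definition v :: "real \<Rightarrow> real \<Rightarrow> real ^ 2" where
  "v = D c"

definition h :: "real \<Rightarrow> real \<Rightarrow> real ^ 2" where
  "h = path_dt c"

text \<open>The relative rate of change of the length element: the time derivative of
  \<open>speed\<close> is \<open>q * speed\<close> (\<open>dt_speed\<close>). It is the factor in
  the commutator of the time derivative with \<open>D\<close>.\<close>

definition q :: "real \<Rightarrow> real \<Rightarrow> real" where
  "q t \<theta> = v t \<theta> \<bullet> D h t \<theta>"

lemma speed_pos: "t \<in> {0..1} \<Longrightarrow> speed t \<theta> > 0"
  using immersed[of t] by (auto simp: speed_def Imm_def)

lemma inner_dtheta_pos: "t \<in> {0..1} \<Longrightarrow> path_dtheta c t \<theta> \<bullet> path_dtheta c t \<theta> > 0"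
  using speed_pos[of t \<theta>] by (simp add: speed_def path_dtheta_def)

text \<open>The norm is not among the operations with a closure lemma; as a real power of a positive
  inner product it becomes one.\<close>

lemma speed_eq_powr:
  assumes "t \<in> {0..1}"
  shows "speed t \<theta> = (path_dtheta c t \<theta> \<bullet> path_dtheta c t \<theta>) powr (1/2)"
  using inner_dtheta_pos[OF assms]
  by (simp add: speed_def path_dtheta_def norm_eq_sqrt_inner powr_half_sqrt)

lemma smooth_speed: "smooth_loops speed"
  by (rule smooth_loops_cong[OF speed_eq_powr[symmetric]], assumption)
    (intro smooth_loops_powr smooth_loops_inner smooth_loops_dtheta smooth_path inner_dtheta_pos)

lemma smooth_sqrt_speed: "smooth_loops (\<lambda>t \<theta>. sqrt (speed t \<theta>))"
  by (rule smooth_loops_cong[OF powr_half_sqrt])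
    (auto intro!: smooth_loops_powr smooth_speed speed_pos less_imp_le[OF speed_pos])

lemma D_eq: "D g t \<theta> = (1 / speed t \<theta>) *\<^sub>R path_dtheta g t \<theta>"
  by (simp add: path_Ds_def Ds_def speed_def path_dtheta_def)

lemma smooth_D:
  assumes "smooth_loops g" shows "smooth_loops (D g)"
proof (rule smooth_loops_cong)
  show "smooth_loops (\<lambda>t \<theta>. (speed t \<theta> powr (-1)) *\<^sub>R path_dtheta g t \<theta>)"
    by (intro smooth_loops_scaleR smooth_loops_powr smooth_speed speed_pos smooth_loops_dtheta assms)
  show "(speed t \<theta> powr (-1)) *\<^sub>R path_dtheta g t \<theta> = D g t \<theta>" if "t \<in> {0..1}" for t \<theta>
    using speed_pos[OF that, of \<theta>] by (simp add: D_eq)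
qed

lemma smooth_D_funpow: "smooth_loops g \<Longrightarrow> smooth_loops ((D ^^ m) g)"
  by (induction m) (auto intro: smooth_D)

lemma smooth_v: "smooth_loops v"
  unfolding v_def by (intro smooth_D smooth_path)

lemma smooth_h: "smooth_loops h"
  unfolding h_def by (intro smooth_loops_dt smooth_path)

lemma smooth_q: "smooth_loops q"
  unfolding q_def by (intro smooth_loops_inner smooth_v smooth_D smooth_h)

lemma has_D:
  assumes "smooth_loops g" "t \<in> {0..1}"
  shows "(g t has_vector_derivative speed t \<theta> *\<^sub>R D g t \<theta>) (at \<theta>)"
  using smooth_loops_has_dtheta[OF assms, of \<theta>] speed_pos[OF assms(2), of \<theta>] by (simp add: D_eq)

lemma D_eqI:
  assumes "(g t has_vector_derivative speed t \<theta> *\<^sub>R d) (at \<theta>)" "t \<in> {0..1}"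
  shows "D g t \<theta> = d"
  using path_dtheta_eq[of g t, OF assms(1)] speed_pos[OF assms(2), of \<theta>] by (simp add: D_eq)

text \<open>\<open>D\<close> acts on each time slice separately, so an identity known only at one
  time may be rewritten under it. The inductions at fixed \<open>t\<close> below rely on
  this.\<close>

lemma D_cong: "(\<And>\<theta>. f t \<theta> = g t \<theta>) \<Longrightarrow> D f t = D g t"
  unfolding path_Ds_def by (metis ext)

lemma D_bilinear:
  assumes B: "bounded_bilinear B" and "smooth_loops f" "smooth_loops g" and t: "t \<in> {0..1}"
  shows "D (\<lambda>t \<theta>. B (f t \<theta>) (g t \<theta>)) t \<theta> = B (D f t \<theta>) (g t \<theta>) + B (f t \<theta>) (D g t \<theta>)"
proof (rule D_eqI[OF _ t])
  show "((\<lambda>\<theta>. B (f t \<theta>) (g t \<theta>)) has_vector_derivative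
      speed t \<theta> *\<^sub>R (B (D f t \<theta>) (g t \<theta>) + B (f t \<theta>) (D g t \<theta>))) (at \<theta>)"
    using bounded_bilinear.has_vector_derivative[OF B has_D[OF assms(2) t] has_D[OF assms(3) t], of \<theta>]
    by (simp add: bounded_bilinear.scaleR_left[OF B] bounded_bilinear.scaleR_right[OF B]
        scaleR_add_right add.commute)
qed

lemma D_add:
  assumes "smooth_loops f" "smooth_loops g" and t: "t \<in> {0..1}"
  shows "D (\<lambda>t \<theta>. f t \<theta> + g t \<theta>) t \<theta> = D f t \<theta> + D g t \<theta>"
  by (rule D_eqI[OF _ t])
    (use has_vector_derivative_add[OF has_D[OF assms(1) t] has_D[OF assms(2) t], of \<theta>] in
      \<open>simp add: scaleR_add_right\<close>)

lemma D_scaleR: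
  assumes "smooth_loops g" and t: "t \<in> {0..1}"
  shows "D (\<lambda>t \<theta>. a *\<^sub>R g t \<theta>) t \<theta> = a *\<^sub>R D g t \<theta>"
proof (rule D_eqI[OF _ t])
  show "((\<lambda>\<theta>. a *\<^sub>R g t \<theta>) has_vector_derivative speed t \<theta> *\<^sub>R a *\<^sub>R D g t \<theta>) (at \<theta>)"
    using bounded_linear.has_vector_derivative[OF bounded_linear_scaleR_right[of a] has_D[OF assms, of \<theta>]]
    by (simp add: mult.commute)
qed

lemma D_sum:
  assumes "\<And>i. i \<in> A \<Longrightarrow> smooth_loops (f i)" and t: "t \<in> {0..1}"
  shows "D (\<lambda>t \<theta>. \<Sum>i\<in>A. f i t \<theta>) t \<theta> = (\<Sum>i\<in>A. D (f i) t \<theta>)"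
proof (rule D_eqI[OF _ t])
  show "((\<lambda>\<theta>. \<Sum>i\<in>A. f i t \<theta>) has_vector_derivative speed t \<theta> *\<^sub>R (\<Sum>i\<in>A. D (f i) t \<theta>)) (at \<theta>)"
    unfolding scaleR_sum_right by (intro has_vector_derivative_sum has_D assms)
qed

lemma smooth_bilinear_Leibniz_term:
  assumes "bounded_bilinear B" "smooth_loops f" "smooth_loops g"
  shows "smooth_loops (\<lambda>t \<theta>. a *\<^sub>R B ((D ^^ i) f t \<theta>) ((D ^^ k) g t \<theta>))"
  by (intro smooth_loops_linear[OF bounded_linear_scaleR_right] smooth_loops_bilinear[OF assms(1)]
      smooth_D_funpow assms)

lemma D_Leibniz_sum:
  assumes B: "bounded_bilinear B" and f: "smooth_loops f" and g: "smooth_loops g" and t: "t \<in> {0..1}"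
  shows "D (\<lambda>t \<theta>. \<Sum>j\<le>m. b j *\<^sub>R B ((D ^^ j) f t \<theta>) ((D ^^ (m - j)) g t \<theta>)) t \<theta> =
    (\<Sum>j\<le>m. b j *\<^sub>R (B ((D ^^ Suc j) f t \<theta>) ((D ^^ (m - j)) g t \<theta>) +
       B ((D ^^ j) f t \<theta>) ((D ^^ Suc (m - j)) g t \<theta>)))"
proof -
  have "D (\<lambda>t \<theta>. b j *\<^sub>R B ((D ^^ j) f t \<theta>) ((D ^^ (m - j)) g t \<theta>)) t \<theta> =
      b j *\<^sub>R (B ((D ^^ Suc j) f t \<theta>) ((D ^^ (m - j)) g t \<theta>) +
       B ((D ^^ j) f t \<theta>) ((D ^^ Suc (m - j)) g t \<theta>))" for j
    using D_scaleR[OF smooth_loops_bilinear[OF B smooth_D_funpow[OF f, of j] smooth_D_funpow[OF g, of "m - j"]] t, of "b j" \<theta>]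
      D_bilinear[OF B smooth_D_funpow[OF f, of j] smooth_D_funpow[OF g, of "m - j"] t, of \<theta>]
    by simp
  then show ?thesis
    by (subst D_sum[OF smooth_bilinear_Leibniz_term[OF B f g] t]) simp
qed

lemma Leibniz_D:
  assumes B: "bounded_bilinear B" and f: "smooth_loops f" and g: "smooth_loops g" and t: "t \<in> {0..1}"
  shows "(D ^^ m) (\<lambda>t \<theta>. B (f t \<theta>) (g t \<theta>)) t \<theta> =
    (\<Sum>i\<le>m. real (m choose i) *\<^sub>R B ((D ^^ i) f t \<theta>) ((D ^^ (m - i)) g t \<theta>))"
proof (induction m arbitrary: \<theta>)
  case 0
  then show ?case by simp
next
  case (Suc m)
  let ?X = "\<lambda>i k. B ((D ^^ i) f t \<theta>) ((D ^^ k) g t \<theta>)"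
  have "(D ^^ Suc m) (\<lambda>t \<theta>. B (f t \<theta>) (g t \<theta>)) t \<theta> =
      D (\<lambda>t \<theta>. \<Sum>i\<le>m. real (m choose i) *\<^sub>R B ((D ^^ i) f t \<theta>) ((D ^^ (m - i)) g t \<theta>)) t \<theta>"
    unfolding funpow.simps comp_apply by (rule fun_cong[OF D_cong]) (rule Suc)
  also have "\<dots> = (\<Sum>i\<le>m. real (m choose i) *\<^sub>R (?X (Suc i) (m - i) + ?X i (Suc (m - i))))"
    by (rule D_Leibniz_sum[OF B f g t])
  also have "\<dots> = (\<Sum>i\<le>Suc m. real (Suc m choose i) *\<^sub>R ?X i (Suc m - i))"
    unfolding sum_leibniz_shift[of "\<lambda>i. real (m choose i)" ?X m]
    by (rule sum.cong) (auto simp: choose_reduce_nat not_le le_Suc_eq)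
  finally show ?case .
qed

section \<open>Time derivatives and the commutator with the arc-length derivative\<close>

lemma dt_speed:
  assumes t: "t \<in> {0..1}"
  shows "((\<lambda>s. speed s \<theta>) has_vector_derivative q t \<theta> * speed t \<theta>) (at t within {0..1})"
proof -
  let ?cx = "path_dtheta c"
  let ?u = "\<lambda>s. ?cx s \<theta> \<bullet> ?cx s \<theta>"
  have "((\<lambda>s. ?cx s \<theta>) has_vector_derivative path_dtheta h t \<theta>) (at t within {0..1})"
    using smooth_loops_has_dt[OF smooth_loops_dtheta[OF smooth_path] t, of \<theta>]
      path_dt_path_dtheta_commute[OF smooth_path t] by (simp add: h_def)
  from has_vector_derivative_powr[OF
      bounded_bilinear.has_vector_derivative[OF bounded_bilinear_inner this this] inner_dtheta_pos[OF t], of "1/2"]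
  have "((\<lambda>s. ?u s powr (1/2)) has_vector_derivative
      ?u t powr (-(1/2)) * (?cx t \<theta> \<bullet> path_dtheta h t \<theta>)) (at t within {0..1})"
    by (simp add: inner_commute algebra_simps)
  also have "?u t powr (-(1/2)) * (?cx t \<theta> \<bullet> path_dtheta h t \<theta>) = q t \<theta> * speed t \<theta>"
    using speed_pos[OF t, of \<theta>]
    by (simp add: q_def v_def D_eq speed_eq_powr[OF t, symmetric] powr_minus field_simps)
  finally show ?thesis
    by (rule has_vector_derivative_transform[OF t speed_eq_powr, rotated])
qed

text \<open>Differentiate \<open>speed * D g = path_dtheta g\<close> in time: the product rule acts
  on the left, the mixed partials commute on the right, and \<open>speed\<close> is cancelled at the
  end.\<close>

lemma dt_D:
  fixes g :: "real \<Rightarrow> real \<Rightarrow> 'a::euclidean_space"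
  assumes g: "smooth_loops g" and t: "t \<in> {0..1}"
  shows "path_dt (D g) t \<theta> = D (path_dt g) t \<theta> - q t \<theta> *\<^sub>R D g t \<theta>"
proof -
  have "((\<lambda>s. speed s \<theta> *\<^sub>R D g s \<theta>) has_vector_derivative
      speed t \<theta> *\<^sub>R path_dt (D g) t \<theta> + (q t \<theta> * speed t \<theta>) *\<^sub>R D g t \<theta>) (at t within {0..1})"
    by (rule bounded_bilinear.has_vector_derivative[OF bounded_bilinear_scaleR dt_speed[OF t]
          smooth_loops_has_dt[OF smooth_D[OF g] t]])
  moreover have "speed s \<theta> *\<^sub>R D g s \<theta> = path_dtheta g s \<theta>" if "s \<in> {0..1}" for s
    using speed_pos[OF that, of \<theta>] by (simp add: D_eq)
  ultimately have "((\<lambda>s. path_dtheta g s \<theta>) has_vector_derivative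
      speed t \<theta> *\<^sub>R path_dt (D g) t \<theta> + (q t \<theta> * speed t \<theta>) *\<^sub>R D g t \<theta>) (at t within {0..1})"
    using has_vector_derivative_transform[OF t, of "\<lambda>s. path_dtheta g s \<theta>"] by (metis (no_types, lifting))
  then have "path_dt (path_dtheta g) t \<theta> =
      speed t \<theta> *\<^sub>R path_dt (D g) t \<theta> + (q t \<theta> * speed t \<theta>) *\<^sub>R D g t \<theta>"
    using path_dt_eq[of "path_dtheta g" \<theta> _ t] t by blast
  moreover have "path_dt (path_dtheta g) t \<theta> = speed t \<theta> *\<^sub>R D (path_dt g) t \<theta>"
    using path_dt_path_dtheta_commute[OF g t, of \<theta>] speed_pos[OF t, of \<theta>] by (simp add: D_eq)
  ultimately have "speed t \<theta> *\<^sub>R (D (path_dt g) t \<theta> - q t \<theta> *\<^sub>R D g t \<theta>) = speed t \<theta> *\<^sub>R path_dt (D g) t \<theta>"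
    by (simp add: algebra_simps)
  then show ?thesis using speed_pos[OF t, of \<theta>] by simp
qed

lemma transport_D:
  fixes g r :: "real \<Rightarrow> real \<Rightarrow> 'a::euclidean_space"
  assumes g: "smooth_loops g" and r: "smooth_loops r"
    and eq: "\<And>t \<theta>. t \<in> {0..1} \<Longrightarrow> path_dt g t \<theta> = r t \<theta> - lam *\<^sub>R q t \<theta> *\<^sub>R g t \<theta>"
    and t: "t \<in> {0..1}"
  shows "path_dt ((D ^^ m) g) t \<theta> = (D ^^ m) r t \<theta> +
    (\<Sum>j\<le>m. transport_coeff lam m j *\<^sub>R ((D ^^ j) q t \<theta> *\<^sub>R (D ^^ (m - j)) g t \<theta>))"
proof (induction m arbitrary: \<theta>)
  case 0
  then show ?case using eq[OF t] by simp
next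
  case (Suc m)
  let ?X = "\<lambda>i k. (D ^^ i) q t \<theta> *\<^sub>R (D ^^ k) g t \<theta>"
  have sm: "smooth_loops (\<lambda>t \<theta>. \<Sum>j\<le>m. transport_coeff lam m j *\<^sub>R ((D ^^ j) q t \<theta> *\<^sub>R (D ^^ (m - j)) g t \<theta>))"
    by (rule smooth_loops_sum) (rule smooth_bilinear_Leibniz_term[OF bounded_bilinear_scaleR smooth_q g])
  have "path_dt ((D ^^ Suc m) g) t \<theta> = D (path_dt ((D ^^ m) g)) t \<theta> - q t \<theta> *\<^sub>R (D ^^ Suc m) g t \<theta>"
    using dt_D[OF smooth_D_funpow[OF g] t] by simp
  also have "D (path_dt ((D ^^ m) g)) t \<theta> = D (\<lambda>t \<theta>. (D ^^ m) r t \<theta> +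
    (\<Sum>j\<le>m. transport_coeff lam m j *\<^sub>R ((D ^^ j) q t \<theta> *\<^sub>R (D ^^ (m - j)) g t \<theta>))) t \<theta>"
    by (rule fun_cong[OF D_cong]) (rule Suc)
  also have "\<dots> = (D ^^ Suc m) r t \<theta> +
      (\<Sum>j\<le>m. transport_coeff lam m j *\<^sub>R (?X (Suc j) (m - j) + ?X j (Suc (m - j))))"
    unfolding D_add[OF smooth_D_funpow[OF r] sm t]
      D_Leibniz_sum[OF bounded_bilinear_scaleR smooth_q g t] by simp
  \<comment> \<open>The second sum gives back the 1 that \<open>transport_coeff lam (Suc m)\<close>
    subtracts at \<open>j = 0\<close>; it then cancels against the commutator term
    \<open>q t \<theta> *\<^sub>R (D ^^ Suc m) g t \<theta>\<close>.\<close>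
  also have "(\<Sum>j\<le>m. transport_coeff lam m j *\<^sub>R (?X (Suc j) (m - j) + ?X j (Suc (m - j)))) =
      (\<Sum>j\<le>Suc m. transport_coeff lam (Suc m) j *\<^sub>R ?X j (Suc m - j)) +
      (\<Sum>j\<le>Suc m. (if j = 0 then ?X j (Suc m - j) else 0))"
    unfolding sum_leibniz_shift[of "transport_coeff lam m" ?X m] sum.distrib[symmetric]
    by (rule sum.cong) (auto simp: algebra_simps)
  also have "(\<Sum>j\<le>Suc m. (if j = 0 then ?X j (Suc m - j) else 0)) = q t \<theta> *\<^sub>R (D ^^ Suc m) g t \<theta>"
    by (subst sum.delta) auto
  finally show ?case by simp
qed

text \<open>Turns the norm of L^2(ds), whose measure moves with the path, into the norm of L^2(d
  theta), whose measure is fixed and allows differentiation in time under the integral.\<close>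

definition weighted :: "(real \<Rightarrow> real \<Rightarrow> 'a::real_normed_vector) \<Rightarrow> real \<Rightarrow> real \<Rightarrow> 'a" where
  "weighted g t \<theta> = sqrt (speed t \<theta>) *\<^sub>R g t \<theta>"

lemma smooth_weighted: "smooth_loops g \<Longrightarrow> smooth_loops (weighted g)"
  unfolding weighted_def by (intro smooth_loops_scaleR smooth_sqrt_speed)

lemma dt_weighted:
  assumes g: "smooth_loops g" and t: "t \<in> {0..1}"
  shows "path_dt (weighted g) t \<theta> =
    weighted (\<lambda>t \<theta>. path_dt g t \<theta> + (q t \<theta> / 2) *\<^sub>R g t \<theta>) t \<theta>"
proof (rule path_dt_eq[OF _ t])
  have "((\<lambda>s. speed s \<theta> powr (1/2)) has_vector_derivative
      (1/2) * (speed t \<theta> powr (1/2 - 1) * (q t \<theta> * speed t \<theta>))) (at t within {0..1})"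
    by (rule has_vector_derivative_powr[OF dt_speed[OF t] speed_pos[OF t]])
  also have "(1/2) * (speed t \<theta> powr (1/2 - 1) * (q t \<theta> * speed t \<theta>)) = sqrt (speed t \<theta>) * (q t \<theta> / 2)"
    using speed_pos[OF t, of \<theta>]
    by (simp add: powr_half_sqrt powr_minus field_simps real_sqrt_mult_self)
  finally have "((\<lambda>s. sqrt (speed s \<theta>)) has_vector_derivative sqrt (speed t \<theta>) * (q t \<theta> / 2)) (at t within {0..1})"
    by (rule has_vector_derivative_transform[OF t powr_half_sqrt[symmetric], rotated])
      (auto intro!: less_imp_le[OF speed_pos])
  from bounded_bilinear.has_vector_derivative[OF bounded_bilinear_scaleR this smooth_loops_has_dt[OF g t]]
  show "((\<lambda>s. weighted g s \<theta>) has_vector_derivative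
      weighted (\<lambda>t \<theta>. path_dt g t \<theta> + (q t \<theta> / 2) *\<^sub>R g t \<theta>) t \<theta>) (at t within {0..1})"
    by (simp add: weighted_def scaleR_add_right)
qed

lemma transport_weighted:
  fixes g r :: "real \<Rightarrow> real \<Rightarrow> 'a::euclidean_space"
  assumes g: "smooth_loops g" and r: "smooth_loops r"
    and eq: "\<And>t \<theta>. t \<in> {0..1} \<Longrightarrow> path_dt g t \<theta> = r t \<theta> - lam *\<^sub>R q t \<theta> *\<^sub>R g t \<theta>"
    and t: "t \<in> {0..1}"
  shows "path_dt (weighted ((D ^^ m) g)) t \<theta> = weighted (\<lambda>t \<theta>. (D ^^ m) r t \<theta> +
    (\<Sum>j\<le>m. (transport_coeff lam m j + (if j = 0 then 1/2 else 0)) *\<^sub>R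
       ((D ^^ j) q t \<theta> *\<^sub>R (D ^^ (m - j)) g t \<theta>))) t \<theta>"
proof -
  have "(\<Sum>j\<le>m. (if j = 0 then 1/2 else 0) *\<^sub>R ((D ^^ j) q t \<theta> *\<^sub>R (D ^^ (m - j)) g t \<theta>)) =
      (\<Sum>j\<le>m. if j = 0 then (q t \<theta> / 2) *\<^sub>R (D ^^ m) g t \<theta> else 0)"
    by (rule sum.cong) auto
  also have "\<dots> = (q t \<theta> / 2) *\<^sub>R (D ^^ m) g t \<theta>"
    by (subst sum.delta) auto
  finally have "(\<Sum>j\<le>m. (transport_coeff lam m j + (if j = 0 then 1/2 else 0)) *\<^sub>R
       ((D ^^ j) q t \<theta> *\<^sub>R (D ^^ (m - j)) g t \<theta>)) =
      (\<Sum>j\<le>m. transport_coeff lam m j *\<^sub>R ((D ^^ j) q t \<theta> *\<^sub>R (D ^^ (m - j)) g t \<theta>)) +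
      (q t \<theta> / 2) *\<^sub>R (D ^^ m) g t \<theta>"
    unfolding scaleR_add_left sum.distrib by simp
  then show ?thesis
    using dt_weighted[OF smooth_D_funpow[OF g] t, of m \<theta>] transport_D[OF assms, of m \<theta>]
    by (simp only: weighted_def add.assoc)
qed

end

section \<open>L2 norms\<close>

text \<open>The L^2(d theta) norm for vector values, with the gauge integral to which the
  fundamental theorem and the Leibniz rule apply. For continuous real functions it equals
  \<open>L2_norm\<close> (\<open>L2_norm_eq_loop_norm\<close>).\<close>

definition loop_norm :: "(real \<Rightarrow> 'a::real_normed_vector) \<Rightarrow> real" where
  "loop_norm f = sqrt (integral {0..2*pi} (\<lambda>\<theta>. (norm (f \<theta>))\<^sup>2))"

lemma integral_norm_sq_nonneg: "integral {0..2*pi} (\<lambda>\<theta>. (norm (f \<theta>))\<^sup>2) \<ge> 0"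
  \<comment> \<open>For a non-integrable integrand \<open>integral\<close> takes the default value
    0.\<close>
  by (cases "(\<lambda>\<theta>. (norm (f \<theta>))\<^sup>2) integrable_on {0..2*pi}")
    (auto intro: integral_nonneg simp: not_integrable_integral)

lemma loop_norm_nonneg: "loop_norm f \<ge> 0"
  by (simp add: loop_norm_def integral_norm_sq_nonneg)

lemma loop_norm_sq: "(loop_norm f)\<^sup>2 = integral {0..2*pi} (\<lambda>\<theta>. (norm (f \<theta>))\<^sup>2)"
  by (simp add: loop_norm_def integral_norm_sq_nonneg)

lemma loop_norm_scale:
  assumes "continuous_on {0..2*pi} g" "K \<ge> 0"
    and le: "\<And>\<theta>. \<theta> \<in> {0..2*pi} \<Longrightarrow> norm (f \<theta>) \<le> K * norm (g \<theta>)"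
    and "continuous_on {0..2*pi} f"
  shows "loop_norm f \<le> K * loop_norm g"
proof -
  have "integral {0..2*pi} (\<lambda>\<theta>. (norm (f \<theta>))\<^sup>2) \<le> integral {0..2*pi} (\<lambda>\<theta>. K\<^sup>2 * (norm (g \<theta>))\<^sup>2)"
  proof (rule integral_le)
    show "(norm (f \<theta>))\<^sup>2 \<le> K\<^sup>2 * (norm (g \<theta>))\<^sup>2" if "\<theta> \<in> {0..2*pi}" for \<theta>
      using power_mono[OF le[OF that] norm_ge_zero, of 2] by (simp add: power_mult_distrib)
  qed (intro integrable_continuous_real continuous_intros assms)+
  then have "(loop_norm f)\<^sup>2 \<le> (K * loop_norm g)\<^sup>2"
    by (simp add: loop_norm_sq power_mult_distrib)
  then show ?thesis
    by (rule power2_le_imp_le) (simp add: assms loop_norm_nonneg)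
qed

lemma loop_norm_scaleR: "loop_norm (\<lambda>\<theta>. a *\<^sub>R f \<theta>) = \<bar>a\<bar> * loop_norm f"
  by (simp add: loop_norm_def power_mult_distrib real_sqrt_mult)

text \<open>Integrating (s|f| - r|g|)^2 >= 0 gives a family of inequalities in \<open>s\<close> and
  \<open>r\<close>. Taking \<open>s\<close> and \<open>r\<close> to be the norms of \<open>g\<close>
  and \<open>f\<close> yields the claim after division by their product; when a norm vanishes, the
  free scale is chosen large instead.\<close>

lemma loop_norm_Cauchy_Schwarz:
  assumes f: "continuous_on {0..2*pi} f" and g: "continuous_on {0..2*pi} g"
  shows "integral {0..2*pi} (\<lambda>\<theta>. norm (f \<theta>) * norm (g \<theta>)) \<le> loop_norm f * loop_norm g"
proof -
  let ?I = "integral {0..2*pi} (\<lambda>\<theta>. norm (f \<theta>) * norm (g \<theta>))"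
  have le: "2 * s * r * ?I \<le> s\<^sup>2 * (loop_norm f)\<^sup>2 + r\<^sup>2 * (loop_norm g)\<^sup>2" for s r
  proof -
    have "integral {0..2*pi} (\<lambda>\<theta>. 2 * s * r * (norm (f \<theta>) * norm (g \<theta>))) \<le>
        integral {0..2*pi} (\<lambda>\<theta>. s\<^sup>2 * (norm (f \<theta>))\<^sup>2 + r\<^sup>2 * (norm (g \<theta>))\<^sup>2)"
    proof (rule integral_le)
      show "2 * s * r * (norm (f \<theta>) * norm (g \<theta>)) \<le> s\<^sup>2 * (norm (f \<theta>))\<^sup>2 + r\<^sup>2 * (norm (g \<theta>))\<^sup>2" for \<theta>
        using zero_le_power2[of "s * norm (f \<theta>) - r * norm (g \<theta>)"]
        by (simp add: power2_diff power_mult_distrib algebra_simps)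
    qed (intro integrable_continuous_real continuous_intros f g)+
    also have "\<dots> = s\<^sup>2 * (loop_norm f)\<^sup>2 + r\<^sup>2 * (loop_norm g)\<^sup>2"
      unfolding loop_norm_sq
      by (subst integral_add) (auto intro!: integrable_continuous_real continuous_intros f g)
    finally show ?thesis by simp
  qed
  show ?thesis
  proof (cases "loop_norm f = 0 \<or> loop_norm g = 0")
    case False
    then have "loop_norm f > 0" "loop_norm g > 0"
      using loop_norm_nonneg[of f] loop_norm_nonneg[of g] by auto
    with le[of "loop_norm g" "loop_norm f"]
    have "(loop_norm f * loop_norm g) * ?I \<le> (loop_norm f * loop_norm g) * (loop_norm f * loop_norm g)"
      by (simp add: power2_eq_square algebra_simps)
    then show ?thesis using \<open>loop_norm f > 0\<close> \<open>loop_norm g > 0\<close>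
      by (meson mult_pos_pos mult_le_cancel_left_pos)
  next
    case True
    have "?I \<le> 0"
    proof (rule ccontr)
      assume "\<not> ?I \<le> 0"
      then have I: "?I > 0" by simp
      from True show False
      proof
        assume z: "loop_norm f = 0"
        \<comment> \<open>With the norm of \<open>f\<close> equal to 0, this scale makes the left
          side of \<open>le\<close> equal to 2 + 2|g|^2 and leaves |g|^2 on the right, where |g| is
          the norm of \<open>g\<close>.\<close>
        have "(loop_norm g)\<^sup>2 + 2 \<le> 0" using le[of "(1 + (loop_norm g)\<^sup>2) / ?I" 1] I z by simp
        then show False using zero_le_power2[of "loop_norm g"] by linarith
      next
        assume z: "loop_norm g = 0"
        have "(loop_norm f)\<^sup>2 + 2 \<le> 0" using le[of 1 "(1 + (loop_norm f)\<^sup>2) / ?I"] I z by simp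
        then show False using zero_le_power2[of "loop_norm f"] by linarith
      qed
    qed
    then show ?thesis using True by auto
  qed
qed

lemma loop_norm_triangle:
  assumes f: "continuous_on {0..2*pi} f" and g: "continuous_on {0..2*pi} g"
  shows "loop_norm (\<lambda>\<theta>. f \<theta> + g \<theta>) \<le> loop_norm f + loop_norm g"
proof -
  have "(loop_norm (\<lambda>\<theta>. f \<theta> + g \<theta>))\<^sup>2 \<le>
      integral {0..2*pi} (\<lambda>\<theta>. ((norm (f \<theta>))\<^sup>2 + (norm (g \<theta>))\<^sup>2) + 2 * (norm (f \<theta>) * norm (g \<theta>)))"
    unfolding loop_norm_sq
  proof (rule integral_le)
    show "(norm (f \<theta> + g \<theta>))\<^sup>2 \<le> ((norm (f \<theta>))\<^sup>2 + (norm (g \<theta>))\<^sup>2) + 2 * (norm (f \<theta>) * norm (g \<theta>))" for \<theta>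
      using power_mono[OF norm_triangle_ineq[of "f \<theta>" "g \<theta>"] norm_ge_zero, of 2]
      by (simp add: power2_sum)
  qed (intro integrable_continuous_real continuous_intros f g)+
  also have "\<dots> = (loop_norm f)\<^sup>2 + (loop_norm g)\<^sup>2 +
      2 * integral {0..2*pi} (\<lambda>\<theta>. norm (f \<theta>) * norm (g \<theta>))"
    unfolding loop_norm_sq
    by (subst integral_add, auto intro!: integrable_continuous_real continuous_intros f g)+
  also have "\<dots> \<le> (loop_norm f + loop_norm g)\<^sup>2"
    using loop_norm_Cauchy_Schwarz[OF f g] by (simp add: power2_sum)
  finally show ?thesis
    by (rule power2_le_imp_le) (simp add: loop_norm_nonneg)
qed

lemma loop_norm_sum:
  assumes "finite A" "\<And>i. i \<in> A \<Longrightarrow> continuous_on {0..2*pi} (f i)"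
  shows "loop_norm (\<lambda>\<theta>. \<Sum>i\<in>A. f i \<theta>) \<le> (\<Sum>i\<in>A. loop_norm (f i))"
  using assms
proof (induction A)
  case empty
  then show ?case by (simp add: loop_norm_def)
next
  case (insert x A)
  have "loop_norm (\<lambda>\<theta>. f x \<theta> + (\<Sum>i\<in>A. f i \<theta>)) \<le> loop_norm (f x) + loop_norm (\<lambda>\<theta>. \<Sum>i\<in>A. f i \<theta>)"
    by (rule loop_norm_triangle) (use insert in \<open>auto intro!: continuous_on_sum\<close>)
  then show ?case using insert by fastforce
qed

definition arc_norm :: "(real \<Rightarrow> real ^ 2) \<Rightarrow> (real \<Rightarrow> 'a::real_normed_vector) \<Rightarrow> real" where
  "arc_norm c g = loop_norm (\<lambda>\<theta>. sqrt (norm (dtheta c \<theta>)) *\<^sub>R g \<theta>)"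

lemma arc_norm_nonneg: "arc_norm c g \<ge> 0"
  by (simp add: arc_norm_def loop_norm_nonneg)

lemma arc_norm_scaleR: "arc_norm c (\<lambda>\<theta>. a *\<^sub>R f \<theta>) = \<bar>a\<bar> * arc_norm c f"
  unfolding arc_norm_def loop_norm_scaleR[symmetric] by (simp add: mult.commute)

section \<open>Sup bounds and interpolation between orders of differentiation\<close>

lemma abs_diff_le_integral_deriv:
  fixes f :: "real \<Rightarrow> real"
  assumes "\<And>x. (f has_vector_derivative f' x) (at x)" "continuous_on {a..b} f'"
    and "x \<in> {a..b}" "y \<in> {a..b}"
  shows "\<bar>f x - f y\<bar> \<le> integral {a..b} (\<lambda>x. \<bar>f' x\<bar>)"
proof -
  have *: "\<bar>f x - f y\<bar> \<le> integral {a..b} (\<lambda>x. \<bar>f' x\<bar>)"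
    if "x \<le> y" "x \<in> {a..b}" "y \<in> {a..b}" for x y
  proof -
    have c: "continuous_on {x..y} f'"
      by (rule continuous_on_subset[OF assms(2)]) (use that in auto)
    have "(f' has_integral (f y - f x)) {x..y}"
      by (rule fundamental_theorem_of_calculus)
        (use that in \<open>auto intro: has_vector_derivative_at_within assms(1)\<close>)
    then have "\<bar>f y - f x\<bar> = norm (integral {x..y} f')" by (simp add: integral_unique)
    also have "\<dots> \<le> integral {x..y} (\<lambda>x. \<bar>f' x\<bar>)"
      by (rule integral_norm_bound_integral) (auto intro!: integrable_continuous_real continuous_intros c)
    also have "\<dots> \<le> integral {a..b} (\<lambda>x. \<bar>f' x\<bar>)"
      by (rule integral_subset_le) (use that in \<open>auto intro!: integrable_continuous_real continuous_intros c assms(2)\<close>)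
    finally show ?thesis by (simp add: abs_minus_commute)
  qed
  show ?thesis
    using *[of x y] *[of y x] assms(3,4) by (cases "x \<le> y") (auto simp: abs_minus_commute)
qed

text \<open>Turns \<open>\<parallel>D\<^sub>s\<^sup>j h\<parallel>\<^sup>2 \<le> \<parallel>D\<^sub>s\<^sup>j\<^sup>-\<^sup>1 h\<parallel> \<parallel>D\<^sub>s\<^sup>j\<^sup>+\<^sup>1 h\<parallel>\<close> into an interpolation inequality whose constant does
  not depend on the length of the curve.\<close>

lemma log_convex_le_ends:
  fixes A :: "nat \<Rightarrow> real"
  assumes nonneg: "\<And>j. A j \<ge> 0"
    and conv: "\<And>j. 0 < j \<Longrightarrow> j < n \<Longrightarrow> (A j)\<^sup>2 \<le> A (j - 1) * A (Suc j)"
    and "j \<le> n"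
  shows "A j \<le> A 0 + A n"
proof -
  define M where "M = Max (A ` {..n})"
  have le: "A i \<le> M" if "i \<le> n" for i unfolding M_def using that by auto
  have "M \<in> A ` {..n}" unfolding M_def by (rule Max_in) auto
  then have ex: "\<exists>i. i \<le> n \<and> A i = M" by auto
  \<comment> \<open>At the first index attaining the maximum the left neighbour is strictly smaller,
    so an interior maximum would give M^2 < M^2.\<close>
  define i where "i = (LEAST i. i \<le> n \<and> A i = M)"
  have i: "i \<le> n" "A i = M" using LeastI_ex[OF ex] by (auto simp: i_def)
  have min: "A k \<noteq> M" if "k < i" for k
    using not_less_Least[of k "\<lambda>i. i \<le> n \<and> A i = M"] that i(1) by (auto simp: i_def)
  have "M \<le> A 0 + A n"
  proof (cases "i = 0 \<or> i = n")
    case True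
    then show ?thesis using i nonneg[of 0] nonneg[of n] by auto
  next
    case False
    then have lt: "A (i - 1) < M" using min[of "i - 1"] le[of "i - 1"] i(1) by force
    then have "M > 0" using nonneg[of "i - 1"] by linarith
    have "M\<^sup>2 \<le> A (i - 1) * A (Suc i)" using conv[of i] False i by simp
    also have "\<dots> \<le> A (i - 1) * M" using le[of "Suc i"] False i nonneg by (intro mult_left_mono) auto
    also have "\<dots> < M * M" using lt \<open>M > 0\<close> by simp
    finally show ?thesis by (simp add: power2_eq_square)
  qed
  then show ?thesis using le[OF assms(3)] by linarith
qed

context immersed_path
begin

abbreviation N :: "real \<Rightarrow> (real \<Rightarrow> real \<Rightarrow> 'a::real_normed_vector) \<Rightarrow> real" where
  "N t g \<equiv> arc_norm (c t) (g t)"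

lemma N_eq_loop_norm: "arc_norm (c t) f = loop_norm (\<lambda>\<theta>. sqrt (speed t \<theta>) *\<^sub>R f \<theta>)"
  by (simp add: arc_norm_def speed_def)

lemma N_eq: "N t g = loop_norm (weighted g t)"
  by (simp add: N_eq_loop_norm weighted_def[abs_def])

lemma continuous_weighted: "smooth_loops g \<Longrightarrow> t \<in> {0..1} \<Longrightarrow> continuous_on S (weighted g t)"
  by (intro smooth_loops_continuous_theta smooth_weighted)

lemma N_sq:
  assumes "t \<in> {0..1}"
  shows "(N t g)\<^sup>2 = integral {0..2*pi} (\<lambda>\<theta>. (norm (g t \<theta>))\<^sup>2 * speed t \<theta>)"
  unfolding N_eq loop_norm_sq weighted_def
  using speed_pos[OF assms] by (simp add: power_mult_distrib less_imp_le mult.commute)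

lemma N_scale:
  assumes "smooth_loops f" "smooth_loops g" "t \<in> {0..1}" "K \<ge> 0"
    and "\<And>\<theta>. \<theta> \<in> {0..2*pi} \<Longrightarrow> norm (f t \<theta>) \<le> K * norm (g t \<theta>)"
  shows "N t f \<le> K * N t g"
  unfolding N_eq
proof (rule loop_norm_scale)
  show "norm (weighted f t \<theta>) \<le> K * norm (weighted g t \<theta>)" if "\<theta> \<in> {0..2*pi}" for \<theta>
    using mult_left_mono[OF assms(5)[OF that], of "sqrt (speed t \<theta>)"] speed_pos[OF assms(3), of \<theta>]
    by (simp add: weighted_def mult.left_commute)
qed (intro continuous_weighted assms)+

lemma N_add:
  assumes "smooth_loops f" "smooth_loops g" "t \<in> {0..1}"
  shows "N t (\<lambda>t \<theta>. f t \<theta> + g t \<theta>) \<le> N t f + N t g"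
  using loop_norm_triangle[of "weighted f t" "weighted g t"] assms
  by (simp add: N_eq_loop_norm weighted_def[abs_def] scaleR_add_right continuous_weighted[unfolded weighted_def[abs_def]])

lemma N_sum:
  assumes "finite A" "\<And>i. i \<in> A \<Longrightarrow> smooth_loops (f i)" "t \<in> {0..1}"
  shows "N t (\<lambda>t \<theta>. \<Sum>i\<in>A. f i t \<theta>) \<le> (\<Sum>i\<in>A. N t (f i))"
  using loop_norm_sum[of A "\<lambda>i. weighted (f i) t"] assms
  by (simp add: N_eq_loop_norm weighted_def[abs_def] scaleR_sum_right continuous_weighted[unfolded weighted_def[abs_def]])

lemma norm_v: "t \<in> {0..1} \<Longrightarrow> norm (v t \<theta>) = 1"
  using speed_pos[of t \<theta>] by (simp add: v_def D_eq speed_def path_dtheta_def)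

lemma integral_norm_mult_le:
  assumes "smooth_loops f" "smooth_loops g" "t \<in> {0..1}"
  shows "integral {0..2*pi} (\<lambda>\<theta>. speed t \<theta> * (norm (f t \<theta>) * norm (g t \<theta>))) \<le> N t f * N t g"
proof -
  have "speed t \<theta> * (norm (f t \<theta>) * norm (g t \<theta>)) = norm (weighted f t \<theta>) * norm (weighted g t \<theta>)" for \<theta>
  proof -
    have "norm (weighted f t \<theta>) * norm (weighted g t \<theta>) = (sqrt (speed t \<theta>))\<^sup>2 * (norm (f t \<theta>) * norm (g t \<theta>))"
      by (simp add: weighted_def power2_eq_square speed_def)
    then show ?thesis by (simp add: speed_def)
  qed
  then show ?thesis
    using loop_norm_Cauchy_Schwarz[OF continuous_weighted continuous_weighted, OF assms(1,3) assms(2,3)]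
    by (simp add: N_eq)
qed

text \<open>\<open>\<langle>g, e\<rangle>\<close> is periodic for every vector \<open>e\<close>, so \<open>\<langle>D\<^sub>s g, e\<rangle>\<close> vanishes somewhere by Rolle. Hence no lower
  bound on the length is needed; \<open>N t v\<close> is the square root of the length.\<close>

lemma sup_D_le:
  fixes g :: "real \<Rightarrow> real \<Rightarrow> 'a::euclidean_space"
  assumes g: "smooth_loops g" and t: "t \<in> {0..1}" and th: "\<theta> \<in> {0..2*pi}"
  shows "norm (D g t \<theta>) \<le> N t v * N t (D (D g))"
proof -
  \<comment> \<open>The test vector is the value to be bounded: its inner product with
    \<open>D g\<close> at \<open>\<theta>\<close> is then the squared norm, and one scalar function
    suffices for Rolle.\<close>
  define e where "e = D g t \<theta>"
  let ?\<phi> = "\<lambda>x. g t x \<bullet> e" and ?\<psi> = "\<lambda>x. D g t x \<bullet> e"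
  let ?d = "\<lambda>x. speed t x * (D (D g) t x \<bullet> e)"
  note sD = smooth_D[OF g] and sDD = smooth_D[OF smooth_D[OF g]]
  note hvi = bounded_linear.has_vector_derivative[OF bounded_linear_inner_left]
  have d1: "(?\<phi> has_real_derivative speed t x * ?\<psi> x) (at x)" for x
    using hvi[OF has_D[OF g t]] by (simp add: has_real_derivative_iff_has_vector_derivative)
  have d2: "(?\<psi> has_vector_derivative ?d x) (at x)" for x
    using hvi[OF has_D[OF sD t]] by simp
  have cs: "continuous_on S (speed t)" "continuous_on S (D (D g) t)" "continuous_on S (g t)" for S
    by (rule smooth_loops_continuous_theta[OF _ t], intro smooth_speed sDD g)+
  have "g t (2 * pi) = g t 0"
    using g t by (auto simp: smooth_loops_def circle_fun_def dest!: bspec[of _ _ t] spec[of _ "0::real"])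
  then have "\<exists>z. 0 < z \<and> z < 2*pi \<and> ((*) (speed t z * ?\<psi> z) = (\<lambda>v. 0))"
    by (intro Rolle_deriv[of 0 "2*pi" ?\<phi> "\<lambda>x. (*) (speed t x * ?\<psi> x)"])
      (auto intro!: continuous_intros cs d1[THEN has_field_derivative_imp_has_derivative])
  then obtain z where z: "0 < z" "z < 2*pi" "speed t z * ?\<psi> z = 0"
    by (metis mult.right_neutral)
  then have "?\<psi> z = 0" using speed_pos[OF t, of z] by simp
  then have "(norm e)\<^sup>2 = \<bar>?\<psi> \<theta> - ?\<psi> z\<bar>" by (simp add: e_def power2_norm_eq_inner)
  also have "\<dots> \<le> integral {0..2*pi} (\<lambda>x. \<bar>?d x\<bar>)"
    by (rule abs_diff_le_integral_deriv[OF d2]) (use th z in \<open>auto intro!: continuous_intros cs\<close>)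
  \<comment> \<open>The factor \<open>norm (v t x) = 1\<close> is inserted so that Cauchy-Schwarz
    produces \<open>N t v\<close>.\<close>
  also have "\<dots> \<le> integral {0..2*pi} (\<lambda>x. norm e * (speed t x * (norm (v t x) * norm (D (D g) t x))))"
  proof (rule integral_le)
    show "\<bar>?d x\<bar> \<le> norm e * (speed t x * (norm (v t x) * norm (D (D g) t x)))" for x
      using Cauchy_Schwarz_ineq2[of "D (D g) t x" e] speed_pos[OF t, of x]
      by (simp add: norm_v[OF t] abs_mult mult_left_mono algebra_simps)
  qed (auto simp: norm_v[OF t] intro!: integrable_continuous_real continuous_intros cs)
  also have "\<dots> \<le> norm e * (N t v * N t (D (D g)))"
    unfolding integral_mult_right by (intro mult_left_mono integral_norm_mult_le smooth_v sDD t norm_ge_zero)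
  finally show ?thesis
    by (cases "e = 0") (auto simp: e_def[symmetric] power2_eq_square arc_norm_nonneg)
qed

text \<open>The derivative of <f, D f> integrates to 0 over the circle by periodicity. This
  integration by parts trades the squared norm of \<open>D f\<close> for minus the integral of <f, D
  (D f)>, and Cauchy-Schwarz finishes.\<close>

lemma interpolation_step:
  fixes f :: "real \<Rightarrow> real \<Rightarrow> 'a::euclidean_space"
  assumes f: "smooth_loops f" and t: "t \<in> {0..1}"
  shows "(N t (D f))\<^sup>2 \<le> N t f * N t (D (D f))"
proof -
  note s = f smooth_D[OF f] smooth_D[OF smooth_D[OF f]]
  have c: "continuous_on S (speed t)" "continuous_on S (f t)"
    "continuous_on S (D f t)" "continuous_on S (D (D f) t)" for S
    by (rule smooth_loops_continuous_theta[OF _ t], intro smooth_speed s)+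
  let ?F = "\<lambda>x. f t x \<bullet> D f t x"
  let ?d = "\<lambda>x. speed t x * (f t x \<bullet> D (D f) t x) + (norm (D f t x))\<^sup>2 * speed t x"
  have "(?F has_vector_derivative ?d x) (at x)" for x
    using bounded_bilinear.has_vector_derivative[OF bounded_bilinear_inner has_D[OF s(1) t] has_D[OF s(2) t], of x]
    by (simp add: power2_norm_eq_inner algebra_simps)
  then have "(?d has_integral (?F (2*pi) - ?F 0)) {0..2*pi}"
    by (intro fundamental_theorem_of_calculus) (auto intro: has_vector_derivative_at_within)
  moreover have "?F (2*pi) = ?F 0"
    using s(1,2) t by (auto simp: smooth_loops_def circle_fun_def dest!: bspec[of _ _ t] spec[of _ "0::real"])
  ultimately have "integral {0..2*pi} ?d = 0" by (simp add: integral_unique)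
  also have "integral {0..2*pi} ?d =
      integral {0..2*pi} (\<lambda>x. speed t x * (f t x \<bullet> D (D f) t x)) + (N t (D f))\<^sup>2"
    unfolding N_sq[OF t] by (rule integral_add) (auto intro!: integrable_continuous_real continuous_intros c)
  finally have "(N t (D f))\<^sup>2 = - integral {0..2*pi} (\<lambda>x. speed t x * (f t x \<bullet> D (D f) t x))" by simp
  also have "\<dots> = integral {0..2*pi} (\<lambda>x. - (speed t x * (f t x \<bullet> D (D f) t x)))" by simp
  also have "\<dots> \<le> integral {0..2*pi} (\<lambda>x. speed t x * (norm (f t x) * norm (D (D f) t x)))"
  proof (rule integral_le)
    show "- (speed t x * (f t x \<bullet> D (D f) t x)) \<le> speed t x * (norm (f t x) * norm (D (D f) t x))" for x
      using mult_left_mono[OF Cauchy_Schwarz_ineq2[of "f t x" "D (D f) t x"], of "speed t x"] speed_pos[OF t, of x]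
        mult_left_mono[of "- (f t x \<bullet> D (D f) t x)" "\<bar>f t x \<bullet> D (D f) t x\<bar>" "speed t x"]
      by linarith
  qed (auto intro!: integrable_continuous_real continuous_intros c)
  also have "\<dots> \<le> N t f * N t (D (D f))"
    by (rule integral_norm_mult_le[OF s(1,3) t])
  finally show ?thesis .
qed

lemma N_funpow_le_ends:
  fixes f :: "real \<Rightarrow> real \<Rightarrow> 'a::euclidean_space"
  assumes f: "smooth_loops f" and t: "t \<in> {0..1}" and "j \<le> n"
  shows "N t ((D ^^ j) f) \<le> N t f + N t ((D ^^ n) f)"
proof -
  have "(N t ((D ^^ i) f))\<^sup>2 \<le> N t ((D ^^ (i - 1)) f) * N t ((D ^^ Suc i) f)" if "0 < i" for i
    using interpolation_step[OF smooth_D_funpow[OF f, of "i - 1"] t] that by (cases i) auto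
  from log_convex_le_ends[of "\<lambda>i. N t ((D ^^ i) f)", OF arc_norm_nonneg this \<open>j \<le> n\<close>]
  show ?thesis by simp
qed

end

section \<open>Gronwall estimates for L2 norms\<close>

text \<open>The differential inequality is integrated over [0,t]; as \<open>w\<close> is
  nonnegative, the integral may be enlarged to all of \<open>{0..1}\<close>, where it becomes the
  path length in the applications.\<close>

lemma comparison_integral:
  fixes f :: "real \<Rightarrow> real"
  assumes d: "\<And>t. t \<in> {0..1} \<Longrightarrow> (f has_vector_derivative f' t) (at t within {0..1})"
    and le: "\<And>t. t \<in> {0..1} \<Longrightarrow> f' t \<le> K * w t"
    and w: "continuous_on {0..1} w" "\<And>t. t \<in> {0..1} \<Longrightarrow> 0 \<le> w t" and K: "0 \<le> K" and t: "t \<in> {0..1}"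
  shows "f t \<le> f 0 + K * integral {0..1} w"
proof -
  have cw: "continuous_on {0..t} w"
    by (rule continuous_on_subset[OF w(1)]) (use t in auto)
  have "(f' has_integral (f t - f 0)) {0..t}"
    by (rule fundamental_theorem_of_calculus)
      (use t in \<open>auto intro: has_vector_derivative_within_subset[OF d]\<close>)
  moreover have "((\<lambda>t. K * w t) has_integral (K * integral {0..t} w)) {0..t}"
    by (intro has_integral_mult_right integrable_integral integrable_continuous_real cw)
  ultimately have "f t - f 0 \<le> K * integral {0..t} w"
    by (rule has_integral_le) (use le t in auto)
  also have "integral {0..t} w \<le> integral {0..1} w"
    by (rule integral_subset_le) (use t w in \<open>auto intro!: integrable_continuous_real cw\<close>)
  finally show ?thesis using K by (simp add: mult_left_mono)
qed

text \<open>The squared norm is used because it is differentiable also where the norm vanishes. The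
  derivative passes under the integral, and Cauchy-Schwarz bounds the result.\<close>

lemma loop_norm_sq_deriv:
  fixes U :: "real \<Rightarrow> real \<Rightarrow> 'a::euclidean_space"
  assumes U: "smooth_loops U" and t: "t \<in> {0..1}"
  shows "\<exists>d. ((\<lambda>s. (loop_norm (U s))\<^sup>2) has_vector_derivative d) (at t within {0..1}) \<and>
             \<bar>d\<bar> \<le> 2 * loop_norm (U t) * loop_norm (path_dt U t)"
proof -
  let ?f = "\<lambda>s \<theta>. U s \<theta> \<bullet> U s \<theta>"
  let ?d = "\<lambda>s \<theta>. U s \<theta> \<bullet> path_dt U s \<theta> + path_dt U s \<theta> \<bullet> U s \<theta>"
  have s: "smooth_loops ?f" "smooth_loops ?d"
    by (intro smooth_loops_add smooth_loops_inner smooth_loops_dt U)+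
  have cU: "continuous_on {0..2*pi} (U t)" "continuous_on {0..2*pi} (path_dt U t)"
    using smooth_loops_continuous_theta[OF _ t] smooth_loops_dt[OF U] U by auto
  have "((\<lambda>s. integral (cbox 0 (2*pi)) (?f s)) has_vector_derivative integral (cbox 0 (2*pi)) (?d t))
      (at t within {0..1})"
  proof (rule leibniz_rule_vector_derivative)
    show "continuous_on ({0..1} \<times> cbox 0 (2*pi)) (\<lambda>(x, t). ?d x t)"
      by (rule continuous_on_subset[OF smooth_loops_continuous[OF s(2)]]) auto
    show "((\<lambda>x. ?f x \<theta>) has_vector_derivative ?d x \<theta>) (at x within {0..1})" if "x \<in> {0..1}" for x \<theta>
      by (rule bounded_bilinear.has_vector_derivative[OF bounded_bilinear_inner
            smooth_loops_has_dt[OF U that] smooth_loops_has_dt[OF U that]])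
    show "?f x integrable_on cbox 0 (2*pi)" if "x \<in> {0..1}" for x
      using integrable_continuous_real[OF smooth_loops_continuous_theta[OF s(1) that], of 0 "2*pi"] by simp
  qed (use t in auto)
  then have "((\<lambda>s. (loop_norm (U s))\<^sup>2) has_vector_derivative integral {0..2*pi} (?d t)) (at t within {0..1})"
    by (simp add: loop_norm_sq power2_norm_eq_inner)
  moreover have "\<bar>integral {0..2*pi} (?d t)\<bar> \<le>
      integral {0..2*pi} (\<lambda>\<theta>. 2 * (norm (U t \<theta>) * norm (path_dt U t \<theta>)))"
    unfolding real_norm_def[symmetric]
  proof (rule integral_norm_bound_integral)
    show "norm (?d t \<theta>) \<le> 2 * (norm (U t \<theta>) * norm (path_dt U t \<theta>))" for \<theta>
      using Cauchy_Schwarz_ineq2[of "U t \<theta>" "path_dt U t \<theta>"] by (simp add: inner_commute)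
  qed (auto intro!: integrable_continuous_real continuous_intros cU)
  moreover have "\<dots> \<le> 2 * loop_norm (U t) * loop_norm (path_dt U t)"
    using loop_norm_Cauchy_Schwarz[OF cU] by simp
  ultimately show ?thesis by (meson order_trans)
qed

text \<open>With x the norm, ln(1 + x^2) satisfies an inequality that integrates directly: since
  2x(1 + x) <= 3(1 + x^2), its derivative is at most 3 K w. This is the origin of the 3 in the
  exponent; the summand 1 keeps the logarithm defined at zeros of the norm.\<close>

lemma loop_norm_Gronwall:
  fixes U :: "real \<Rightarrow> real \<Rightarrow> 'a::euclidean_space"
  assumes U: "smooth_loops U" and K: "K \<ge> 0"
    and w: "continuous_on {0..1} w" "\<And>t. t \<in> {0..1} \<Longrightarrow> 0 \<le> w t" and L: "integral {0..1} w \<le> L"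
    and le: "\<And>t. t \<in> {0..1} \<Longrightarrow> loop_norm (path_dt U t) \<le> K * w t * (1 + loop_norm (U t))"
    and t: "t \<in> {0..1}"
  shows "loop_norm (U t) \<le> (1 + loop_norm (U 0)) * exp (3 * K * L)"
proof -
  let ?Y = "\<lambda>t. (loop_norm (U t))\<^sup>2"
  obtain d where d: "\<And>t. t \<in> {0..1} \<Longrightarrow> (?Y has_vector_derivative d t) (at t within {0..1})"
    "\<And>t. t \<in> {0..1} \<Longrightarrow> \<bar>d t\<bar> \<le> 2 * loop_norm (U t) * loop_norm (path_dt U t)"
    using loop_norm_sq_deriv[OF U] by metis
  have pos: "1 + ?Y s > 0" for s by (simp add: add_pos_nonneg)
  have "ln (1 + ?Y t) \<le> ln (1 + ?Y 0) + 3 * K * integral {0..1} w"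
  proof (rule comparison_integral[OF _ _ w _ t])
    fix s :: real assume s: "s \<in> {0..1}"
    have "((\<lambda>s. 1 + ?Y s) has_vector_derivative d s) (at s within {0..1})"
      using has_vector_derivative_add[OF has_vector_derivative_const[of 1] d(1)[OF s]] by simp
    from has_vector_derivative_ln[OF this pos]
    show "((\<lambda>s. ln (1 + ?Y s)) has_vector_derivative (1 + ?Y s) powr (-1) * d s) (at s within {0..1})" .
    let ?x = "loop_norm (U s)"
    have "2 * ?x * (1 + ?x) \<le> 3 * (1 + ?x\<^sup>2)"
      using zero_le_power2[of "?x - 1"] by (simp add: power2_eq_square algebra_simps)
    then have "K * w s * (2 * ?x * (1 + ?x)) \<le> K * w s * (3 * (1 + ?x\<^sup>2))"
      by (rule mult_left_mono) (use K w(2)[OF s] in simp)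
    moreover have "d s \<le> 2 * ?x * (K * w s * (1 + ?x))"
      using d(2)[OF s] mult_left_mono[OF le[OF s], of "2 * ?x"] loop_norm_nonneg[of "U s"] by linarith
    ultimately have "d s \<le> 3 * K * w s * (1 + ?x\<^sup>2)" by (simp add: algebra_simps)
    then show "(1 + ?Y s) powr (-1) * d s \<le> 3 * K * w s"
      using pos[of s] by (simp add: divide_le_eq)
  qed (use K in auto)
  also have "\<dots> \<le> ln (1 + ?Y 0) + 3 * K * L"
    using mult_left_mono[OF L, of "3 * K"] K by simp
  finally have "exp (ln (1 + ?Y t)) \<le> exp (ln (1 + ?Y 0) + 3 * K * L)" by simp
  then have le1: "1 + ?Y t \<le> (1 + ?Y 0) * exp (3 * K * L)"
    using pos by (simp add: exp_add)
  have "0 \<le> L"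
    using integral_nonneg[OF integrable_continuous_real[OF w(1)]] w(2) L by fastforce
  then have "exp (3 * K * L) \<ge> 1" using K by simp
  \<comment> \<open>The exponential is at least 1 and may be squared, which makes the right side a
    perfect square, so that the root can be taken.\<close>
  then have e: "exp (3 * K * L) \<le> (exp (3 * K * L))\<^sup>2"
    by (simp add: power2_eq_square)
  have "?Y t \<le> (1 + ?Y 0) * exp (3 * K * L)" using le1 by simp
  also have "\<dots> \<le> (1 + loop_norm (U 0))\<^sup>2 * (exp (3 * K * L))\<^sup>2"
    using loop_norm_nonneg[of "U 0"] by (intro mult_mono e) (auto simp: power2_sum)
  finally show ?thesis
    unfolding power_mult_distrib[symmetric]
    by (rule power2_le_imp_le) (simp add: loop_norm_nonneg)
qed

text \<open>The norm of \<open>U t - U 0\<close> starts at 0 and grows at most at the rate of the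
  norm of \<open>path_dt U\<close>. Integrating this scalar inequality replaces a norm estimate for
  a function-valued integral.\<close>

lemma loop_norm_Lipschitz:
  fixes U :: "real \<Rightarrow> real \<Rightarrow> 'a::euclidean_space"
  assumes U: "smooth_loops U" and K: "K \<ge> 0"
    and w: "continuous_on {0..1} w" "\<And>t. t \<in> {0..1} \<Longrightarrow> 0 \<le> w t"
    and le: "\<And>t. t \<in> {0..1} \<Longrightarrow> loop_norm (path_dt U t) \<le> K * w t"
  shows "loop_norm (\<lambda>\<theta>. U 1 \<theta> - U 0 \<theta>) \<le> K * integral {0..1} w"
proof -
  define V where "V = (\<lambda>t \<theta>. U t \<theta> + (-1) *\<^sub>R U 0 \<theta>)"
  have V: "smooth_loops V"
    unfolding V_def by (intro smooth_loops_add U smooth_loops_linear[OF bounded_linear_scaleR_right]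
        smooth_loops_freeze) auto
  have dV: "path_dt V t = path_dt U t" if t: "t \<in> {0..1}" for t
  proof
    fix \<theta>
    show "path_dt V t \<theta> = path_dt U t \<theta>"
      by (rule path_dt_eq[OF _ t])
        (use has_vector_derivative_add[OF smooth_loops_has_dt[OF U t] has_vector_derivative_const[of "- U 0 \<theta>"]] in
          \<open>simp add: V_def\<close>)
  qed
  let ?Y = "\<lambda>t. (loop_norm (V t))\<^sup>2"
  obtain d where d: "\<And>t. t \<in> {0..1} \<Longrightarrow> (?Y has_vector_derivative d t) (at t within {0..1})"
    "\<And>t. t \<in> {0..1} \<Longrightarrow> \<bar>d t\<bar> \<le> 2 * loop_norm (V t) * loop_norm (path_dt V t)"
    using loop_norm_sq_deriv[OF V] by metis
  \<comment> \<open>\<open>e\<close> regularises the square root at zeros of the norm\<close>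
  have "loop_norm (V 1) \<le> K * integral {0..1} w + e" if "e > 0" for e
  proof -
    have pos: "e\<^sup>2 + ?Y s > 0" for s using that by (simp add: add_pos_nonneg)
    have "(e\<^sup>2 + ?Y 1) powr (1/2) \<le> (e\<^sup>2 + ?Y 0) powr (1/2) + K * integral {0..1} w"
    proof (rule comparison_integral[OF _ _ w K])
      fix s :: real assume s: "s \<in> {0..1}"
      have "((\<lambda>s. e\<^sup>2 + ?Y s) has_vector_derivative d s) (at s within {0..1})"
        using has_vector_derivative_add[OF has_vector_derivative_const[of "e\<^sup>2"] d(1)[OF s]] by simp
      from has_vector_derivative_powr[OF this pos]
      show "((\<lambda>s. (e\<^sup>2 + ?Y s) powr (1/2)) has_vector_derivative
          1/2 * ((e\<^sup>2 + ?Y s) powr (1/2 - 1) * d s)) (at s within {0..1})" .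
      let ?r = "sqrt (e\<^sup>2 + ?Y s)"
      have r: "?r > 0" "loop_norm (V s) \<le> ?r"
        using pos[of s] by (auto intro!: real_le_rsqrt)
      have "(e\<^sup>2 + ?Y s) powr (1/2 - 1) = 1 / ?r"
        using pos[of s] powr_minus_divide[of "e\<^sup>2 + ?Y s" "1/2"] by (simp add: powr_half_sqrt)
      then have eq: "1/2 * ((e\<^sup>2 + ?Y s) powr (1/2 - 1) * d s) = d s / (2 * ?r)" by simp
      have "d s \<le> 2 * loop_norm (V s) * (K * w s)"
        using d(2)[OF s] mult_left_mono[OF le[OF s], of "2 * loop_norm (V s)"] loop_norm_nonneg[of "V s"]
        by (simp add: dV[OF s])
      also have "\<dots> \<le> 2 * ?r * (K * w s)"
        using r(2) K w(2)[OF s] by (intro mult_right_mono) auto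
      finally show "1/2 * ((e\<^sup>2 + ?Y s) powr (1/2 - 1) * d s) \<le> K * w s"
        unfolding eq pos_divide_le_eq[OF mult_pos_pos[OF zero_less_numeral r(1)]]
        by (simp only: mult.commute mult.left_commute)
    qed auto
    moreover have "loop_norm (V 0) = 0" by (simp add: V_def loop_norm_def)
    ultimately have "sqrt (e\<^sup>2 + ?Y 1) \<le> K * integral {0..1} w + e"
      using that pos[of 1] by (simp add: powr_half_sqrt)
    moreover have "loop_norm (V 1) \<le> sqrt (e\<^sup>2 + ?Y 1)" by (intro real_le_rsqrt) simp
    ultimately show ?thesis by linarith
  qed
  then have "loop_norm (V 1) \<le> K * integral {0..1} w" by (rule field_le_epsilon)
  then show ?thesis by (simp add: V_def)
qed

section \<open>Estimates along a path in terms of the metric speed\<close>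

context immersed_path
begin

lemma N_inner_le:
  fixes f g :: "real \<Rightarrow> real \<Rightarrow> 'a::euclidean_space"
  assumes "smooth_loops f" "smooth_loops g" "t \<in> {0..1}" "K \<ge> 0"
    and "\<And>\<theta>. \<theta> \<in> {0..2*pi} \<Longrightarrow> norm (f t \<theta>) \<le> K"
  shows "N t (\<lambda>t \<theta>. f t \<theta> \<bullet> g t \<theta>) \<le> K * N t g"
proof (rule N_scale)
  show "norm (f t \<theta> \<bullet> g t \<theta>) \<le> K * norm (g t \<theta>)" if "\<theta> \<in> {0..2*pi}" for \<theta>
    using Cauchy_Schwarz_ineq2[of "f t \<theta>" "g t \<theta>"] mult_right_mono[OF assms(5)[OF that] norm_ge_zero[of "g t \<theta>"]]
    by simp
qed (use assms in \<open>auto intro: smooth_loops_inner\<close>)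

lemma sup_D_funpow_le:
  fixes g :: "real \<Rightarrow> real \<Rightarrow> 'a::euclidean_space"
  assumes "smooth_loops g" "t \<in> {0..1}" "\<theta> \<in> {0..2*pi}" "0 < j"
  shows "norm ((D ^^ j) g t \<theta>) \<le> N t v * N t ((D ^^ Suc j) g)"
  using sup_D_le[OF smooth_D_funpow[OF assms(1), of "j - 1"] assms(2,3)] assms(4) by (cases j) auto

text \<open>A common bound for all products is multiplied by the sum of the binomial coefficients;
  this is the origin of the powers of 2 in the rates.\<close>

lemma sup_Leibniz_le:
  assumes B: "bounded_bilinear B" and f: "smooth_loops f" and g: "smooth_loops g" and t: "t \<in> {0..1}"
    and le: "\<And>i. i \<le> m \<Longrightarrow> norm (B ((D ^^ i) f t \<theta>) ((D ^^ (m - i)) g t \<theta>)) \<le> X"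
  shows "norm ((D ^^ m) (\<lambda>t \<theta>. B (f t \<theta>) (g t \<theta>)) t \<theta>) \<le> 2 ^ m * X"
proof -
  have "norm ((D ^^ m) (\<lambda>t \<theta>. B (f t \<theta>) (g t \<theta>)) t \<theta>) \<le> (\<Sum>i\<le>m. real (m choose i) * X)"
    unfolding Leibniz_D[OF B f g t] by (rule sum_norm_le) (auto intro!: mult_left_mono le)
  also have "\<dots> = real (\<Sum>i\<le>m. m choose i) * X"
    by (simp add: sum_distrib_right)
  also have "\<dots> = 2 ^ m * X"
    unfolding choose_row_sum by simp
  finally show ?thesis .
qed

lemma N_Leibniz_le:
  assumes B: "bounded_bilinear B" and f: "smooth_loops f" and g: "smooth_loops g" and t: "t \<in> {0..1}"
    and le: "\<And>i. i \<le> m \<Longrightarrow> N t (\<lambda>t \<theta>. B ((D ^^ i) f t \<theta>) ((D ^^ (m - i)) g t \<theta>)) \<le> X"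
  shows "N t ((D ^^ m) (\<lambda>t \<theta>. B (f t \<theta>) (g t \<theta>))) \<le> 2 ^ m * X"
proof -
  have "N t ((D ^^ m) (\<lambda>t \<theta>. B (f t \<theta>) (g t \<theta>))) =
      N t (\<lambda>t \<theta>. \<Sum>i\<le>m. real (m choose i) *\<^sub>R B ((D ^^ i) f t \<theta>) ((D ^^ (m - i)) g t \<theta>))"
    by (rule arg_cong[where f = "arc_norm (c t)"]) (rule ext, rule Leibniz_D[OF B f g t])
  also have "\<dots> \<le> (\<Sum>i\<le>m. N t (\<lambda>t \<theta>. real (m choose i) *\<^sub>R B ((D ^^ i) f t \<theta>) ((D ^^ (m - i)) g t \<theta>)))"
    by (rule N_sum[OF _ smooth_bilinear_Leibniz_term[OF B f g] t]) simp
  also have "\<dots> \<le> (\<Sum>i\<le>m. real (m choose i) * X)"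
  proof (rule sum_mono)
    fix i assume i: "i \<in> {..m}"
    show "N t (\<lambda>t \<theta>. real (m choose i) *\<^sub>R B ((D ^^ i) f t \<theta>) ((D ^^ (m - i)) g t \<theta>)) \<le> real (m choose i) * X"
      unfolding arc_norm_scaleR using le[of i] i by (simp add: mult_left_mono)
  qed
  also have "\<dots> = real (\<Sum>i\<le>m. m choose i) * X"
    by (simp add: sum_distrib_right)
  also have "\<dots> = 2 ^ m * X"
    unfolding choose_row_sum by simp
  finally show ?thesis .
qed

lemma N_scaleR_sup_le:
  assumes "smooth_loops u" "smooth_loops g" "t \<in> {0..1}" "K \<ge> 0"
    and "\<And>\<theta>. \<theta> \<in> {0..2*pi} \<Longrightarrow> \<bar>u t \<theta>\<bar> \<le> K"
  shows "N t (\<lambda>t \<theta>. u t \<theta> *\<^sub>R g t \<theta>) \<le> K * N t g"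
  by (rule N_scale) (use assms in \<open>auto intro!: smooth_loops_scaleR mult_right_mono\<close>)

end

text \<open>The rate constants must not involve the norm of the highest derivative: the evolution estimates
  are then linear in it and Gronwall's inequality applies on arbitrarily long paths.\<close>

definition velocity_rate :: "nat \<Rightarrow> real \<Rightarrow> real" where
  "velocity_rate m R =
     1 + (\<Sum>j\<le>m. \<bar>transport_coeff 1 m j + (if j = 0 then 1/2 else 0)\<bar>) * (2 ^ m * (1 + R) ^ 4)"

definition scalar_rate :: "real \<Rightarrow> nat \<Rightarrow> real \<Rightarrow> real \<Rightarrow> real" where
  "scalar_rate lam m R S =
     2 ^ Suc m * (1 + R\<^sup>2) + (\<Sum>j\<le>m. \<bar>transport_coeff lam m j + (if j = 0 then 1/2 else 0)\<bar>) *
       (2 ^ m * (1 + R\<^sup>2) * R * (1 + S))"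

text \<open>Only the coefficients of orders 0 and n are known to be positive. Each controls the norm
  of its own order with factor \<open>1 / sqrt (a j)\<close>, and interpolation bounds every order
  in between by the sum of these two norms (\<open>N_h_le\<close>).\<close>

definition metric_const :: "nat \<Rightarrow> (nat \<Rightarrow> real) \<Rightarrow> real" where
  "metric_const n a = 1 / sqrt (a 0) + 1 / sqrt (a n)"

locale sobolev_path = immersed_path +
  fixes n :: nat and a :: "nat \<Rightarrow> real"
  assumes n_ge_2: "n \<ge> 2"
    and a_nonneg: "\<And>j. j \<le> n \<Longrightarrow> a j \<ge> 0"
    and a_0: "a 0 \<noteq> 0" and a_n: "a n \<noteq> 0"
begin

definition metric_speed :: "real \<Rightarrow> real" where
  "metric_speed t = sqrt (sobolev_metric n a (c t) (h t) (h t))"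

definition \<beta> :: "real \<Rightarrow> real" where
  "\<beta> t = metric_const n a * metric_speed t"

lemma path_len_eq: "path_len n a c = integral {0..1} metric_speed"
  by (simp add: path_len_def metric_speed_def[abs_def] h_def)

lemma sobolev_metric_eq:
  assumes t: "t \<in> {0..1}"
  shows "sobolev_metric n a (c t) (h t) (h t) = (\<Sum>j\<le>n. a j * (N t ((D ^^ j) h))\<^sup>2)"
proof -
  have c: "continuous_on S ((D ^^ j) h t)" "continuous_on S (speed t)" for j S
    by (rule smooth_loops_continuous_theta[OF _ t], intro smooth_D_funpow smooth_h smooth_speed)+
  have "sobolev_metric n a (c t) (h t) (h t) =
      integral {0..2*pi} (\<lambda>\<theta>. \<Sum>j\<le>n. a j * ((norm ((D ^^ j) h t \<theta>))\<^sup>2 * speed t \<theta>))"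
    by (simp add: sobolev_metric_def path_Ds_funpow speed_def power2_norm_eq_inner sum_distrib_right mult.assoc)
  also have "\<dots> = (\<Sum>j\<le>n. a j * (N t ((D ^^ j) h))\<^sup>2)"
    unfolding N_sq[OF t]
    by (subst integral_sum) (auto intro!: integrable_continuous_real continuous_intros c)
  finally show ?thesis .
qed

lemma metric_speed_nonneg: "t \<in> {0..1} \<Longrightarrow> metric_speed t \<ge> 0"
  unfolding metric_speed_def by (auto simp: sobolev_metric_eq intro!: sum_nonneg mult_nonneg_nonneg a_nonneg)

lemma metric_const_nonneg: "metric_const n a \<ge> 0"
  using a_nonneg[of 0] a_nonneg[of n] by (simp add: metric_const_def)

lemma \<beta>_nonneg: "t \<in> {0..1} \<Longrightarrow> \<beta> t \<ge> 0"
  using metric_speed_nonneg metric_const_nonneg by (simp add: \<beta>_def)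

text \<open>The square root need not be differentiable at times when the path stands still; the
  weight \<open>w\<close> in the Gronwall estimates is therefore only asked to be
  continuous.\<close>

lemma continuous_metric_speed: "continuous_on {0..1} metric_speed"
proof -
  let ?f = "\<lambda>t \<theta>. (\<Sum>j\<le>n. a j * ((D ^^ j) h t \<theta> \<bullet> (D ^^ j) h t \<theta>)) * speed t \<theta>"
  have "smooth_loops ?f"
    by (intro smooth_loops_mult smooth_loops_sum smooth_loops_const smooth_loops_inner smooth_D_funpow
        smooth_h smooth_speed)
  then have "continuous_on ({0..1} \<times> cbox 0 (2*pi)) (\<lambda>(t, \<theta>). ?f t \<theta>)"
    by (rule continuous_on_subset[OF smooth_loops_continuous]) auto
  then have "continuous_on {0..1} (\<lambda>t. integral (cbox 0 (2*pi)) (?f t))"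
    by (rule integral_continuous_on_param)
  then show ?thesis
    unfolding metric_speed_def[abs_def] sobolev_metric_def
    by (intro continuous_on_real_sqrt) (simp add: path_Ds_funpow speed_def)
qed

lemma N_end_le:
  assumes t: "t \<in> {0..1}" and j: "j = 0 \<or> j = n"
  shows "N t ((D ^^ j) h) \<le> 1 / sqrt (a j) * metric_speed t"
proof -
  have aj: "a j > 0" using j a_nonneg[of 0] a_nonneg[of n] a_0 a_n by fastforce
  have "a j * (N t ((D ^^ j) h))\<^sup>2 \<le> (\<Sum>j\<le>n. a j * (N t ((D ^^ j) h))\<^sup>2)"
    using j a_nonneg by (intro member_le_sum) auto
  then have "sqrt (a j * (N t ((D ^^ j) h))\<^sup>2) \<le> metric_speed t"
    unfolding metric_speed_def sobolev_metric_eq[OF t] by (rule real_sqrt_le_mono)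
  then show ?thesis using aj by (simp add: real_sqrt_mult arc_norm_nonneg field_simps)
qed

lemma N_h_le:
  assumes t: "t \<in> {0..1}" and j: "j \<le> n"
  shows "N t ((D ^^ j) h) \<le> \<beta> t"
  using N_funpow_le_ends[OF smooth_h t j] N_end_le[OF t, of 0] N_end_le[OF t, of n]
  by (simp add: \<beta>_def metric_const_def algebra_simps)

lemma sup_h_le:
  assumes t: "t \<in> {0..1}" and th: "\<theta> \<in> {0..2*pi}" and j: "0 < j" "j < n" and R: "N t v \<le> R"
  shows "norm ((D ^^ j) h t \<theta>) \<le> R * \<beta> t"
proof -
  have "norm ((D ^^ j) h t \<theta>) \<le> N t v * N t ((D ^^ Suc j) h)"
    by (rule sup_D_funpow_le[OF smooth_h t th j(1)])
  also have "\<dots> \<le> R * \<beta> t"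
    using N_h_le[OF t, of "Suc j"] j R order_trans[OF arc_norm_nonneg R]
    by (intro mult_mono) (auto simp: arc_norm_nonneg)
  finally show ?thesis .
qed

text \<open>The highest factor in the Leibniz expansion of <v, D h> is the derivative of order k + 1
  of \<open>h\<close>, and its sup bound costs one derivative more, whence
  \<open>k + 2 \<le> n\<close>.\<close>

lemma sup_q_le:
  assumes t: "t \<in> {0..1}" and th: "\<theta> \<in> {0..2*pi}" and k: "k + 2 \<le> n" and R: "N t v \<le> R"
    and V: "\<And>i. i \<le> k \<Longrightarrow> norm ((D ^^ i) v t \<theta>) \<le> V"
  shows "\<bar>(D ^^ k) q t \<theta>\<bar> \<le> 2 ^ k * (V * (R * \<beta> t))"
proof -
  have "norm ((D ^^ k) q t \<theta>) \<le> 2 ^ k * (V * (R * \<beta> t))"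
    unfolding q_def
  proof (rule sup_Leibniz_le[OF bounded_bilinear_inner smooth_v smooth_D[OF smooth_h] t])
    fix i assume i: "i \<le> k"
    have "norm ((D ^^ (k - i)) (D h) t \<theta>) \<le> R * \<beta> t"
      using sup_h_le[OF t th _ _ R, of "Suc (k - i)"] k by (simp add: funpow_swap1)
    then have "norm ((D ^^ i) v t \<theta>) * norm ((D ^^ (k - i)) (D h) t \<theta>) \<le> V * (R * \<beta> t)"
      using V[OF i] order_trans[OF norm_ge_zero V[OF i]] by (intro mult_mono) auto
    then show "norm ((D ^^ i) v t \<theta> \<bullet> (D ^^ (k - i)) (D h) t \<theta>) \<le> V * (R * \<beta> t)"
      using Cauchy_Schwarz_ineq2[of "(D ^^ i) v t \<theta>" "(D ^^ (k - i)) (D h) t \<theta>"] by simp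
  qed
  then show ?thesis by simp
qed

text \<open>If no derivative falls on \<open>v\<close>, then |v| = 1 and the factor of order m + 1
  of \<open>h\<close> stays in L^2. Otherwise the factor of \<open>h\<close> has order at most m < n
  and is bounded in sup, while the derivative of \<open>v\<close> stays in L^2. So \<open>X\<close>
  enters linearly, as \<open>velocity_estimate\<close> requires.\<close>

lemma N_q_le:
  assumes t: "t \<in> {0..1}" and m: "m < n" and R: "N t v \<le> R" and X: "X \<ge> 0"
    and V: "\<And>i. 0 < i \<Longrightarrow> i \<le> m \<Longrightarrow> N t ((D ^^ i) v) \<le> X"
  shows "N t ((D ^^ m) q) \<le> 2 ^ m * ((1 + X * R) * \<beta> t)"
  unfolding q_def
proof (rule N_Leibniz_le[OF bounded_bilinear_inner smooth_v smooth_D[OF smooth_h] t])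
  fix i assume i: "i \<le> m"
  have R0: "R \<ge> 0" using R arc_norm_nonneg[of "c t" "v t"] by linarith
  have sm: "smooth_loops ((D ^^ i) v)" "smooth_loops ((D ^^ (m - i)) (D h))"
    by (intro smooth_D_funpow smooth_v smooth_D smooth_h)+
  show "N t (\<lambda>t \<theta>. (D ^^ i) v t \<theta> \<bullet> (D ^^ (m - i)) (D h) t \<theta>) \<le> (1 + X * R) * \<beta> t"
  proof (cases "i = 0")
    case True
    have "N t (\<lambda>t \<theta>. (D ^^ i) v t \<theta> \<bullet> (D ^^ (m - i)) (D h) t \<theta>) \<le> 1 * N t ((D ^^ (m - i)) (D h))"
      by (rule N_inner_le[OF sm t]) (use True norm_v[OF t] in auto)
    also have "\<dots> \<le> \<beta> t"
      using N_h_le[OF t, of "Suc m"] m True by (simp add: funpow_swap1)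
    also have "\<dots> \<le> (1 + X * R) * \<beta> t"
      using X R0 \<beta>_nonneg[OF t] by (simp add: algebra_simps)
    finally show ?thesis .
  next
    case False
    have "N t (\<lambda>t \<theta>. (D ^^ (m - i)) (D h) t \<theta> \<bullet> (D ^^ i) v t \<theta>) \<le> (R * \<beta> t) * N t ((D ^^ i) v)"
    proof (rule N_inner_le[OF sm(2,1) t])
      show "norm ((D ^^ (m - i)) (D h) t \<theta>) \<le> R * \<beta> t" if "\<theta> \<in> {0..2*pi}" for \<theta>
        using sup_h_le[OF t that _ _ R, of "Suc (m - i)"] m i False by (simp add: funpow_swap1)
    qed (use R0 \<beta>_nonneg[OF t] in simp)
    also have "\<dots> \<le> (R * \<beta> t) * X"
      using V[of i] i False R0 \<beta>_nonneg[OF t] by (intro mult_left_mono) auto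
    also have "\<dots> \<le> (1 + X * R) * \<beta> t"
      using \<beta>_nonneg[OF t] by (simp add: algebra_simps)
    finally show ?thesis by (simp add: inner_commute)
  qed
qed

section \<open>Evolution estimates for the unit tangent and for general transported
  quantities\<close>

lemma dt_v: "t \<in> {0..1} \<Longrightarrow> path_dt v t \<theta> = D h t \<theta> - 1 *\<^sub>R q t \<theta> *\<^sub>R v t \<theta>"
  using dt_D[OF smooth_path, of t \<theta>] by (simp add: v_def h_def)

lemma N_transport_le:
  fixes g r :: "real \<Rightarrow> real \<Rightarrow> 'a::euclidean_space"
  assumes g: "smooth_loops g" and r: "smooth_loops r" and t: "t \<in> {0..1}"
    and eq: "\<And>t \<theta>. t \<in> {0..1} \<Longrightarrow> path_dt g t \<theta> = r t \<theta> - lam *\<^sub>R q t \<theta> *\<^sub>R g t \<theta>"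
    and Y: "N t ((D ^^ m) r) \<le> Y"
    and X: "\<And>j. j \<le> m \<Longrightarrow> N t (\<lambda>t \<theta>. (D ^^ j) q t \<theta> *\<^sub>R (D ^^ (m - j)) g t \<theta>) \<le> X"
  shows "loop_norm (path_dt (weighted ((D ^^ m) g)) t) \<le>
    Y + (\<Sum>j\<le>m. \<bar>transport_coeff lam m j + (if j = 0 then 1/2 else 0)\<bar>) * X"
proof -
  let ?b = "\<lambda>j. transport_coeff lam m j + (if j = 0 then 1/2 else 0)"
  let ?f = "\<lambda>j t \<theta>. ?b j *\<^sub>R ((D ^^ j) q t \<theta> *\<^sub>R (D ^^ (m - j)) g t \<theta>)"
  have sm: "smooth_loops (?f j)" for j
    by (rule smooth_bilinear_Leibniz_term[OF bounded_bilinear_scaleR smooth_q g])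
  let ?F = "\<lambda>t \<theta>. (D ^^ m) r t \<theta> + (\<Sum>j\<le>m. ?f j t \<theta>)"
  have "path_dt (weighted ((D ^^ m) g)) t = weighted ?F t"
    by (rule ext) (rule transport_weighted[OF g r eq t])
  then have "loop_norm (path_dt (weighted ((D ^^ m) g)) t) = N t ?F"
    by (simp only: N_eq[of t ?F])
  also have "\<dots> \<le> N t ((D ^^ m) r) + N t (\<lambda>t \<theta>. \<Sum>j\<le>m. ?f j t \<theta>)"
    by (rule N_add[OF smooth_D_funpow[OF r] _ t]) (intro smooth_loops_sum sm)
  also have "N t (\<lambda>t \<theta>. \<Sum>j\<le>m. ?f j t \<theta>) \<le> (\<Sum>j\<le>m. N t (?f j))"
    by (rule N_sum[OF _ sm t]) simp
  also have "\<dots> \<le> (\<Sum>j\<le>m. \<bar>?b j\<bar> * X)"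
  proof (rule sum_mono)
    fix j assume j: "j \<in> {..m}"
    show "N t (?f j) \<le> \<bar>?b j\<bar> * X"
      unfolding arc_norm_scaleR using X[of j] j by (intro mult_left_mono) auto
  qed
  finally show ?thesis using Y by (simp add: sum_distrib_right)
qed

text \<open>Write z for the norm of order m; each commutator term is at most linear in z. For
  \<open>j = m\<close> all derivatives fall on \<open>q\<close> and |v| = 1. For
  \<open>j = 0 < m\<close> the factor \<open>q\<close> is bounded in sup by means of order 0. For
  \<open>0 < j < m\<close> the norm of \<open>(D ^^ (m - j)) v\<close> is at most \<open>R\<close>,
  and z can enter only through the sup of \<open>(D ^^ j) q\<close>.\<close>

lemma velocity_estimate:
  assumes t: "t \<in> {0..1}" and m: "m < n" and R0: "R \<ge> 0"
    and R: "\<And>i. i < m \<Longrightarrow> N t ((D ^^ i) v) \<le> R"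
  shows "loop_norm (path_dt (weighted ((D ^^ m) v)) t) \<le>
    velocity_rate m R * \<beta> t * (1 + N t ((D ^^ m) v))"
proof -
  define z where "z = N t ((D ^^ m) v)"
  \<comment> \<open>One factor (1 + R)^2 absorbs \<open>1 + (R + z) * R\<close> up to
    \<open>1 + z\<close>, a second one the product \<open>R * R\<close> that arises for
    \<open>0 < j < m\<close>; hence the exponent 4.\<close>
  define T where "T = 2 ^ m * (1 + R) ^ 4"
  have z: "z \<ge> 0" by (simp add: z_def arc_norm_nonneg)
  note b = \<beta>_nonneg[OF t]
  have RR: "1 + (R + z) * R \<le> (1 + R)\<^sup>2 * (1 + z)" "R \<le> 1 + R" "1 \<le> (1 + R)\<^sup>2"
    using R0 z by (auto simp: power2_eq_square algebra_simps)
  have pow: "(1 + R) ^ 4 = (1 + R)\<^sup>2 * (1 + R)\<^sup>2" by (simp flip: power_add)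
  have R4: "(1 + R)\<^sup>2 \<le> (1 + R) ^ 4" "1 \<le> (1 + R) ^ 4" "R \<le> (1 + R) ^ 4"
    using R0 self_le_power[of "1 + R" 4] by (auto intro!: power_increasing one_le_power)
  have X: "N t (\<lambda>t \<theta>. (D ^^ j) q t \<theta> *\<^sub>R (D ^^ (m - j)) v t \<theta>) \<le> T * \<beta> t * (1 + z)" if j: "j \<le> m" for j
  proof -
    have pj: "(2::real) ^ j \<le> 2 ^ m" using j by (simp add: power_increasing)
    consider "j = m" | "j = 0" "0 < m" | "0 < j" "j < m" using j by fastforce
    then show ?thesis
    proof cases
      case 1
      have "N t (\<lambda>t \<theta>. (D ^^ j) q t \<theta> *\<^sub>R (D ^^ (m - j)) v t \<theta>) \<le> 1 * N t ((D ^^ m) q)"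
        by (rule N_scale) (use 1 t norm_v[OF t] in \<open>auto intro!: smooth_loops_scaleR smooth_D_funpow smooth_q smooth_v\<close>)
      also have "\<dots> \<le> 2 ^ m * ((1 + R) ^ 4 * (1 + z) * \<beta> t)"
      proof (cases "m = 0")
        case True
        \<comment> \<open>At order 0 the hypothesis on lower orders is empty and the length is still
          unbounded. No derivative falls on \<open>v\<close>, so \<open>N_q_le\<close> applies with
          0 for \<open>X\<close>, which removes the length \<open>N t v\<close> from the
          bound.\<close>
        have "N t ((D ^^ m) q) \<le> 2 ^ m * ((1 + 0 * N t v) * \<beta> t)"
          by (rule N_q_le[OF t m]) (use True in auto)
        also have "\<dots> \<le> 2 ^ m * ((1 + R) ^ 4 * (1 + z) * \<beta> t)"
          using mult_mono[OF R4(2), of 1 "1 + z"] z R0 b by (intro mult_left_mono mult_right_mono) auto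
        finally show ?thesis by simp
      next
        case False
        have "N t ((D ^^ m) q) \<le> 2 ^ m * ((1 + (R + z) * R) * \<beta> t)"
        proof (rule N_q_le[OF t m])
          show "N t v \<le> R" using R[of 0] False by simp
          show "N t ((D ^^ i) v) \<le> R + z" if "0 < i" "i \<le> m" for i
            using R[of i] R0 z that by (cases "i = m") (auto simp: z_def)
        qed (use R0 z in simp)
        also have "\<dots> \<le> 2 ^ m * ((1 + R) ^ 4 * (1 + z) * \<beta> t)"
          using order_trans[OF RR(1) mult_right_mono[OF R4(1), of "1 + z"]] z b
          by (intro mult_left_mono mult_right_mono) auto
        finally show ?thesis by simp
      qed
      finally show ?thesis by (simp add: T_def algebra_simps)
    next
      case 2
      have "N t (\<lambda>t \<theta>. (D ^^ j) q t \<theta> *\<^sub>R (D ^^ (m - j)) v t \<theta>) \<le> (R * \<beta> t) * N t ((D ^^ m) v)"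
        unfolding 2
      proof (simp, rule N_scaleR_sup_le[OF smooth_q smooth_D_funpow[OF smooth_v] t])
        show "\<bar>q t \<theta>\<bar> \<le> R * \<beta> t" if "\<theta> \<in> {0..2*pi}" for \<theta>
          using sup_q_le[OF t that, of 0 R 1] n_ge_2 R[of 0] 2 norm_v[OF t] by simp
      qed (use R0 b in simp)
      also have "\<dots> \<le> (2 ^ m * (1 + R) ^ 4) * \<beta> t * (1 + z)"
        unfolding z_def[symmetric]
        using z R0 b mult_mono[of 1 "2 ^ m" R "(1 + R) ^ 4"] R4(3)
        by (intro mult_mono) auto
      finally show ?thesis by (simp add: T_def)
    next
      case 3
      define V where "V = 1 + (R + z) * R"
      have V: "V \<ge> 0" using R0 z by (simp add: V_def)
      have Nv: "N t v \<le> R" using R[of 0] 3 by simp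
      have "N t (\<lambda>t \<theta>. (D ^^ j) q t \<theta> *\<^sub>R (D ^^ (m - j)) v t \<theta>) \<le>
          (2 ^ j * (V * (R * \<beta> t))) * N t ((D ^^ (m - j)) v)"
      proof (rule N_scaleR_sup_le[OF smooth_D_funpow[OF smooth_q] smooth_D_funpow[OF smooth_v] t])
        fix \<theta> :: real assume th: "\<theta> \<in> {0..2*pi}"
        show "\<bar>(D ^^ j) q t \<theta>\<bar> \<le> 2 ^ j * (V * (R * \<beta> t))"
        proof (rule sup_q_le[OF t th _ Nv])
          fix i assume i: "i \<le> j"
          show "norm ((D ^^ i) v t \<theta>) \<le> V"
          proof (cases "i = 0")
            case True
            then show ?thesis using norm_v[OF t] R0 z by (simp add: V_def)
          next
            case False
            \<comment> \<open>The sup bound costs one derivative, so order m itself is reached when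
              \<open>Suc i = m\<close>; only here does \<open>z\<close> appear.\<close>
            have "N t ((D ^^ Suc i) v) \<le> R + z"
              using R[of "Suc i"] R0 z i 3 by (cases "Suc i = m") (auto simp: z_def)
            then have "N t v * N t ((D ^^ Suc i) v) \<le> R * (R + z)"
              using Nv R0 by (intro mult_mono) (auto simp: arc_norm_nonneg)
            then show ?thesis
              using sup_D_funpow_le[OF smooth_v t th, of i] False by (simp add: V_def mult.commute)
          qed
        qed (use 3 m in simp)
      qed (use V R0 b in simp)
      also have "\<dots> \<le> (2 ^ m * ((1 + R)\<^sup>2 * (1 + z) * (R * \<beta> t))) * R"
        using R[of "m - j"] 3 V R0 b z pj RR(1)
        by (intro mult_mono) (auto simp: V_def arc_norm_nonneg)
      also have "\<dots> = (2 ^ m * (1 + R)\<^sup>2 * \<beta> t * (1 + z)) * (R * R)"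
        by (simp add: algebra_simps)
      also have "\<dots> \<le> (2 ^ m * (1 + R)\<^sup>2 * \<beta> t * (1 + z)) * (1 + R)\<^sup>2"
        using R0 z b by (intro mult_left_mono) (auto simp: power2_eq_square algebra_simps)
      also have "\<dots> = T * \<beta> t * (1 + z)"
        unfolding T_def pow by (simp add: algebra_simps)
      finally show ?thesis .
    qed
  qed
  have Y: "N t ((D ^^ m) (D h)) \<le> \<beta> t * (1 + z)"
  proof -
    have "N t ((D ^^ m) (D h)) \<le> \<beta> t"
      using N_h_le[OF t, of "Suc m"] m by (simp add: funpow_swap1)
    also have "\<dots> \<le> \<beta> t * (1 + z)" using z b by (simp add: algebra_simps)
    finally show ?thesis .
  qed
  show ?thesis
    using N_transport_le[OF smooth_v smooth_D[OF smooth_h] t dt_v Y X]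
    unfolding velocity_rate_def z_def[symmetric] T_def[symmetric] by (simp add: algebra_simps)
qed


lemma sup_v_le:
  assumes t: "t \<in> {0..1}" and th: "\<theta> \<in> {0..2*pi}" and k: "k + 2 \<le> n"
    and R: "\<And>i. i < n \<Longrightarrow> N t ((D ^^ i) v) \<le> R"
  shows "norm ((D ^^ k) v t \<theta>) \<le> 1 + R\<^sup>2"
proof (cases "k = 0")
  case True
  then show ?thesis using norm_v[OF t] by simp
next
  case False
  have R0: "0 \<le> R" using R[of 0] n_ge_2 order_trans[OF arc_norm_nonneg, of "c t" "v t" R] by simp
  have "norm ((D ^^ k) v t \<theta>) \<le> N t v * N t ((D ^^ Suc k) v)"
    by (rule sup_D_funpow_le[OF smooth_v t th]) (use False in simp)
  also have "\<dots> \<le> R * R"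
    using R[of 0] R[of "Suc k"] R0 k by (intro mult_mono) (auto simp: arc_norm_nonneg)
  finally show ?thesis by (simp add: power2_eq_square)
qed

text \<open>All orders of \<open>v\<close> below n are bounded by now, so \<open>(D ^^ j) q\<close>
  is bounded in sup for every j <= m. The norm of order m of \<open>g\<close> occurs only in the
  term \<open>j = 0\<close>; in the others the norm of \<open>g\<close> has lower order and is at
  most \<open>S\<close>.\<close>

lemma scalar_estimate:
  fixes g r :: "real \<Rightarrow> real \<Rightarrow> 'a::euclidean_space"
  assumes g: "smooth_loops g" and r: "smooth_loops r" and t: "t \<in> {0..1}" and m: "m + 2 \<le> n"
    and eq: "\<And>t \<theta>. t \<in> {0..1} \<Longrightarrow> path_dt g t \<theta> = r t \<theta> - lam *\<^sub>R q t \<theta> *\<^sub>R g t \<theta>"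
    and R: "\<And>i. i < n \<Longrightarrow> N t ((D ^^ i) v) \<le> R"
    and Y: "N t ((D ^^ m) r) \<le> 2 ^ Suc m * ((1 + R\<^sup>2) * \<beta> t)"
    and S: "\<And>i. i < m \<Longrightarrow> N t ((D ^^ i) g) \<le> S" "S \<ge> 0"
  shows "loop_norm (path_dt (weighted ((D ^^ m) g)) t) \<le>
    scalar_rate lam m R S * \<beta> t * (1 + N t ((D ^^ m) g))"
proof -
  define z where "z = N t ((D ^^ m) g)"
  have z: "z \<ge> 0" by (simp add: z_def arc_norm_nonneg)
  note b = \<beta>_nonneg[OF t]
  have R0: "0 \<le> R" using R[of 0] n_ge_2 order_trans[OF arc_norm_nonneg, of "c t" "v t" R] by simp
  define T where "T = 2 ^ m * (1 + R\<^sup>2) * R * (1 + S)"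
  have X: "N t (\<lambda>t \<theta>. (D ^^ j) q t \<theta> *\<^sub>R (D ^^ (m - j)) g t \<theta>) \<le> T * \<beta> t * (1 + z)" if j: "j \<le> m" for j
  proof -
    have pj: "(2::real) ^ j \<le> 2 ^ m" using j by (simp add: power_increasing)
    have "N t (\<lambda>t \<theta>. (D ^^ j) q t \<theta> *\<^sub>R (D ^^ (m - j)) g t \<theta>) \<le>
        (2 ^ j * ((1 + R\<^sup>2) * (R * \<beta> t))) * N t ((D ^^ (m - j)) g)"
    proof (rule N_scaleR_sup_le[OF smooth_D_funpow[OF smooth_q] smooth_D_funpow[OF g] t])
      fix \<theta> :: real assume th: "\<theta> \<in> {0..2*pi}"
      show "\<bar>(D ^^ j) q t \<theta>\<bar> \<le> 2 ^ j * ((1 + R\<^sup>2) * (R * \<beta> t))"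
        by (rule sup_q_le[OF t th])
          (use j m R[of 0] sup_v_le[OF t th _ R] n_ge_2 in auto)
    qed (use R0 b in simp)
    also have "\<dots> \<le> (2 ^ m * ((1 + R\<^sup>2) * (R * \<beta> t))) * ((1 + S) * (1 + z))"
    proof (rule mult_mono)
      have "N t ((D ^^ (m - j)) g) \<le> (1 + S) + z"
        using S(1)[of "m - j"] S(2) z j by (cases "j = 0") (auto simp: z_def)
      also have "\<dots> \<le> (1 + S) * (1 + z)" using S(2) z by (simp add: algebra_simps)
      finally show "N t ((D ^^ (m - j)) g) \<le> (1 + S) * (1 + z)" .
    qed (use pj R0 b in \<open>auto simp: arc_norm_nonneg intro!: mult_right_mono\<close>)
    also have "\<dots> = T * \<beta> t * (1 + z)" by (simp add: T_def algebra_simps)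
    finally show ?thesis .
  qed
  have "2 ^ Suc m * ((1 + R\<^sup>2) * \<beta> t) \<le> 2 ^ Suc m * ((1 + R\<^sup>2) * \<beta> t) * (1 + z)"
    using mult_left_mono[of 1 "1 + z" "2 ^ Suc m * ((1 + R\<^sup>2) * \<beta> t)"] z b by simp
  with Y have Y': "N t ((D ^^ m) r) \<le> 2 ^ Suc m * ((1 + R\<^sup>2) * \<beta> t) * (1 + z)" by linarith
  show ?thesis
    using N_transport_le[OF g r t eq Y' X]
    unfolding scalar_rate_def z_def[symmetric] T_def[symmetric] by (simp add: algebra_simps)
qed

lemma tangent_eq: "tangent (c t) = v t"
  by (rule ext) (simp add: tangent_def v_def path_Ds_def Ds_def)

end

section \<open>Evolution of the curvature and of the arc-length derivative of the logarithmic
  speed\<close>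

lemma bounded_linear_J: "bounded_linear J"
  by (rule linear_conv_bounded_linear[THEN iffD1])
    (auto intro!: linearI simp: J_def vec_eq_iff forall_2 vector_2)

lemma norm_J [simp]: "norm (J x) = norm x"
  by (simp add: norm_eq_sqrt_inner J_def inner_vec_def sum_2 vector_2 algebra_simps)

text \<open>In the plane a vector orthogonal to a unit vector \<open>x\<close> is the multiple
  \<open>y \<bullet> J x\<close> of \<open>J x\<close>, and \<open>J\<close> preserves inner
  products.\<close>

lemma inner_J_decompose:
  assumes "norm x = 1" "y \<bullet> x = 0"
  shows "y \<bullet> J w = (y \<bullet> J x) * (x \<bullet> w)"
proof -
  have "x $ 1 * x $ 1 + x $ 2 * x $ 2 = 1" "y $ 1 * x $ 1 + y $ 2 * x $ 2 = 0"
    using assms by (simp_all add: norm_eq_sqrt_inner inner_vec_def sum_2)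
  then show ?thesis
    unfolding J_def inner_vec_def sum_2 vector_2 inner_real_def by algebra
qed

lemma bounded_bilinear_inner_J: "bounded_bilinear (\<lambda>x y. x \<bullet> J y)"
  by (rule bounded_bilinear.comp[OF bounded_bilinear_inner bounded_linear_ident bounded_linear_J])

context immersed_path
begin

lemma smooth_curvature: "smooth_loops (\<lambda>t. curvature (c t))"
proof (rule smooth_loops_cong)
  show "smooth_loops (\<lambda>t \<theta>. D v t \<theta> \<bullet> J (v t \<theta>))"
    by (intro smooth_loops_bilinear[OF bounded_bilinear_inner_J] smooth_D smooth_v)
  show "D v t \<theta> \<bullet> J (v t \<theta>) = curvature (c t) \<theta>" for t \<theta>
  proof -
    have "tangent (c t) = v t" by (rule ext) (simp add: tangent_def v_def path_Ds_def Ds_def)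
    then show ?thesis by (simp add: curvature_def path_Ds_def)
  qed
qed

lemma smooth_log_speed: "smooth_loops (\<lambda>t \<theta>. ln (speed t \<theta>))"
  by (intro smooth_loops_ln smooth_speed speed_pos)

lemma smooth_Ds_log_speed: "smooth_loops (\<lambda>t. Ds (c t) (\<lambda>\<phi>. ln (norm (dtheta (c t) \<phi>))))"
  using smooth_D[OF smooth_log_speed] by (simp add: path_Ds_def[abs_def] speed_def)

end

context sobolev_path
begin

text \<open>One \<open>- q D v\<close> comes from commuting the time derivative with
  \<open>D\<close>, the other from differentiating the term \<open>- q v\<close> of
  \<open>dt_v\<close>; together they give the 2. The \<open>D q\<close> term is tangential and drops
  out against \<open>J v\<close>. Differentiating \<open>J v\<close> contributes nothing:
  \<open>path_dt v\<close> is orthogonal to \<open>v\<close>, so its rotation is tangential, while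
  \<open>D v\<close> is normal.\<close>

lemma dt_curvature:
  assumes t: "t \<in> {0..1}"
  shows "path_dt (\<lambda>t. curvature (c t)) t \<theta> =
    D (D h) t \<theta> \<bullet> J (v t \<theta>) - 2 *\<^sub>R q t \<theta> *\<^sub>R curvature (c t) \<theta>"
proof -
  let ?k = "D v t \<theta> \<bullet> J (v t \<theta>)"
  have k: "curvature (c t) \<theta> = D v t \<theta> \<bullet> J (v t \<theta>)" for t \<theta>
    by (simp add: curvature_def tangent_eq path_Ds_def)
  note sv = smooth_v smooth_D[OF smooth_v]
  have "path_dt (\<lambda>t. curvature (c t)) t \<theta> =
      D v t \<theta> \<bullet> J (path_dt v t \<theta>) + path_dt (D v) t \<theta> \<bullet> J (v t \<theta>)"
    using bounded_bilinear.has_vector_derivative[OF bounded_bilinear_inner_J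
        smooth_loops_has_dt[OF sv(2) t] smooth_loops_has_dt[OF sv(1) t], of \<theta>]
    by (intro path_dt_eq[OF _ t]) (simp add: k)
  also have "path_dt (D v) t \<theta> = D (path_dt v) t \<theta> - q t \<theta> *\<^sub>R D v t \<theta>"
    by (rule dt_D[OF smooth_v t])
  also have "D (path_dt v) t \<theta> = D (\<lambda>t \<theta>. D h t \<theta> + (-1) *\<^sub>R (q t \<theta> *\<^sub>R v t \<theta>)) t \<theta>"
    by (rule fun_cong[OF D_cong]) (simp add: dt_v[OF t])
  also have "\<dots> = D (D h) t \<theta> - (D q t \<theta> *\<^sub>R v t \<theta> + q t \<theta> *\<^sub>R D v t \<theta>)"
    using D_add[OF smooth_D[OF smooth_h] smooth_loops_linear[OF bounded_linear_scaleR_right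
          smooth_loops_scaleR[OF smooth_q smooth_v], of "-1"] t, of \<theta>]
      D_scaleR[OF smooth_loops_scaleR[OF smooth_q smooth_v] t, of "-1" \<theta>]
      D_bilinear[OF bounded_bilinear_scaleR smooth_q smooth_v t, of \<theta>]
    by simp
  finally have eq: "path_dt (\<lambda>t. curvature (c t)) t \<theta> =
      D v t \<theta> \<bullet> J (D h t \<theta> - q t \<theta> *\<^sub>R v t \<theta>) +
      (D (D h) t \<theta> - (D q t \<theta> *\<^sub>R v t \<theta> + q t \<theta> *\<^sub>R D v t \<theta>) - q t \<theta> *\<^sub>R D v t \<theta>) \<bullet> J (v t \<theta>)"
    using dt_v[OF t, of \<theta>] by simp
  have "D (\<lambda>t \<theta>. v t \<theta> \<bullet> v t \<theta>) t \<theta> = 0"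
    by (rule D_eqI[OF _ t]) (simp add: norm_v[OF t] flip: power2_norm_eq_inner)
  then have orth: "D v t \<theta> \<bullet> v t \<theta> = 0"
    using D_bilinear[OF bounded_bilinear_inner smooth_v smooth_v t, of \<theta>] by (simp add: inner_commute)
  have vJv: "v t \<theta> \<bullet> J (v t \<theta>) = 0"
    by (simp add: J_def inner_vec_def sum_2 vector_2)
  have "D v t \<theta> \<bullet> J (D h t \<theta>) = ?k * q t \<theta>"
    unfolding q_def by (rule inner_J_decompose[OF norm_v[OF t] orth])
  then have "D v t \<theta> \<bullet> J (D h t \<theta> - q t \<theta> *\<^sub>R v t \<theta>) = 0"
    by (simp add: bounded_bilinear.diff_right[OF bounded_bilinear_inner_J]
        bounded_bilinear.scaleR_right[OF bounded_bilinear_inner_J])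
  then show ?thesis
    unfolding eq k by (simp only: inner_diff_left inner_add_left inner_scaleR_left vJv) simp
qed

text \<open>If all derivatives fall on \<open>h\<close>, then \<open>J v\<close> has norm 1 and
  order m + 2 <= n of \<open>h\<close> is used in L^2. Otherwise the order of \<open>h\<close> is
  below n, which allows its sup bound, and the derivative of \<open>v\<close> stays in L^2.\<close>

lemma N_curvature_source_le:
  assumes t: "t \<in> {0..1}" and m: "m + 2 \<le> n"
    and R: "\<And>i. i < n \<Longrightarrow> N t ((D ^^ i) v) \<le> R"
  shows "N t ((D ^^ m) (\<lambda>t \<theta>. D (D h) t \<theta> \<bullet> J (v t \<theta>))) \<le> 2 ^ Suc m * ((1 + R\<^sup>2) * \<beta> t)"
proof -
  have R0: "0 \<le> R" using R[of 0] n_ge_2 order_trans[OF arc_norm_nonneg, of "c t" "v t" R] by simp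
  note b = \<beta>_nonneg[OF t]
  have "N t ((D ^^ m) (\<lambda>t \<theta>. D (D h) t \<theta> \<bullet> J (v t \<theta>))) \<le> 2 ^ m * ((1 + R\<^sup>2) * \<beta> t)"
  proof (rule N_Leibniz_le[OF bounded_bilinear_inner_J smooth_D[OF smooth_D[OF smooth_h]] smooth_v t])
    fix i assume i: "i \<le> m"
    have Dh: "(D ^^ i) (D (D h)) = (D ^^ (i + 2)) h" by (simp add: funpow_swap1)
    have sm: "smooth_loops ((D ^^ i) (D (D h)))" "smooth_loops ((D ^^ (m - i)) v)"
      "smooth_loops (\<lambda>t \<theta>. J ((D ^^ (m - i)) v t \<theta>))"
      by (intro smooth_D_funpow smooth_v smooth_D smooth_h smooth_loops_linear[OF bounded_linear_J])+
    show "N t (\<lambda>t \<theta>. (D ^^ i) (D (D h)) t \<theta> \<bullet> J ((D ^^ (m - i)) v t \<theta>)) \<le> (1 + R\<^sup>2) * \<beta> t"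
    proof (cases "i = m")
      case True
      have "N t (\<lambda>t \<theta>. J ((D ^^ (m - i)) v t \<theta>) \<bullet> (D ^^ i) (D (D h)) t \<theta>) \<le> 1 * N t ((D ^^ i) (D (D h)))"
        by (rule N_inner_le[OF sm(3,1) t]) (use True norm_v[OF t] in auto)
      also have "\<dots> \<le> \<beta> t"
        using N_h_le[OF t, of "i + 2"] m True unfolding Dh by simp
      also have "\<dots> \<le> (1 + R\<^sup>2) * \<beta> t" using b by (simp add: algebra_simps)
      finally show ?thesis by (simp add: inner_commute)
    next
      case False
      have "N t (\<lambda>t \<theta>. (D ^^ i) (D (D h)) t \<theta> \<bullet> J ((D ^^ (m - i)) v t \<theta>)) \<le>
          (R * \<beta> t) * N t (\<lambda>t \<theta>. J ((D ^^ (m - i)) v t \<theta>))"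
      proof (rule N_inner_le[OF sm(1,3) t])
        show "norm ((D ^^ i) (D (D h)) t \<theta>) \<le> R * \<beta> t" if "\<theta> \<in> {0..2*pi}" for \<theta>
          unfolding Dh using sup_h_le[OF t that, of "i + 2"] R[of 0] n_ge_2 i m False by simp
      qed (use R0 b in simp)
      also have "\<dots> \<le> (R * \<beta> t) * (1 * N t ((D ^^ (m - i)) v))"
        by (rule mult_left_mono, rule N_scale[OF sm(3,2) t]) (use R0 b in auto)
      also have "\<dots> \<le> (R * \<beta> t) * R"
        using R[of "m - i"] i m R0 b by (intro mult_left_mono) auto
      also have "\<dots> \<le> (1 + R\<^sup>2) * \<beta> t" using b by (simp add: algebra_simps power2_eq_square)
      finally show ?thesis .
    qed
  qed
  \<comment> \<open>The spare factor 2 matches the source \<open>D q\<close> of the other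
    functional, where m + 1 derivatives are expanded; both then fit
    \<open>transported_functional\<close>.\<close>
  also have "\<dots> \<le> 2 ^ Suc m * ((1 + R\<^sup>2) * \<beta> t)"
    using b by simp
  finally show ?thesis .
qed

text \<open>The time derivative of \<open>ln (speed t \<theta>)\<close> is exactly \<open>q\<close>,
  so the formula is the commutator \<open>dt_D\<close> applied to it.\<close>

lemma dt_Ds_log_speed:
  assumes t: "t \<in> {0..1}"
  shows "path_dt (\<lambda>t. Ds (c t) (\<lambda>\<phi>. ln (norm (dtheta (c t) \<phi>)))) t \<theta> =
    D q t \<theta> - 1 *\<^sub>R q t \<theta> *\<^sub>R Ds (c t) (\<lambda>\<phi>. ln (norm (dtheta (c t) \<phi>))) \<theta>"
proof -
  let ?s = "\<lambda>t \<theta>. ln (speed t \<theta>)"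
  have s: "(\<lambda>t. Ds (c t) (\<lambda>\<phi>. ln (norm (dtheta (c t) \<phi>)))) = D ?s"
    by (simp add: path_Ds_def[abs_def] speed_def)
  have "path_dt ?s t \<theta> = q t \<theta>" for \<theta>
    by (rule path_dt_eq[OF _ t])
      (use has_vector_derivative_ln[OF dt_speed[OF t] speed_pos[OF t], of \<theta>] speed_pos[OF t, of \<theta>] in simp)
  then have "D (path_dt ?s) t = D q t" by (rule D_cong)
  then have "path_dt (D ?s) t \<theta> = D q t \<theta> - 1 *\<^sub>R q t \<theta> *\<^sub>R D ?s t \<theta>"
    using dt_D[OF smooth_log_speed t, of \<theta>] by simp
  then show ?thesis unfolding s[symmetric] by simp
qed

text \<open>The source differentiated m times is order m + 1 of \<open>q\<close>; the bound
  \<open>m + 2 \<le> n\<close> is the condition \<open>Suc m < n\<close> of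
  \<open>N_q_le\<close>.\<close>

lemma N_log_speed_source_le:
  assumes t: "t \<in> {0..1}" and m: "m + 2 \<le> n"
    and R: "\<And>i. i < n \<Longrightarrow> N t ((D ^^ i) v) \<le> R"
  shows "N t ((D ^^ m) (D q)) \<le> 2 ^ Suc m * ((1 + R\<^sup>2) * \<beta> t)"
proof -
  have R0: "0 \<le> R" using R[of 0] n_ge_2 order_trans[OF arc_norm_nonneg, of "c t" "v t" R] by simp
  have "N t ((D ^^ Suc m) q) \<le> 2 ^ Suc m * ((1 + R * R) * \<beta> t)"
    by (rule N_q_le[OF t]) (use m R[of 0] R n_ge_2 R0 in auto)
  then show ?thesis by (simp add: funpow_swap1 power2_eq_square)
qed

end

section \<open>Uniform bounds and the Lipschitz estimate\<close>

text \<open>Covers the orders strictly below \<open>m\<close>. It is a predicate on a single curve,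
  so that a bound at the end of one path can serve as the initial bound of another.\<close>

definition bounded_upto ::
    "nat \<Rightarrow> real \<Rightarrow> ((real \<Rightarrow> real ^ 2) \<Rightarrow> real \<Rightarrow> 'a::real_normed_vector) \<Rightarrow> (real \<Rightarrow> real ^ 2) \<Rightarrow> bool" where
  "bounded_upto m R G c \<longleftrightarrow> (\<forall>i<m. arc_norm c ((Ds c ^^ i) (G c)) \<le> R)"

lemma bounded_upto_mono: "bounded_upto m R G c \<Longrightarrow> R \<le> S \<Longrightarrow> k \<le> m \<Longrightarrow> bounded_upto k S G c"
  unfolding bounded_upto_def by (meson order_trans less_le_trans)

lemma bounded_upto_exists: "\<exists>R\<ge>0. bounded_upto m R G c"
proof (intro exI conjI)
  show "(\<Sum>i<m. arc_norm c ((Ds c ^^ i) (G c))) \<ge> 0" by (intro sum_nonneg arc_norm_nonneg)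
  show "bounded_upto m (\<Sum>i<m. arc_norm c ((Ds c ^^ i) (G c))) G c"
    unfolding bounded_upto_def by (auto intro!: member_le_sum arc_norm_nonneg)
qed

lemma velocity_rate_nonneg: "R \<ge> 0 \<Longrightarrow> velocity_rate m R \<ge> 0"
  unfolding velocity_rate_def by (intro add_nonneg_nonneg mult_nonneg_nonneg sum_nonneg) auto

lemma scalar_rate_nonneg: "R \<ge> 0 \<Longrightarrow> S \<ge> 0 \<Longrightarrow> scalar_rate lam m R S \<ge> 0"
  unfolding scalar_rate_def by (intro add_nonneg_nonneg mult_nonneg_nonneg sum_nonneg) auto

context sobolev_path
begin

lemma velocity_bounded_upto:
  "bounded_upto m R tangent (c t) \<longleftrightarrow> (\<forall>i<m. N t ((D ^^ i) v) \<le> R)"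
  by (simp add: bounded_upto_def path_Ds_funpow tangent_eq)

lemma functional_bounded_upto:
  "bounded_upto m R G (c t) \<longleftrightarrow> (\<forall>i<m. N t ((D ^^ i) (\<lambda>t. G (c t))) \<le> R)"
  by (simp add: bounded_upto_def path_Ds_funpow)

lemma functional_bounded_uptoD:
  "bounded_upto m R G (c t) \<Longrightarrow> i < m \<Longrightarrow> N t ((D ^^ i) (\<lambda>t. G (c t))) \<le> R"
  by (simp add: functional_bounded_upto)

lemma N_Gronwall:
  fixes g :: "real \<Rightarrow> real \<Rightarrow> 'a::euclidean_space"
  assumes g: "smooth_loops g" and A: "A \<ge> 0"
    and le: "\<And>t. t \<in> {0..1} \<Longrightarrow> loop_norm (path_dt (weighted g) t) \<le> A * \<beta> t * (1 + N t g)"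
    and R: "N 0 g \<le> R" and L: "path_len n a c \<le> L" and t: "t \<in> {0..1}"
  shows "N t g \<le> (1 + R) * exp (3 * (A * metric_const n a) * L)"
proof -
  have "loop_norm (weighted g t) \<le> (1 + loop_norm (weighted g 0)) * exp (3 * (A * metric_const n a) * L)"
    by (rule loop_norm_Gronwall[OF smooth_weighted[OF g] _ continuous_metric_speed metric_speed_nonneg _ _ t])
      (use A metric_const_nonneg le L in \<open>auto simp: path_len_eq N_eq \<beta>_def mult.assoc\<close>)
  also have "\<dots> \<le> (1 + R) * exp (3 * (A * metric_const n a) * L)"
    using R by (simp add: N_eq)
  finally show ?thesis by (simp add: N_eq)
qed

lemma N_Lipschitz:
  fixes g :: "real \<Rightarrow> real \<Rightarrow> 'a::euclidean_space"
  assumes g: "smooth_loops g" and A: "A \<ge> 0"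
    and le: "\<And>t. t \<in> {0..1} \<Longrightarrow> loop_norm (path_dt (weighted g) t) \<le> A * \<beta> t * (1 + N t g)"
    and S: "\<And>t. t \<in> {0..1} \<Longrightarrow> N t g \<le> S"
  shows "loop_norm (\<lambda>\<theta>. weighted g 1 \<theta> - weighted g 0 \<theta>) \<le> A * metric_const n a * (1 + S) * path_len n a c"
  unfolding path_len_eq
proof (rule loop_norm_Lipschitz[OF smooth_weighted[OF g] _ continuous_metric_speed metric_speed_nonneg])
  have "0 \<le> S" using order_trans[OF arc_norm_nonneg S[of 0]] by simp
  then show "0 \<le> A * metric_const n a * (1 + S)" using A metric_const_nonneg by simp
  fix t :: real assume t: "t \<in> {0..1}"
  have "A * \<beta> t * (1 + N t g) \<le> A * \<beta> t * (1 + S)"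
    using S[OF t] A \<beta>_nonneg[OF t] by (intro mult_left_mono) auto
  with le[OF t] show "loop_norm (path_dt (weighted g) t) \<le> A * metric_const n a * (1 + S) * metric_speed t"
    by (simp add: \<beta>_def algebra_simps)
qed

end

text \<open>Gronwall raises one order at a time, with a rate built from the bound for the lower
  orders. \<open>S\<close> stands before the quantifier over paths; this uniformity is what lets the
  estimates pass to the infimum of the lengths.\<close>

lemma velocity_bounds:
  assumes "m \<le> n" "R \<ge> 0"
  shows "\<exists>S\<ge>0. \<forall>c. sobolev_path c n a \<longrightarrow> path_len n a c \<le> L \<longrightarrow> bounded_upto m R tangent (c 0) \<longrightarrow>
    (\<forall>t\<in>{0..1}. bounded_upto m S tangent (c t))"
  using assms(1)
proof (induction m)
  case 0
  then show ?case by (auto simp: bounded_upto_def)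
next
  case (Suc m)
  then obtain S where S: "S \<ge> 0" "\<And>c t. \<lbrakk>sobolev_path c n a; path_len n a c \<le> L; bounded_upto m R tangent (c 0);
      t \<in> {0..1}\<rbrakk> \<Longrightarrow> bounded_upto m S tangent (c t)"
    by (metis Suc_leD)
  define S' where "S' = (1 + R) * exp (3 * (velocity_rate m S * metric_const n a) * L)"
  have "bounded_upto (Suc m) (max S S') tangent (c t)"
    if c: "sobolev_path c n a" "path_len n a c \<le> L" "bounded_upto (Suc m) R tangent (c 0)" and t: "t \<in> {0..1}"
    for c t
  proof -
    interpret sobolev_path c n a by (rule c(1))
    have S_t: "N t ((D ^^ i) v) \<le> S" if "t \<in> {0..1}" "i < m" for t i
      using S(2)[OF c(1,2) bounded_upto_mono[OF c(3)] that(1)] that(2) velocity_bounded_upto by auto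
    have "N t ((D ^^ m) v) \<le> S'"
      unfolding S'_def
    proof (rule N_Gronwall[OF smooth_D_funpow[OF smooth_v] velocity_rate_nonneg[OF S(1)] _ _ c(2) t])
      show "loop_norm (path_dt (weighted ((D ^^ m) v)) t) \<le> velocity_rate m S * \<beta> t * (1 + N t ((D ^^ m) v))"
        if "t \<in> {0..1}" for t
        by (rule velocity_estimate[OF that _ S(1) S_t[OF that]]) (use Suc.prems in auto)
      show "N 0 ((D ^^ m) v) \<le> R" using c(3) velocity_bounded_upto by auto
    qed
    with S_t[OF t] show ?thesis
      unfolding velocity_bounded_upto by (auto simp: less_Suc_eq intro: max.coboundedI1 max.coboundedI2)
  qed
  then show ?case using S(1) by (intro exI[of _ "max S S'"]) auto
qed

text \<open>What the curvature and the arc-length derivative of log|c'| have in common: an evolution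
  equation whose source is bounded linearly in \<open>\<beta>\<close> once the tangent is bounded.
  The remaining estimates are carried out once for both.\<close>

definition transported_functional ::
    "nat \<Rightarrow> (nat \<Rightarrow> real) \<Rightarrow> ((real \<Rightarrow> real ^ 2) \<Rightarrow> real \<Rightarrow> real) \<Rightarrow> real \<Rightarrow> bool" where
  "transported_functional n a G lam \<longleftrightarrow>
     (\<forall>c. sobolev_path c n a \<longrightarrow> smooth_loops (\<lambda>t. G (c t)) \<and>
       (\<exists>r. smooth_loops r \<and>
         (\<forall>t\<in>{0..1}. \<forall>\<theta>. path_dt (\<lambda>t. G (c t)) t \<theta> = r t \<theta> - lam *\<^sub>R immersed_path.q c t \<theta> *\<^sub>R G (c t) \<theta>) \<and>
         (\<forall>t\<in>{0..1}. \<forall>R. bounded_upto n R tangent (c t) \<longrightarrow> (\<forall>m. m + 2 \<le> n \<longrightarrow>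
            arc_norm (c t) ((path_Ds c ^^ m) r t) \<le> 2 ^ Suc m * ((1 + R\<^sup>2) * sobolev_path.\<beta> c n a t)))))"

lemma transported_curvature: "transported_functional n a curvature 2"
  unfolding transported_functional_def
proof (intro allI impI)
  fix c assume "sobolev_path c n a"
  then interpret sobolev_path c n a .
  have "smooth_loops (\<lambda>t \<theta>. D (D h) t \<theta> \<bullet> J (v t \<theta>))"
    by (intro smooth_loops_bilinear[OF bounded_bilinear_inner_J] smooth_D smooth_v smooth_h)
  then show "smooth_loops (\<lambda>t. curvature (c t)) \<and>
       (\<exists>r. smooth_loops r \<and>
         (\<forall>t\<in>{0..1}. \<forall>\<theta>. path_dt (\<lambda>t. curvature (c t)) t \<theta> = r t \<theta> - 2 *\<^sub>R q t \<theta> *\<^sub>R curvature (c t) \<theta>) \<and>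
         (\<forall>t\<in>{0..1}. \<forall>R. bounded_upto n R tangent (c t) \<longrightarrow> (\<forall>m. m + 2 \<le> n \<longrightarrow>
            N t ((D ^^ m) r) \<le> 2 ^ Suc m * ((1 + R\<^sup>2) * \<beta> t))))"
    using smooth_curvature dt_curvature N_curvature_source_le velocity_bounded_upto
    by (intro conjI exI[of _ "\<lambda>t \<theta>. D (D h) t \<theta> \<bullet> J (v t \<theta>)"]) auto
qed

lemma transported_Ds_log_speed:
  "transported_functional n a (\<lambda>c. Ds c (\<lambda>\<phi>. ln (norm (dtheta c \<phi>)))) 1"
  unfolding transported_functional_def
proof (intro allI impI)
  fix c assume "sobolev_path c n a"
  then interpret sobolev_path c n a .
  let ?G = "\<lambda>c. Ds c (\<lambda>\<phi>. ln (norm (dtheta c \<phi>)))"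
  show "smooth_loops (\<lambda>t. ?G (c t)) \<and>
       (\<exists>r. smooth_loops r \<and>
         (\<forall>t\<in>{0..1}. \<forall>\<theta>. path_dt (\<lambda>t. ?G (c t)) t \<theta> = r t \<theta> - 1 *\<^sub>R q t \<theta> *\<^sub>R ?G (c t) \<theta>) \<and>
         (\<forall>t\<in>{0..1}. \<forall>R. bounded_upto n R tangent (c t) \<longrightarrow> (\<forall>m. m + 2 \<le> n \<longrightarrow>
            N t ((D ^^ m) r) \<le> 2 ^ Suc m * ((1 + R\<^sup>2) * \<beta> t))))"
    using smooth_Ds_log_speed dt_Ds_log_speed N_log_speed_source_le velocity_bounded_upto smooth_D[OF smooth_q]
    by (intro conjI exI[of _ "D q"]) auto
qed

lemma transported_functional_rate:
  assumes G: "transported_functional n a G lam" and c: "sobolev_path c n a"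
    and m: "m + 2 \<le> n" and t: "t \<in> {0..1}"
    and v: "bounded_upto n R tangent (c t)" and g: "bounded_upto m S G (c t)" and S: "S \<ge> 0"
  shows "loop_norm (path_dt (immersed_path.weighted c ((path_Ds c ^^ m) (\<lambda>t. G (c t)))) t) \<le>
    scalar_rate lam m R S * sobolev_path.\<beta> c n a t * (1 + arc_norm (c t) ((path_Ds c ^^ m) (\<lambda>t. G (c t)) t))"
proof -
  interpret sobolev_path c n a by (rule c)
  obtain r where r: "smooth_loops (\<lambda>t. G (c t))" "smooth_loops r"
    "\<And>t \<theta>. t \<in> {0..1} \<Longrightarrow> path_dt (\<lambda>t. G (c t)) t \<theta> = r t \<theta> - lam *\<^sub>R q t \<theta> *\<^sub>R G (c t) \<theta>"
    "\<And>t R m. \<lbrakk>t \<in> {0..1}; bounded_upto n R tangent (c t); m + 2 \<le> n\<rbrakk> \<Longrightarrow>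
        N t ((D ^^ m) r) \<le> 2 ^ Suc m * ((1 + R\<^sup>2) * \<beta> t)"
    using G c unfolding transported_functional_def by metis
  show ?thesis
    by (rule scalar_estimate[OF r(1,2) t m r(3) _ r(4)[OF t v m] _ S])
      (use v functional_bounded_uptoD[OF g] in \<open>auto simp: velocity_bounded_upto\<close>)
qed

text \<open>The bound \<open>V\<close> on all orders of the tangent below n comes first and is
  independent of \<open>G\<close>. It fixes the rate in \<open>scalar_estimate\<close>, after which
  Gronwall raises the order of \<open>G\<close> step by step.\<close>

lemma transported_functional_bounds:
  assumes G: "transported_functional n a G lam" and "m < n" "R \<ge> 0"
  shows "\<exists>S\<ge>0. \<forall>c. sobolev_path c n a \<longrightarrow> path_len n a c \<le> L \<longrightarrow> bounded_upto n R tangent (c 0) \<longrightarrow>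
    bounded_upto m R G (c 0) \<longrightarrow> (\<forall>t\<in>{0..1}. bounded_upto m S G (c t))"
  using assms(2)
proof (induction m)
  case 0
  then show ?case by (auto simp: bounded_upto_def)
next
  case (Suc m)
  then obtain S where S: "S \<ge> 0" "\<And>c t. \<lbrakk>sobolev_path c n a; path_len n a c \<le> L; bounded_upto n R tangent (c 0);
      bounded_upto m R G (c 0); t \<in> {0..1}\<rbrakk> \<Longrightarrow> bounded_upto m S G (c t)"
    by (metis Suc_lessD)
  obtain V where V: "V \<ge> 0" "\<And>c t. \<lbrakk>sobolev_path c n a; path_len n a c \<le> L; bounded_upto n R tangent (c 0);
      t \<in> {0..1}\<rbrakk> \<Longrightarrow> bounded_upto n V tangent (c t)"
    using velocity_bounds[OF order_refl \<open>R \<ge> 0\<close>] by metis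
  define S' where "S' = (1 + R) * exp (3 * (scalar_rate lam m V S * metric_const n a) * L)"
  have "bounded_upto (Suc m) (max S S') G (c t)"
    if c: "sobolev_path c n a" "path_len n a c \<le> L" "bounded_upto n R tangent (c 0)"
      "bounded_upto (Suc m) R G (c 0)" and t: "t \<in> {0..1}"
    for c t
  proof -
    interpret sobolev_path c n a by (rule c(1))
    have S_t: "bounded_upto m S G (c t)" if "t \<in> {0..1}" for t
      by (rule S(2)[OF c(1-3) bounded_upto_mono[OF c(4)] that]) auto
    have sm: "smooth_loops (\<lambda>t. G (c t))"
      using G c(1) by (simp add: transported_functional_def)
    have "N t ((D ^^ m) (\<lambda>t. G (c t))) \<le> S'"
      unfolding S'_def
    proof (rule N_Gronwall[OF smooth_D_funpow[OF sm] scalar_rate_nonneg[OF V(1) S(1)] _ _ c(2) t])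
      show "loop_norm (path_dt (weighted ((D ^^ m) (\<lambda>t. G (c t)))) t) \<le>
          scalar_rate lam m V S * \<beta> t * (1 + N t ((D ^^ m) (\<lambda>t. G (c t))))" if "t \<in> {0..1}" for t
        by (rule transported_functional_rate[OF G c(1) _ that V(2)[OF c(1-3) that] S_t[OF that] S(1)])
          (use Suc.prems in simp)
      show "N 0 ((D ^^ m) (\<lambda>t. G (c t))) \<le> R" by (rule functional_bounded_uptoD[OF c(4)]) simp
    qed
    with S_t[OF t] show ?thesis
      unfolding functional_bounded_upto by (auto simp: less_Suc_eq intro: max.coboundedI1 max.coboundedI2)
  qed
  then show ?case using S(1) by (intro exI[of _ "max S S'"]) auto
qed

text \<open>The common shape of \<open>curvature_map\<close> and \<open>log_speed_map\<close>. The
  root of the speed is the square root of the density of ds, so the L^2(d theta) norm of this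
  function is the L^2(ds) norm of the derivative.\<close>

definition half_density :: "nat \<Rightarrow> ((real \<Rightarrow> real ^ 2) \<Rightarrow> real \<Rightarrow> real) \<Rightarrow> (real \<Rightarrow> real ^ 2) \<Rightarrow> real \<Rightarrow> real" where
  "half_density k G c \<theta> = (Ds c ^^ k) (G c) \<theta> * sqrt (norm (dtheta c \<theta>))"

lemma half_density_norm: "loop_norm (half_density k G c) = arc_norm c ((Ds c ^^ k) (G c))"
  by (simp add: arc_norm_def half_density_def[abs_def] mult.commute)

lemma transported_functional_Lipschitz:
  assumes G: "transported_functional n a G lam" and k: "k + 2 \<le> n" and R: "R \<ge> 0"
  shows "\<exists>K\<ge>0. \<forall>c. sobolev_path c n a \<longrightarrow> path_len n a c \<le> L \<longrightarrow> bounded_upto n R tangent (c 0) \<longrightarrow>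
    bounded_upto (Suc k) R G (c 0) \<longrightarrow>
    loop_norm (\<lambda>\<theta>. half_density k G (c 1) \<theta> - half_density k G (c 0) \<theta>) \<le> K * path_len n a c"
proof -
  obtain S where S: "S \<ge> 0" "\<And>c t. \<lbrakk>sobolev_path c n a; path_len n a c \<le> L; bounded_upto n R tangent (c 0);
      bounded_upto (Suc k) R G (c 0); t \<in> {0..1}\<rbrakk> \<Longrightarrow> bounded_upto (Suc k) S G (c t)"
    using transported_functional_bounds[OF G _ R, of "Suc k" L] k by (metis Suc_lessI add_2_eq_Suc' Suc_le_lessD)
  obtain V where V: "V \<ge> 0" "\<And>c t. \<lbrakk>sobolev_path c n a; path_len n a c \<le> L; bounded_upto n R tangent (c 0);
      t \<in> {0..1}\<rbrakk> \<Longrightarrow> bounded_upto n V tangent (c t)"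
    using velocity_bounds[OF order_refl R] by metis
  define K where "K = scalar_rate lam k V S * \<bar>metric_const n a\<bar> * (1 + S)"
  have "loop_norm (\<lambda>\<theta>. half_density k G (c 1) \<theta> - half_density k G (c 0) \<theta>) \<le> K * path_len n a c"
    if c: "sobolev_path c n a" "path_len n a c \<le> L" "bounded_upto n R tangent (c 0)"
      "bounded_upto (Suc k) R G (c 0)" for c
  proof -
    interpret sobolev_path c n a by (rule c(1))
    have sm: "smooth_loops (\<lambda>t. G (c t))"
      using G c(1) by (simp add: transported_functional_def)
    have w: "weighted ((D ^^ k) (\<lambda>t. G (c t))) t = half_density k G (c t)" for t
      by (rule ext) (simp add: weighted_def half_density_def path_Ds_funpow speed_def mult.commute)
    have "loop_norm (\<lambda>\<theta>. weighted ((D ^^ k) (\<lambda>t. G (c t))) 1 \<theta> - weighted ((D ^^ k) (\<lambda>t. G (c t))) 0 \<theta>) \<le>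
        scalar_rate lam k V S * metric_const n a * (1 + S) * path_len n a c"
    proof (rule N_Lipschitz[OF smooth_D_funpow[OF sm] scalar_rate_nonneg[OF V(1) S(1)]])
      fix t :: real assume t: "t \<in> {0..1}"
      note St = S(2)[OF c t]
      show "loop_norm (path_dt (weighted ((D ^^ k) (\<lambda>t. G (c t)))) t) \<le>
          scalar_rate lam k V S * \<beta> t * (1 + N t ((D ^^ k) (\<lambda>t. G (c t))))"
        by (rule transported_functional_rate[OF G c(1) k t V(2)[OF c(1-3) t] bounded_upto_mono[OF St] S(1)]) auto
      show "N t ((D ^^ k) (\<lambda>t. G (c t))) \<le> S" by (rule functional_bounded_uptoD[OF St]) simp
    qed
    then show ?thesis using metric_const_nonneg by (simp add: w K_def)
  qed
  moreover have "K \<ge> 0" using scalar_rate_nonneg[OF V(1) S(1)] S(1) by (simp add: K_def)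
  ultimately show ?thesis by blast
qed

section \<open>Passage to the L2 maps on \<open>Imm\<close> with the geodesic distance\<close>

lemma L2_norm_eq_loop_norm:
  assumes "continuous_on {0..2*pi} u"
  shows "L2_norm u = loop_norm u"
proof -
  have "continuous_on {0..2*pi} (\<lambda>\<theta>. (u \<theta>)\<^sup>2)" by (intro continuous_intros assms)
  from set_lebesgue_integral_eq_integral(2)[OF absolutely_integrable_continuous_real[OF this]]
  show ?thesis by (simp add: L2_norm_def loop_norm_def)
qed

lemma continuous_in_L2_circle:
  assumes "continuous_on {0..2*pi} u" "circle_fun u"
  shows "u \<in> L2_circle"
proof -
  have "continuous_on {0..2*pi} (\<lambda>\<theta>. (u \<theta>)\<^sup>2)" by (intro continuous_intros assms)
  from absolutely_integrable_continuous_real[OF this] absolutely_integrable_continuous_real[OF assms(1)] assms(2)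
  show ?thesis
    by (auto simp: L2_circle_def set_borel_measurable_def set_integrable_def dest: borel_measurable_integrable)
qed

context
  fixes n k :: nat and a :: "nat \<Rightarrow> real" and G :: "(real \<Rightarrow> real ^ 2) \<Rightarrow> real \<Rightarrow> real" and lam :: real
  assumes n: "n \<ge> 2" and a_nonneg: "\<And>j. j \<le> n \<Longrightarrow> a j \<ge> 0" and a0: "a 0 \<noteq> 0" and an: "a n \<noteq> 0"
    and G: "transported_functional n a G lam" and k: "k + 2 \<le> n"
begin

lemma sobolev_path_smooth_paths:
  assumes "p \<in> smooth_paths c1 c2" shows "sobolev_path p n a"
  by unfold_locales
    (use assms n a_nonneg a0 an smooth_loops_path in \<open>auto simp: smooth_paths_def\<close>)

lemma sobolev_path_constant:
  assumes "c \<in> Imm" shows "sobolev_path (\<lambda>t. c) n a"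
  by unfold_locales
    (use assms n a_nonneg a0 an smooth_loops_constant_path in \<open>auto simp: Imm_def\<close>)

lemma half_density_regular:
  assumes "c \<in> Imm"
  shows "continuous_on {0..2*pi} (half_density k G c)" "circle_fun (half_density k G c)"
proof -
  \<comment> \<open>A single curve is treated as a constant path, so its regularity follows from the
    closure lemmas for paths.\<close>
  interpret sobolev_path "\<lambda>t. c" n a by (rule sobolev_path_constant[OF assms])
  have "smooth_loops (weighted ((D ^^ k) (\<lambda>t. G c)))"
    using G sobolev_path_constant[OF assms] unfolding transported_functional_def
    by (intro smooth_weighted smooth_D_funpow) blast
  moreover have "weighted ((D ^^ k) (\<lambda>t. G c)) = (\<lambda>t. half_density k G c)"
    by (rule ext)+ (simp add: weighted_def half_density_def path_Ds_funpow speed_def mult.commute)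
  ultimately have s: "smooth_loops (\<lambda>t. half_density k G c)"
    by simp
  show "continuous_on {0..2*pi} (half_density k G c)"
    using smooth_loops_continuous_theta[OF s, of 0] by simp
  show "circle_fun (half_density k G c)"
    using s by (force simp: smooth_loops_def)
qed

lemma L2_dist_half_density:
  assumes "c1 \<in> Imm" "c2 \<in> Imm"
  shows "L2_dist (half_density k G c1) (half_density k G c2) =
    loop_norm (\<lambda>\<theta>. half_density k G c2 \<theta> - half_density k G c1 \<theta>)"
proof -
  have "L2_dist (half_density k G c1) (half_density k G c2) =
    loop_norm (\<lambda>\<theta>. half_density k G c1 \<theta> - half_density k G c2 \<theta>)"
    unfolding L2_dist_def by (intro L2_norm_eq_loop_norm continuous_intros half_density_regular assms)
  then show ?thesis by (simp add: loop_norm_def norm_minus_commute power2_commute)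
qed

lemma half_density_in_L2: "half_density k G \<in> Imm \<rightarrow> L2_circle"
  using continuous_in_L2_circle half_density_regular by blast

lemma bounded_upto_both_exists:
  "\<exists>R\<ge>0. bounded_upto n R tangent c \<and> bounded_upto (Suc k) R G c"
proof -
  obtain R1 where R1: "R1 \<ge> 0" "bounded_upto n R1 tangent c" using bounded_upto_exists by blast
  obtain R2 where R2: "R2 \<ge> 0" "bounded_upto (Suc k) R2 G c" using bounded_upto_exists by blast
  have "bounded_upto n (max R1 R2) tangent c" "bounded_upto (Suc k) (max R1 R2) G c"
    using bounded_upto_mono[OF R1(2), of "max R1 R2" n] bounded_upto_mono[OF R2(2), of "max R1 R2" "Suc k"] by auto
  then show ?thesis using R1(1) by (intro exI[of _ "max R1 R2"]) auto
qed

text \<open>Bounds are asked only of the initial curve, and \<open>K\<close> is the same for all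
  paths of length at most \<open>L\<close>. For continuity \<open>c1\<close> is one fixed curve; for
  the ball estimate it is any point of the ball.\<close>

lemma half_density_Lipschitz:
  assumes "R \<ge> 0"
  obtains K where "K \<ge> 0" "\<And>c1 c2 p. \<lbrakk>p \<in> smooth_paths c1 c2; path_len n a p \<le> L;
      bounded_upto n R tangent c1; bounded_upto (Suc k) R G c1\<rbrakk> \<Longrightarrow>
      L2_dist (half_density k G c1) (half_density k G c2) \<le> K * path_len n a p"
proof -
  obtain K where K: "K \<ge> 0" "\<And>c. \<lbrakk>sobolev_path c n a; path_len n a c \<le> L; bounded_upto n R tangent (c 0);
      bounded_upto (Suc k) R G (c 0)\<rbrakk> \<Longrightarrow>
      loop_norm (\<lambda>\<theta>. half_density k G (c 1) \<theta> - half_density k G (c 0) \<theta>) \<le> K * path_len n a c"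
    using transported_functional_Lipschitz[OF G k assms] by metis
  show ?thesis
  proof (rule that[OF K(1)])
    fix c1 c2 p assume p: "p \<in> smooth_paths c1 c2" "path_len n a p \<le> L"
      "bounded_upto n R tangent c1" "bounded_upto (Suc k) R G c1"
    then have e: "p 0 = c1" "p 1 = c2" "c1 \<in> Imm" "c2 \<in> Imm" by (auto simp: smooth_paths_def)
    show "L2_dist (half_density k G c1) (half_density k G c2) \<le> K * path_len n a p"
      using K(2)[OF sobolev_path_smooth_paths[OF p(1)] p(2)] p(3,4) e by (simp add: L2_dist_half_density)
  qed
qed

lemma geod_dist_less_path:
  assumes "geod_dist n a c1 c2 < ereal N"
  obtains p where "p \<in> smooth_paths c1 c2" "path_len n a p < N"
  using assms by (auto simp: geod_dist_def INF_less_iff)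

lemma continuous_half_density: "continuous_Imm_L2 n a (half_density k G)"
  unfolding continuous_Imm_L2_def
proof (intro ballI allI impI)
  fix c1 and e :: real assume c1: "c1 \<in> Imm" and e: "e > 0"
  obtain R where R: "R \<ge> 0" "bounded_upto n R tangent c1" "bounded_upto (Suc k) R G c1"
    using bounded_upto_both_exists by blast
  obtain K where K: "K \<ge> 0" "\<And>c1 c2 p. \<lbrakk>p \<in> smooth_paths c1 c2; path_len n a p \<le> 1;
      bounded_upto n R tangent c1; bounded_upto (Suc k) R G c1\<rbrakk> \<Longrightarrow>
      L2_dist (half_density k G c1) (half_density k G c2) \<le> K * path_len n a p"
    using half_density_Lipschitz[OF R(1), of 1] by blast
  \<comment> \<open>The 1 keeps every path used within the length for which \<open>K\<close> was
    obtained; \<open>K + 1\<close> avoids division by zero and makes the final inequality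
    strict.\<close>
  define d where "d = min 1 (e / (K + 1))"
  have "L2_dist (half_density k G c1) (half_density k G c2) < e"
    if c2: "c2 \<in> Imm" "geod_dist n a c1 c2 < ereal d" for c2
  proof -
    obtain p where p: "p \<in> smooth_paths c1 c2" "path_len n a p < d"
      using geod_dist_less_path[OF c2(2)] by blast
    have "L2_dist (half_density k G c1) (half_density k G c2) \<le> K * path_len n a p"
      by (rule K(2)[OF p(1) _ R(2,3)]) (use p(2) in \<open>simp add: d_def\<close>)
    also have "\<dots> \<le> K * (e / (K + 1))"
      using p(2) K(1) by (intro mult_left_mono) (auto simp: d_def)
    also have "\<dots> < e" using K(1) e by (simp add: field_simps)
    finally show ?thesis .
  qed
  moreover have "d > 0" using e K(1) by (simp add: d_def)
  ultimately show "\<exists>\<delta>>0. \<forall>c2\<in>Imm. geod_dist n a c1 c2 < ereal \<delta> \<longrightarrow>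
      L2_dist (half_density k G c1) (half_density k G c2) < e" by blast
qed

text \<open>The triangle inequality for \<^const>\<open>geod_dist\<close> (which would require smoothing concatenated paths) is
  avoided: for paths in the ball that are longer than \<open>r\<close>, boundedness of the functional suffices.\<close>

lemma Lipschitz_half_density: "lipschitz_on_balls_Imm_L2 n a (half_density k G)"
  unfolding lipschitz_on_balls_Imm_L2_def
proof (intro ballI allI impI)
  fix c0 and r :: real assume c0: "c0 \<in> Imm" and r: "r > 0"
  let ?F = "half_density k G"
  obtain R where R: "R \<ge> 0" "bounded_upto n R tangent c0" "bounded_upto (Suc k) R G c0"
    using bounded_upto_both_exists by blast
  obtain V where V: "V \<ge> 0" "\<And>c t. \<lbrakk>sobolev_path c n a; path_len n a c \<le> r; bounded_upto n R tangent (c 0);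
      t \<in> {0..1}\<rbrakk> \<Longrightarrow> bounded_upto n V tangent (c t)"
    using velocity_bounds[OF order_refl R(1)] by metis
  obtain S where S: "S \<ge> 0" "\<And>c t. \<lbrakk>sobolev_path c n a; path_len n a c \<le> r; bounded_upto n R tangent (c 0);
      bounded_upto (Suc k) R G (c 0); t \<in> {0..1}\<rbrakk> \<Longrightarrow> bounded_upto (Suc k) S G (c t)"
    using transported_functional_bounds[OF G _ R(1), of "Suc k" r] k
    by (metis Suc_lessI add_2_eq_Suc' Suc_le_lessD)
  \<comment> \<open>Every point of the ball ends a path of length below \<open>r\<close> from the
    centre, so the bounds at the centre propagate to it.\<close>
  define M where "M = max V S"
  have ball: "c \<in> Imm" "bounded_upto n M tangent c" "bounded_upto (Suc k) M G c"
    if "c \<in> metric_ball n a c0 r" for c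
  proof -
    show "c \<in> Imm" using that by (simp add: metric_ball_def)
    have "geod_dist n a c0 c < ereal r" using that by (simp add: metric_ball_def)
    then obtain p where p: "p \<in> smooth_paths c0 c" "path_len n a p < r"
      by (rule geod_dist_less_path)
    note sp = sobolev_path_smooth_paths[OF p(1)]
    have ends: "p 0 = c0" "p 1 = c" using p(1) by (auto simp: smooth_paths_def)
    show "bounded_upto n M tangent c"
      using V(2)[OF sp, of 1] p(2) R ends by (auto simp: M_def intro: bounded_upto_mono)
    show "bounded_upto (Suc k) M G c"
      using S(2)[OF sp, of 1] p(2) R ends by (auto simp: M_def intro: bounded_upto_mono)
  qed
  have M: "M \<ge> 0" using V(1) by (simp add: M_def)
  obtain K where K: "K \<ge> 0" "\<And>c1 c2 p. \<lbrakk>p \<in> smooth_paths c1 c2; path_len n a p \<le> r;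
      bounded_upto n M tangent c1; bounded_upto (Suc k) M G c1\<rbrakk> \<Longrightarrow>
      L2_dist (?F c1) (?F c2) \<le> K * path_len n a p"
    using half_density_Lipschitz[OF M, of r] by blast
  \<comment> \<open>\<open>K\<close> handles paths of length at most \<open>r\<close>. On longer
    ones the distance of the images is at most 2M, hence at most 2M/r times the length. The summand
    1 makes \<open>L\<close> positive, so that it can be divided by.\<close>
  define L where "L = K + 2 * M / r + 1"
  have L: "L > 0" "K \<le> L" "2 * M / r \<le> L" using K(1) M r by (auto simp: L_def add_nonneg_pos)
  have main: "ereal (L2_dist (?F c1) (?F c2)) \<le> ereal L * geod_dist n a c1 c2"
    if c1: "c1 \<in> metric_ball n a c0 r" and c2: "c2 \<in> metric_ball n a c0 r" for c1 c2
  proof -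
    have "L2_dist (?F c1) (?F c2) \<le> L * path_len n a p" if p: "p \<in> smooth_paths c1 c2" for p
    proof (cases "path_len n a p \<le> r")
      case True
      interpret sobolev_path p n a by (rule sobolev_path_smooth_paths[OF p])
      have "path_len n a p \<ge> 0"
        unfolding path_len_eq
        by (rule integral_nonneg[OF integrable_continuous_real[OF continuous_metric_speed]])
          (rule metric_speed_nonneg)
      then show ?thesis
        using K(2)[OF p True ball(2,3)[OF c1]] mult_right_mono[OF L(2)] by (meson order_trans)
    next
      case False
      have "L2_dist (?F c1) (?F c2) \<le> loop_norm (?F c2) + loop_norm (?F c1)"
        unfolding L2_dist_half_density[OF ball(1)[OF c1] ball(1)[OF c2]]
        using loop_norm_triangle[OF half_density_regular(1)[OF ball(1)[OF c2]]
            continuous_on_minus[OF half_density_regular(1)[OF ball(1)[OF c1]]]]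
          loop_norm_scaleR[of "-1" "?F c1"] by simp
      also have "\<dots> \<le> 2 * M"
        using ball(3)[OF c1] ball(3)[OF c2] unfolding half_density_norm bounded_upto_def
        by (auto dest!: spec[of _ k])
      also have "\<dots> = 2 * M / r * r" using r by simp
      also have "\<dots> \<le> L * path_len n a p"
        using L(1,3) False r M by (intro mult_mono) auto
      finally show ?thesis .
    qed
    \<comment> \<open>Divided by \<open>L\<close>, the estimate is a lower bound for the length of
      each path and passes to the infimum; this includes the case of no path, where the distance is
      infinite.\<close>
    then have "ereal (L2_dist (?F c1) (?F c2) / L) \<le> geod_dist n a c1 c2"
      unfolding geod_dist_def using L(1) by (intro INF_greatest) (simp add: divide_le_eq mult.commute)
    then have "ereal L * ereal (L2_dist (?F c1) (?F c2) / L) \<le> ereal L * geod_dist n a c1 c2"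
      using L(1) by (intro ereal_mult_left_mono) auto
    then show ?thesis using L(1) by simp
  qed
  then show "\<exists>L\<ge>0. \<forall>c1\<in>metric_ball n a c0 r. \<forall>c2\<in>metric_ball n a c0 r.
      ereal (L2_dist (?F c1) (?F c2)) \<le> ereal L * geod_dist n a c1 c2"
    using L(1) by (intro exI[of _ L]) auto
qed

end

lemma curvature_map_eq: "curvature_map k = half_density k curvature"
  by (rule ext)+ (simp add: curvature_map_def half_density_def)

lemma log_speed_map_eq:
  "log_speed_map k = half_density k (\<lambda>c. Ds c (\<lambda>\<phi>. ln (norm (dtheta c \<phi>))))"
  by (rule ext)+ (simp add: log_speed_map_def half_density_def funpow_swap1)

theorem theorem1p2:
  fixes n k :: nat and a :: "nat \<Rightarrow> real"
  assumes "n \<ge> 2"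
    and "\<And>j. j \<le> n \<Longrightarrow> a j \<ge> 0"
    and "a 0 \<noteq> 0" and "a n \<noteq> 0"
    and "k \<le> n - 2"
  shows "curvature_map k \<in> Imm \<rightarrow> L2_circle \<and>
         continuous_Imm_L2 n a (curvature_map k) \<and>
         lipschitz_on_balls_Imm_L2 n a (curvature_map k) \<and>
         log_speed_map k \<in> Imm \<rightarrow> L2_circle \<and>
         continuous_Imm_L2 n a (log_speed_map k) \<and>
         lipschitz_on_balls_Imm_L2 n a (log_speed_map k)"
proof -
  have k: "k + 2 \<le> n" using assms(1,5) by simp
  note facts = half_density_in_L2 continuous_half_density Lipschitz_half_density
  show ?thesis
    unfolding curvature_map_eq log_speed_map_eq
    using facts[OF assms(1-4) transported_curvature k] facts[OF assms(1-4) transported_Ds_log_speed k]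
    by blast
qed

end
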